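(* Let $X_d=\otimes_{j=1}^dX_{1,j}$. Let $(a_d)$ be a real sequence and $(b_d)$ a positive sequence with $b_d\to\infty$. Assume the uniform negligibility condition $$\lim_{d\to\infty}\max_{j=1,\dots,d}\sum_{k=1}^\infty\bar\lambda^{X_{1,j}}_k\,\mathbf 1\bigl(\bar\lambda^{X_{1,j}}_k<e^{-\tau b_d}\bigr)=0\quad\text{for all }\tau>0.$$ Let $q:(0,1)\to\mathbb R$ be non-increasing and $G$ a distribution function with $q(\varepsilon)=G^{-1}(1-\varepsilon^2)$ for all $\varepsilon\in C(q)$, and suppose $$\ln n^{X_d}(\varepsilon)=a_d+q(\varepsilon)b_d+o(b_d),\quad d\to\infty,\quad\text{for all }\varepsilon\in C(q).$$ Then $G$ is self-decomposable and its Lévy spectral function $L$ vanishes on $(-\infty,0)$. If moreover $G$ is non-degenerate, then $b_{d+1}/b_d\to1$ as $d\to\infty$.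
   Context: For a centered Hilbert-space random element $Z$ with finite second moment, $\lambda^Z_1\ge\lambda^Z_2\ge\dots\ge 0$ denote the eigenvalues of its covariance operator $K^Z$ with multiplicity (padded with zeros), $\Lambda^Z=\sum_k\lambda^Z_k$, $\bar\lambda^Z_k=\lambda^Z_k/\Lambda^Z$. Let $X_{1,j}$ be centered random elements of separable Hilbert spaces $H_{1,j}$ with $\mathbb E\|X_{1,j}\|^2<\infty$ and $\lambda^{X_{1,j}}_1>0$; $X_d=\otimes_{j=1}^dX_{1,j}$ means $X_d$ is a centered random element of $H_d=\otimes_{j=1}^dH_{1,j}$ with covariance operator $\otimes_{j=1}^dK^{X_{1,j}}$ (eigenvalues $\prod_j\lambda^{X_{1,j}}_{k_j}$). The complexity is $n^{X_d}(\varepsilon)=\min\{n\in\mathbb N:\sum_{k>n}\bar\lambda^{X_d}_k\le\varepsilon^2\}$, equivalently the minimal rank $n$ of a linear approximation $\sum_{m=1}^nl_m(X_d)\psi_m$ ($l_m\in H_d^*$, $\psi_m\in H_d$) with $\mathbb E\|X_d-\sum l_m(X_d)\psi_m\|^2\le\varepsilon^2\mathbb E\|X_d\|^2$. A distribution function is non-decreasing, right-continuous, with limits $0,1$ at $\mp\infty$; degenerate means $F(x)=\mathbf 1(x\ge a)$. $C(f)$: continuity points of $f$; $f^{-1}(y)=\inf\{x:f(x)\ge y\}$. A distribution function $F$ is self-decomposable if for every $\alpha>1$ there is a distribution function $F_\alpha$ with $F(x)=\int_{\mathbb R}F_\alpha(x-y)\,dF(\alpha y)$ for all $x$. Such $F$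 is infinitely divisible and its characteristic function has the Lévy representation $f(t)=\exp\{i\gamma t-\sigma^2t^2/2+\int_{|x|>0}(e^{itx}-1-\frac{itx}{1+x^2})\,dL(x)\}$ with $\gamma\in\mathbb R$, $\sigma^2\ge0$, and Lévy spectral function $L:\mathbb R\setminus\{0\}\to\mathbb R$ non-decreasing on $(-\infty,0)$ and on $(0,\infty)$, $L(\pm\infty)=0$, $\int_{0<|x|<\tau}x^2dL(x)<\infty$. *)

theory Defs
  imports "HOL-Probability.Probability"
begin

definition distribution_function :: "(real \<Rightarrow> real) \<Rightarrow> bool" where
  "distribution_function F \<longleftrightarrow> mono F \<and> (\<forall>x. continuous (at_right x) F)
     \<and> (F \<longlongrightarrow> 0) at_bot \<and> (F \<longlongrightarrow> 1) at_top"

definition degenerate_df :: "(real \<Rightarrow> real) \<Rightarrow> bool" where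
  "degenerate_df F \<longleftrightarrow> (\<exists>a. \<forall>x. F x = (if x \<ge> a then 1 else 0))"

definition gen_inv :: "(real \<Rightarrow> real) \<Rightarrow> real \<Rightarrow> real" where
  "gen_inv f y = Inf {x. f x \<ge> y}"

text \<open>F(x) = int F_alpha(x - y) dF(alpha y): the integrator y |-> F(alpha y) is a
  distribution function, whose Lebesgue-Stieltjes measure is interval_measure.\<close>
definition self_decomposable :: "(real \<Rightarrow> real) \<Rightarrow> bool" where
  "self_decomposable F \<longleftrightarrow> (\<forall>\<alpha>>1. \<exists>F\<^sub>\<alpha>. distribution_function F\<^sub>\<alpha> \<and>
     (\<forall>x. F x = (\<integral>y. F\<^sub>\<alpha> (x - y) \<partial>interval_measure (\<lambda>y. F (\<alpha> * y)))))"

text \<open>Lebesgue-Stieltjes measure on the real line minus 0 generated by a Levy spectral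
  function L (non-decreasing on each half-line), prescribed on intervals with endpoints at
  continuity points of L on the same side of 0 (such points are dense).\<close>
definition stieltjes_measure_punctured :: "(real \<Rightarrow> real) \<Rightarrow> real measure \<Rightarrow> bool" where
  "stieltjes_measure_punctured L \<nu> \<longleftrightarrow> sets \<nu> = sets borel \<and> emeasure \<nu> {0} = 0 \<and>
     (\<forall>a b. ((0 < a \<and> a \<le> b) \<or> (a \<le> b \<and> b < 0)) \<longrightarrow> isCont L a \<longrightarrow> isCont L b \<longrightarrow>
        emeasure \<nu> {a<..b} = ennreal (L b - L a))"

definition levy_representation ::
  "(real \<Rightarrow> real) \<Rightarrow> real \<Rightarrow> real \<Rightarrow> (real \<Rightarrow> real) \<Rightarrow> bool" where
  "levy_representation G \<gamma> \<sigma>2 L \<longleftrightarrow> \<sigma>2 \<ge> 0 \<and>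
     mono_on {..<0} L \<and> mono_on {0<..} L \<and>
     (L \<longlongrightarrow> 0) at_bot \<and> (L \<longlongrightarrow> 0) at_top \<and>
     (\<exists>\<nu>. stieltjes_measure_punctured L \<nu> \<and>
        (\<forall>\<tau>>0. (\<integral>\<^sup>+x. ennreal (x\<^sup>2) * indicator {x. 0 < \<bar>x\<bar> \<and> \<bar>x\<bar> < \<tau>} x \<partial>\<nu>) < \<infinity>) \<and>
        (\<forall>t. char (interval_measure G) t =
           exp (\<i> * complex_of_real (\<gamma> * t) - complex_of_real (\<sigma>2 * t\<^sup>2 / 2) +
             (\<integral>x. indicator {x. x \<noteq> 0} x *\<^sub>R
                 (iexp (t * x) - 1 - \<i> * complex_of_real (t * x / (1 + x\<^sup>2))) \<partial>\<nu>))))"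

text \<open>lam j k is the (k+1)-th largest eigenvalue (with multiplicity, padded with zeros)
  of the covariance operator of X_{1,j}.\<close>
definition eigen_seq :: "(nat \<Rightarrow> real) \<Rightarrow> bool" where
  "eigen_seq l \<longleftrightarrow> (\<forall>k. 0 \<le> l k) \<and> (\<forall>k. l (Suc k) \<le> l k) \<and> summable l \<and> 0 < l 0"

definition trace_of :: "(nat \<Rightarrow> real) \<Rightarrow> real" where
  "trace_of l = (\<Sum>k. l k)"

definition normalized_eig :: "(nat \<Rightarrow> nat \<Rightarrow> real) \<Rightarrow> nat \<Rightarrow> nat \<Rightarrow> real" where
  "normalized_eig lam j k = lam j k / trace_of (lam j)"

text \<open>Eigenvalues of the covariance of X_d, indexed by multi-indices (k_1,...,k_d).\<close>
definition tensor_eig :: "(nat \<Rightarrow> nat \<Rightarrow> real) \<Rightarrow> nat \<Rightarrow> (nat \<Rightarrow> nat) \<Rightarrow> real" where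
  "tensor_eig lam d kk = (\<Prod>j\<in>{1..d}. lam j (kk j))"

definition multi_idx :: "nat \<Rightarrow> (nat \<Rightarrow> nat) set" where
  "multi_idx d = PiE {1..d} (\<lambda>_. UNIV)"

definition tensor_trace :: "(nat \<Rightarrow> nat \<Rightarrow> real) \<Rightarrow> nat \<Rightarrow> real" where
  "tensor_trace lam d = (\<Prod>j\<in>{1..d}. trace_of (lam j))"

text \<open>Sum of the n largest eigenvalues (with multiplicity) of X_d.\<close>
definition top_sum :: "(nat \<Rightarrow> nat \<Rightarrow> real) \<Rightarrow> nat \<Rightarrow> nat \<Rightarrow> real" where
  "top_sum lam d n = Sup {(\<Sum>kk\<in>F. tensor_eig lam d kk) | F.
      F \<subseteq> multi_idx d \<and> finite F \<and> card F \<le> n}"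

text \<open>sum_{k>n} of the normalized ordered eigenvalues of X_d.\<close>
definition tail_norm :: "(nat \<Rightarrow> nat \<Rightarrow> real) \<Rightarrow> nat \<Rightarrow> nat \<Rightarrow> real" where
  "tail_norm lam d n = (tensor_trace lam d - top_sum lam d n) / tensor_trace lam d"

definition complexity :: "(nat \<Rightarrow> nat \<Rightarrow> real) \<Rightarrow> nat \<Rightarrow> real \<Rightarrow> nat" where
  "complexity lam d \<epsilon> = (LEAST n. tail_norm lam d n \<le> \<epsilon>\<^sup>2)"

end

theory Submission
  imports Defs
begin

text \<open>
  Attach to the multi-index \<open>(k\<^sub>1, \<dots>, k\<^sub>d)\<close> its normalised eigenvalue as probability. Minus its
  logarithm is then a sum of \<open>d\<close> independent nonnegative random variables \<open>U\<^sub>j\<close>, and up to an error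
  \<open>o(b\<^sub>d)\<close> the logarithm of the complexity at level \<open>\<epsilon>\<close> is the \<open>(1 - \<epsilon>\<^sup>2)\<close>-quantile of that sum.
  So the hypothesis says that \<open>(U\<^sub>1 + \<dots> + U\<^sub>d - a\<^sub>d) / b\<^sub>d\<close> converges in law to \<open>G\<close>, and the negligibility
  condition says that the array \<open>U\<^sub>j / b\<^sub>d\<close> is infinitesimal.

  Since \<open>U\<^sub>d\<^sub>+\<^sub>1 / b\<^sub>d\<^sub>+\<^sub>1\<close> tends to \<open>0\<close> in probability, the first \<open>d\<close> summands converge to \<open>G\<close> under both
  normalisations \<open>b\<^sub>d\<close> and \<open>b\<^sub>d\<^sub>+\<^sub>1\<close>, which forces \<open>b\<^sub>d\<^sub>+\<^sub>1 / b\<^sub>d\<close> to tend to \<open>1\<close> unless \<open>G\<close> is degenerate.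
  Then one can choose \<open>m\<^sub>d\<close> with \<open>b\<^bsub>m\<^sub>d\<^esub> / b\<^sub>d\<close> tending to \<open>1 / \<alpha>\<close>; splitting the sum at \<open>m\<^sub>d\<close> and taking a limit of
  the tight remainders gives self-decomposability. The Levy representation is the limit of the
  accompanying compound Poisson laws of the summands centred at truncated means; these centrings
  vanish uniformly, so nonnegativity of the \<open>U\<^sub>j\<close> leaves no mass on the negative half-line.
\<close>

section \<open>The kernel of the Levy-Khintchine formula\<close>

text \<open>The bridge between complexity and quantiles is a count: at most \<open>exp z\<close>
  atoms have information at most \<open>z\<close>, while \<open>n\<close> atoms with information
  above \<open>z\<close> carry mass at most \<open>n * exp (- z)\<close>. The gap between the two is
  harmless on the scale \<open>b d\<close>, since raising \<open>z\<close> by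
  \<open>\<delta> * b d\<close> multiplies the second bound by
  \<open>exp (- (\<delta> * b d))\<close>. The centrings \<open>a d\<close> are arbitrary, so no
  bound can rest on them. Estimates are made for symmetrised summands, whose transforms are squared
  moduli and forget every shift; smallness of the individual summands carries them back. Exponents
  are kept in Khintchine form, with one finite measure \<open>Q\<close> whose atom at 0 is the
  Gaussian variance, so that weak compactness handles jumps and Gaussian part together. The spectral
  function enters the claim through an arbitrary representation. Finding one without negative mass
  is not enough: uniqueness of the Levy measure off 0 is needed too. Nor can the ratio argument
  cover a degenerate \<open>G\<close>, for which \<open>b (Suc d) / b d\<close> may fail to tend to
  1; there self-decomposability is checked directly.\<close>

definition lk_integrand :: "real \<Rightarrow> real \<Rightarrow> complex" where
  "lk_integrand t x = iexp (t * x) - 1 - \<i> * complex_of_real (t * x / (1 + x\<^sup>2))"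

definition lk_weight :: "real \<Rightarrow> real" where
  "lk_weight x = x\<^sup>2 / (1 + x\<^sup>2)"

text \<open>Khintchine's kernel. The value at 0 is the limit of the quotient, so an atom of mass
  \<open>s\<close> at 0 in the integrating measure contributes \<open>- s * t\<^sup>2 / 2\<close>, a
  Gaussian part. The weight is comparable to \<open>min 1 (x\<^sup>2)\<close> and turns Levy
  measures into finite ones.\<close>

definition lk_kernel :: "real \<Rightarrow> real \<Rightarrow> complex" where
  "lk_kernel t x = (if x = 0 then complex_of_real (- t\<^sup>2 / 2)
     else lk_integrand t x / complex_of_real (lk_weight x))"

section \<open>Elementary bounds for the weight and for Taylor remainders of the exponential\<close>

lemma one_plus_square_pos: "0 < 1 + (x::real)\<^sup>2"
  by (simp add: add_pos_nonneg)

lemma one_plus_square_neq [simp]: "1 + (x::real)\<^sup>2 \<noteq> 0"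
  using one_plus_square_pos[of x] by simp

lemma one_plus_square_neq_complex [simp]: "1 + (complex_of_real x)\<^sup>2 \<noteq> 0"
proof -
  have "complex_of_real (1 + x\<^sup>2) \<noteq> 0" by (subst of_real_eq_0_iff) simp
  then show ?thesis by simp
qed

lemma lk_weight_nonneg [simp]: "0 \<le> lk_weight x"
  by (simp add: lk_weight_def)

lemma lk_weight_le_1 [simp]: "lk_weight x \<le> 1"
  using one_plus_square_pos[of x] by (simp add: lk_weight_def divide_le_eq_1)

lemma lk_weight_le_square: "lk_weight x \<le> x\<^sup>2"
proof -
  have "x\<^sup>2 / (1 + x\<^sup>2) \<le> x\<^sup>2 / 1"
    by (rule divide_left_mono) (auto simp: one_plus_square_pos)
  then show ?thesis by (simp add: lk_weight_def)
qed

lemma lk_weight_eq_0_iff [simp]: "lk_weight x = 0 \<longleftrightarrow> x = 0"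
  by (simp add: lk_weight_def)

lemma lk_weight_measurable [measurable]: "lk_weight \<in> borel_measurable borel"
  unfolding lk_weight_def by measurable

lemma lk_integrand_measurable [measurable]: "lk_integrand t \<in> borel_measurable borel"
  unfolding lk_integrand_def by measurable

lemma lk_kernel_measurable [measurable]: "lk_kernel t \<in> borel_measurable borel"
  unfolding lk_kernel_def by measurable

lemma lk_integrand_0 [simp]: "lk_integrand t 0 = 0"
  by (simp add: lk_integrand_def)

lemma lk_kernel_times_weight: "lk_kernel t x * complex_of_real (lk_weight x) = lk_integrand t x"
  by (simp add: lk_kernel_def)

lemma norm_iexp [simp]: "norm (iexp x) = 1"
  by (simp add: norm_exp_i_times)

lemma norm_iexp_minus_1_le: "norm (iexp x - 1) \<le> \<bar>x\<bar>"
  using iexp_approx1[of x 0] by simp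

lemma norm_iexp_minus_1_le_2: "norm (iexp x - 1) \<le> 2"
  using norm_triangle_ineq4[of "iexp x" 1] by simp

lemma norm_iexp_second_order: "norm (iexp x - 1 - \<i> * x) \<le> x\<^sup>2 / 2"
  using iexp_approx1[of x 1] by (simp add: diff_diff_eq power2_eq_square)

lemma norm_iexp_third_order: "norm (iexp x - 1 - \<i> * x + x\<^sup>2 / 2) \<le> \<bar>x\<bar> ^ 3 / 6"
proof -
  have "(\<Sum>k\<le>2. (\<i> * x) ^ k / fact k) = 1 + \<i> * x - x\<^sup>2 / 2"
    by (simp add: numeral_2_eq_2 power2_eq_square algebra_simps)
  then have "iexp x - 1 - \<i> * x + x\<^sup>2 / 2 = iexp x - (\<Sum>k\<le>2. (\<i> * x) ^ k / fact k)"
    by simp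
  moreover have "\<bar>x\<bar> ^ Suc 2 / fact (Suc 2) = \<bar>x\<bar> ^ 3 / 6" by (simp add: fact_numeral)
  ultimately show ?thesis
    using iexp_approx1[of x 2] by metis
qed

text \<open>The quotient is rearranged so that \<open>x\<^sup>2\<close> divides only a second-order
  Taylor remainder. This tames the 0/0 at the origin and serves both the bound for small
  \<open>x\<close> and continuity at 0.\<close>

lemma lk_kernel_expand:
  assumes "x \<noteq> 0"
  shows "lk_kernel t x = (1 + x\<^sup>2) * ((iexp (t * x) - 1 - \<i> * (t * x)) / x\<^sup>2) + \<i> * t * x"
proof -
  define y where "y = complex_of_real x"
  define s where "s = complex_of_real t"
  have y: "y \<noteq> 0" "1 + y\<^sup>2 \<noteq> 0"
  proof -
    have "1 + y\<^sup>2 = complex_of_real (1 + x\<^sup>2)" by (simp add: y_def)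
    then show "1 + y\<^sup>2 \<noteq> 0" using one_plus_square_neq[of x] of_real_eq_0_iff by metis
  qed (use assms in \<open>simp add: y_def\<close>)
  have "lk_kernel t x = (exp (\<i> * (s * y)) - 1 - \<i> * (s * y / (1 + y\<^sup>2))) / (y\<^sup>2 / (1 + y\<^sup>2))"
    using assms by (simp add: lk_kernel_def lk_integrand_def lk_weight_def y_def s_def)
  also have "\<dots> = (1 + y\<^sup>2) * ((exp (\<i> * (s * y)) - 1 - \<i> * (s * y)) / y\<^sup>2) + \<i> * s * y"
    using y by (simp add: divide_simps) (simp add: algebra_simps power2_eq_square)
  finally show ?thesis by (simp add: y_def s_def)
qed

text \<open>For \<open>\<bar>x\<bar> \<le> 1\<close> the Taylor remainder over
  \<open>x\<^sup>2\<close> is at most \<open>t\<^sup>2 / 2\<close> and its factor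
  \<open>1 + x\<^sup>2\<close> at most 2. For larger \<open>x\<close> the weight is at least 1/2,
  which at most doubles the bound \<open>2 + \<bar>t\<bar> / 2\<close> for the integrand.\<close>

lemma norm_lk_kernel_le: "norm (lk_kernel t x) \<le> 4 + \<bar>t\<bar> + t\<^sup>2"
proof (cases "x = 0")
  case True
  have "norm (complex_of_real (t\<^sup>2 / 2)) = t\<^sup>2 / 2"
    by (subst norm_of_real) simp
  then have "norm (lk_kernel t x) = t\<^sup>2 / 2"
    using True by (simp add: lk_kernel_def norm_divide norm_power)
  then show ?thesis using zero_le_power2[of t] by linarith
next
  case x: False
  show ?thesis
  proof (cases "\<bar>x\<bar> \<le> 1")
    case True
    then have x2: "x\<^sup>2 \<le> 1" by (simp add: abs_square_le_1)
    have "norm (lk_kernel t x) \<le> norm (complex_of_real (1 + x\<^sup>2) * ((iexp (t * x) - 1 - \<i> * (t * x)) / x\<^sup>2))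
        + norm (\<i> * t * x)"
      using x by (simp add: lk_kernel_expand norm_triangle_ineq)
    also have "\<dots> = (1 + x\<^sup>2) * (norm (iexp (t * x) - 1 - \<i> * (t * x)) / x\<^sup>2) + \<bar>t\<bar> * \<bar>x\<bar>"
      by (simp only: norm_mult norm_divide norm_of_real norm_ii norm_power) simp
    also have "\<dots> \<le> 2 * (((t * x)\<^sup>2 / 2) / x\<^sup>2) + \<bar>t\<bar> * 1"
      using True x2 norm_iexp_second_order[of "t * x"]
      by (intro add_mono mult_mono divide_right_mono) auto
    also have "\<dots> = t\<^sup>2 + \<bar>t\<bar>"
      using x by (simp add: power_mult_distrib)
    finally show ?thesis by simp
  next
    case False
    then have x2: "1 \<le> x\<^sup>2" using one_le_power[of "\<bar>x\<bar>" 2] by simp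
    have w: "1 / 2 \<le> lk_weight x"
      using x2 one_plus_square_pos[of x] by (simp add: lk_weight_def field_simps)
    have "\<bar>x\<bar> \<le> 1 + x\<^sup>2"
      using zero_le_power2[of "\<bar>x\<bar> - 1"] by (simp add: power2_eq_square algebra_simps)
    then have "\<bar>t * x / (1 + x\<^sup>2)\<bar> \<le> \<bar>t\<bar>"
      using one_plus_square_pos[of x]
      by (simp add: abs_mult divide_le_eq mult_left_mono)
    moreover have "2 * \<bar>x\<bar> \<le> 1 + x\<^sup>2"
      using zero_le_power2[of "\<bar>x\<bar> - 1"] by (simp add: power2_eq_square algebra_simps)
    then have "\<bar>t * x / (1 + x\<^sup>2)\<bar> \<le> \<bar>t\<bar> / 2"
      using one_plus_square_pos[of x] mult_left_mono[of "2 * \<bar>x\<bar>" "1 + x\<^sup>2" "\<bar>t\<bar>"]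
      by (simp add: abs_mult divide_le_eq)
    ultimately have "norm (lk_integrand t x) \<le> 2 + \<bar>t\<bar> / 2"
      unfolding lk_integrand_def
      using norm_triangle_ineq4[of "iexp (t * x) - 1" "\<i> * complex_of_real (t * x / (1 + x\<^sup>2))"]
        norm_iexp_minus_1_le_2[of "t * x"]
      by (simp only: norm_mult norm_ii norm_of_real mult_1)
    then have "norm (lk_integrand t x) / lk_weight x \<le> (2 + \<bar>t\<bar> / 2) / (1 / 2)"
      using w by (intro frac_le) auto
    then have "norm (lk_kernel t x) \<le> 4 + \<bar>t\<bar>"
      using x by (simp add: lk_kernel_def norm_divide)
    then show ?thesis using zero_le_power2[of t] by linarith
  qed
qed

lemma norm_lk_integrand_le: "norm (lk_integrand t x) \<le> (4 + \<bar>t\<bar> + t\<^sup>2) * lk_weight x"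
  unfolding lk_kernel_times_weight[symmetric]
  by (simp add: norm_mult mult_right_mono norm_lk_kernel_le)

text \<open>The kernel serves as a test function for weak convergence, and mass may accumulate at 0,
  so continuity there is essential. The third-order Taylor bound leaves an error linear in
  \<open>y\<close> after division by \<open>y\<^sup>2\<close>; this is what fixes the value at
  0.\<close>

lemma isCont_lk_kernel: "isCont (lk_kernel t) x"
proof (cases "x = 0")
  case False
  have "\<forall>\<^sub>F y in nhds x. y \<in> - {0}"
    using False by (intro eventually_nhds_in_open) auto
  then have ev: "\<forall>\<^sub>F y in nhds x. lk_kernel t y = lk_integrand t y / complex_of_real (lk_weight y)"
    by (rule eventually_mono) (simp add: lk_kernel_def)
  have "isCont (\<lambda>y. lk_integrand t y / complex_of_real (lk_weight y)) x"
    unfolding lk_integrand_def lk_weight_def using False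
    by (intro continuous_intros) auto
  then show ?thesis
    using isCont_cong[OF ev] by blast
next
  case True
  define h where "h y = (iexp (t * y) - 1 - \<i> * (t * y)) / y\<^sup>2" for y :: real
  have "((\<lambda>y. \<bar>t\<bar> ^ 3 * \<bar>y\<bar> / 6) \<longlongrightarrow> \<bar>t\<bar> ^ 3 * \<bar>0::real\<bar> / 6) (at 0)"
    by (intro tendsto_intros) simp
  then have lim: "((\<lambda>y. \<bar>t\<bar> ^ 3 * \<bar>y\<bar> / 6) \<longlongrightarrow> 0) (at (0::real))" by simp
  have "(h \<longlongrightarrow> complex_of_real (- t\<^sup>2 / 2)) (at 0)"
  proof (rule Lim_transform_bound[OF _ lim, THEN Lim_transform[rotated]])
    show "\<forall>\<^sub>F y in at 0. norm (h y - complex_of_real (- t\<^sup>2 / 2)) \<le> norm (\<bar>t\<bar> ^ 3 * \<bar>y\<bar> / 6)"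
      unfolding eventually_at_filter
    proof (rule always_eventually, safe)
      fix y :: real assume y: "y \<noteq> 0"
      have "h y - complex_of_real (- t\<^sup>2 / 2) = (iexp (t * y) - 1 - \<i> * (t * y) + (t * y)\<^sup>2 / 2) / y\<^sup>2"
      proof -
        have "complex_of_real ((t * y)\<^sup>2 / 2) / complex_of_real (y\<^sup>2) = complex_of_real (t\<^sup>2 / 2)"
          using y by (simp add: power_mult_distrib)
        then show ?thesis by (simp only: h_def add_divide_distrib) simp
      qed
      also have "norm \<dots> = norm (iexp (t * y) - 1 - \<i> * (t * y) + (t * y)\<^sup>2 / 2) / y\<^sup>2"
        by (simp only: norm_divide norm_of_real abs_power2)
      also have "\<dots> \<le> (\<bar>t * y\<bar> ^ 3 / 6) / y\<^sup>2"
        using norm_iexp_third_order[of "t * y"] by (intro divide_right_mono) simp_all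
      also have "\<dots> = \<bar>t\<bar> ^ 3 * \<bar>y\<bar> / 6"
        using y by (simp add: abs_mult power_mult_distrib power3_eq_cube power2_eq_square field_simps)
      finally show "norm (h y - complex_of_real (- t\<^sup>2 / 2)) \<le> norm (\<bar>t\<bar> ^ 3 * \<bar>y\<bar> / 6)"
        by simp
    qed
    show "((\<lambda>y. complex_of_real (- t\<^sup>2 / 2)) \<longlongrightarrow> complex_of_real (- t\<^sup>2 / 2)) (at 0)"
      by simp
  qed
  then have "((\<lambda>y. complex_of_real (1 + y\<^sup>2) * h y + \<i> * t * y) \<longlongrightarrow>
      complex_of_real (1 + 0\<^sup>2) * complex_of_real (- t\<^sup>2 / 2) + \<i> * t * complex_of_real 0) (at 0)"
    by (intro tendsto_intros)
  then have *: "((\<lambda>y. complex_of_real (1 + y\<^sup>2) * h y + \<i> * t * y) \<longlongrightarrow> lk_kernel t 0) (at 0)"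
    by (simp add: lk_kernel_def)
  have "(lk_kernel t \<longlongrightarrow> lk_kernel t 0) (at 0)"
    by (rule Lim_transform_eventually[OF *])
       (auto simp: eventually_at_filter lk_kernel_expand h_def)
  then show ?thesis using True by (simp add: isCont_def)
qed

lemma isCont_integral_lk_kernel:
  assumes Q: "finite_borel_measure Q"
  shows "isCont (\<lambda>t. \<integral>x. lk_kernel t x \<partial>Q) t"
  unfolding continuous_at_sequentially
proof safe
  interpret finite_borel_measure Q by fact
  have [measurable_cong]: "sets Q = sets borel" by (rule M_is_borel)
  fix s assume s: "s \<longlonglongrightarrow> t"
  then have "Bseq s" using convergent_imp_Bseq convergentI by blast
  then obtain K where K: "\<And>n. \<bar>s n\<bar> \<le> K" unfolding Bseq_def by auto
  show "((\<lambda>t. \<integral>x. lk_kernel t x \<partial>Q) \<circ> s) \<longlonglongrightarrow> (\<integral>x. lk_kernel t x \<partial>Q)"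
    unfolding comp_def
  proof (rule integral_dominated_convergence[where w = "\<lambda>_. 4 + K + K\<^sup>2"])
    show "AE x in Q. (\<lambda>n. lk_kernel (s n) x) \<longlonglongrightarrow> lk_kernel t x"
      unfolding lk_kernel_def lk_integrand_def
      by (intro always_eventually allI) (auto intro!: tendsto_intros s)
    fix n
    have "\<bar>s n\<bar>\<^sup>2 \<le> K\<^sup>2" using K[of n] by (intro power_mono) auto
    then have "4 + \<bar>s n\<bar> + (s n)\<^sup>2 \<le> 4 + K + K\<^sup>2" using K[of n] by simp
    then show "AE x in Q. norm (lk_kernel (s n) x) \<le> 4 + K + K\<^sup>2"
      by (intro always_eventually allI order_trans[OF norm_lk_kernel_le])
  qed auto
qed

text \<open>Frequency 0 gives equal total masses; dividing by the common mass reduces the claim to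
  Levy's uniqueness theorem for probability laws. Mass 0 has to be split off.\<close>

lemma finite_borel_measure_eqI_char:
  assumes M: "finite_borel_measure M" and N: "finite_borel_measure N"
    and eq: "\<And>t. (CLINT x|M. iexp (t * x)) = (CLINT x|N. iexp (t * x))"
  shows "M = N"
proof -
  interpret M: finite_borel_measure M by fact
  interpret N: finite_borel_measure N by fact
  have [simp]: "sets M = sets borel" "sets N = sets borel" "space M = UNIV" "space N = UNIV"
    using M.M_is_borel N.M_is_borel M.borel_UNIV N.borel_UNIV by auto
  define c where "c = measure M UNIV"
  have "complex_of_real (measure M UNIV) = complex_of_real (measure N UNIV)"
    using eq[of 0] by simp
  then have c: "c = measure N UNIV" by (simp add: c_def)
  show ?thesis
  proof (cases "c = 0")
    case True
    then have "emeasure M UNIV = 0" "emeasure N UNIV = 0"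
      using c by (auto simp: c_def M.emeasure_eq_measure N.emeasure_eq_measure)
    then have "emeasure M X = 0" "emeasure N X = 0" for X
      using emeasure_mono[of X UNIV M] emeasure_mono[of X UNIV N] by auto
    then show ?thesis by (intro measure_eqI) auto
  next
    case False
    then have c0: "c > 0" using measure_nonneg[of M UNIV] by (simp add: c_def less_le)
    have distr: "real_distribution (density K (\<lambda>_. ennreal (1 / c)))"
      if "finite_borel_measure K" "measure K UNIV = c" for K
    proof -
      interpret K: finite_borel_measure K by fact
      have [simp]: "sets K = sets borel" "space K = UNIV" using K.M_is_borel K.borel_UNIV by auto
      have "emeasure (density K (\<lambda>_. ennreal (1 / c))) UNIV = ennreal (1 / c) * emeasure K UNIV"
        by (subst emeasure_density_const) auto
      also have "\<dots> = 1"
        using c0 that by (simp add: K.emeasure_eq_measure ennreal_mult[symmetric])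
      finally show ?thesis
        by (intro real_distribution.intro prob_spaceI) (auto simp: real_distribution_axioms_def)
    qed
    have ch: "char (density K (\<lambda>_. ennreal (1 / c))) t = (1 / c) *\<^sub>R (CLINT x|K. iexp (t * x))"
      if "finite_borel_measure K" for K t
    proof -
      interpret K: finite_borel_measure K by fact
      have [measurable_cong]: "sets K = sets borel" using K.M_is_borel .
      show ?thesis unfolding char_def using c0 by (subst integral_density) auto
    qed
    have eqd: "density M (\<lambda>_. ennreal (1 / c)) = density N (\<lambda>_. ennreal (1 / c))"
      using distr[OF M c_def[symmetric]] distr[OF N c[symmetric]]
    proof (rule Levy_uniqueness)
      show "char (density M (\<lambda>_. ennreal (1 / c))) = char (density N (\<lambda>_. ennreal (1 / c)))"
        by (rule ext) (simp only: ch[OF M] ch[OF N] eq)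
    qed
    show ?thesis
    proof (rule measure_eqI)
      fix X assume X: "X \<in> sets M"
      have "ennreal (1 / c) * emeasure M X = ennreal (1 / c) * emeasure N X"
        using arg_cong[OF eqd, of "\<lambda>K. emeasure K X"] X by (simp add: emeasure_density_const)
      then show "emeasure M X = emeasure N X"
        using c0 by (subst (asm) ennreal_mult_cancel_left) auto
    qed simp
  qed
qed

section \<open>Levy representations\<close>

text \<open>A monotone function has countably many discontinuities. Such points are needed
  throughout, because \<open>stieltjes_measure_punctured\<close> fixes the measure only on intervals
  whose endpoints are continuity points.\<close>

lemma mono_on_obtain_isCont:
  fixes L :: "real \<Rightarrow> real"
  assumes "mono_on S L" "open S" "{p<..<q} \<subseteq> S" "p < q"
  obtains x where "p < x" "x < q" "isCont L x"
proof -
  have "countable {x\<in>S. \<not> continuous (at x within S) L}"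
    by (rule mono_on_ctble_discont) fact
  moreover have "uncountable {p<..<q}" using assms by (simp add: uncountable_open_interval)
  ultimately have "\<not> {p<..<q} \<subseteq> {x\<in>S. \<not> continuous (at x within S) L}"
    using countable_subset by blast
  then obtain x where x: "x \<in> {p<..<q}" "continuous (at x within S) L" using assms by blast
  then have "at x within S = at x"
    using assms by (intro at_within_open) auto
  then show ?thesis using that x by auto
qed

section \<open>Tails of the spectral function and integrability of the Levy weight\<close>

lemma mono_on_le_lim_at_top:
  fixes L :: "real \<Rightarrow> real"
  assumes "mono_on {0<..} L" "(L \<longlongrightarrow> 0) at_top" "0 < x"
  shows "L x \<le> 0"
  using assms(2)
proof (rule tendsto_lowerbound)
  show "\<forall>\<^sub>F y in at_top. L x \<le> L y"
    using eventually_ge_at_top[of x]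
    by (rule eventually_mono) (use assms in \<open>auto intro: mono_onD\<close>)
qed simp

lemma mono_on_ge_lim_at_bot:
  fixes L :: "real \<Rightarrow> real"
  assumes "mono_on {..<0} L" "(L \<longlongrightarrow> 0) at_bot" "x < 0"
  shows "0 \<le> L x"
  using assms(2)
proof (rule tendsto_upperbound)
  show "\<forall>\<^sub>F y in at_bot. L y \<le> L x"
    using eventually_le_at_bot[of x]
    by (rule eventually_mono) (use assms in \<open>auto intro: mono_onD\<close>)
qed simp

text \<open>Integrability of \<open>x\<^sup>2\<close> is given only on bounded sets, so finite tails
  have to come from \<open>L\<close>: an interval \<open>{a<..b}\<close> has mass
  \<open>L b - L a\<close>, at most \<open>- L a\<close> because \<open>L\<close> increases to 0,
  and these intervals exhaust the tail.\<close>

lemma stieltjes_punctured_tail_finite_pos: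
  assumes st: "stieltjes_measure_punctured L \<nu>" and mono: "mono_on {0<..} L"
    and lim: "(L \<longlongrightarrow> 0) at_top" and c: "0 < c"
  shows "emeasure \<nu> {c<..} < \<infinity>"
proof -
  have [simp]: "sets \<nu> = sets borel" using st by (simp add: stieltjes_measure_punctured_def)
  obtain a where a: "0 < a" "a < c" "isCont L a"
    by (rule mono_on_obtain_isCont[OF mono, of 0 c]) (use c in auto)
  \<comment> \<open>Taking one point in each of the successive unit windows makes the sequence
    increasing and unbounded at once.\<close>
  have "\<exists>b. c + real n < b \<and> b < c + real n + 1 \<and> isCont L b" for n
  proof -
    have "{c + real n<..<c + real n + 1} \<subseteq> {0<..}" using c by auto
    then show ?thesis
      by (rule mono_on_obtain_isCont[OF mono open_greaterThan]) auto
  qed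
  then obtain b where b: "\<And>n. c + real n < b n" "\<And>n. b n < c + real n + 1" "\<And>n. isCont L (b n)"
    by metis
  have ab: "a \<le> b n" for n
    using a(2) b(1)[of n] of_nat_0_le_iff[of n, where 'a = real] by linarith
  have "emeasure \<nu> {a<..} = (SUP n. emeasure \<nu> {a<..b n})"
  proof (subst SUP_emeasure_incseq)
    have "b n \<le> b (Suc n)" for n using b(1)[of "Suc n"] b(2)[of n] by simp
    then show "incseq (\<lambda>n. {a<..b n})" by (intro incseq_SucI) (fastforce intro: order_trans)
    have "\<exists>n. x \<le> b n" for x
    proof -
      obtain n where "x < real n" using reals_Archimedean2 by blast
      then have "x \<le> b n" using b(1)[of n] c by simp
      then show ?thesis ..
    qed
    then show "emeasure \<nu> {a<..} = emeasure \<nu> (\<Union>n. {a<..b n})"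
      by (intro arg_cong[where f = "emeasure \<nu>"]) auto
  qed auto
  also have "\<dots> \<le> ennreal (- L a)"
  proof (rule SUP_least)
    fix n
    have "emeasure \<nu> {a<..b n} = ennreal (L (b n) - L a)"
      using st a b(3) ab[of n] unfolding stieltjes_measure_punctured_def by blast
    moreover have "L (b n) \<le> 0"
      using mono_on_le_lim_at_top[OF mono lim, of "b n"] ab[of n] a by simp
    ultimately show "emeasure \<nu> {a<..b n} \<le> ennreal (- L a)" by (simp add: ennreal_leI)
  qed
  finally have "emeasure \<nu> {a<..} < \<infinity>" by (simp add: order_le_less_trans)
  moreover have "emeasure \<nu> {c<..} \<le> emeasure \<nu> {a<..}" using a by (intro emeasure_mono) auto
  ultimately show ?thesis by (rule order_le_less_trans[rotated])
qed

lemma stieltjes_punctured_tail_finite_neg: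
  assumes st: "stieltjes_measure_punctured L \<nu>" and mono: "mono_on {..<0} L"
    and lim: "(L \<longlongrightarrow> 0) at_bot" and c: "0 < c"
  shows "emeasure \<nu> {..<-c} < \<infinity>"
proof -
  have [simp]: "sets \<nu> = sets borel" using st by (simp add: stieltjes_measure_punctured_def)
  obtain b where b: "- c < b" "b < 0" "isCont L b"
    by (rule mono_on_obtain_isCont[OF mono, of "-c" 0]) (use c in auto)
  have "\<exists>a. - c - real n - 1 < a \<and> a < - c - real n \<and> isCont L a" for n
  proof -
    have "{- c - real n - 1<..<- c - real n} \<subseteq> {..<0}" using c by auto
    then show ?thesis
      by (rule mono_on_obtain_isCont[OF mono open_lessThan]) auto
  qed
  then obtain a where a: "\<And>n. - c - real n - 1 < a n" "\<And>n. a n < - c - real n" "\<And>n. isCont L (a n)"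
    by metis
  have ab: "a n \<le> b" for n
    using b(1) a(2)[of n] of_nat_0_le_iff[of n, where 'a = real] by linarith
  have "emeasure \<nu> {..b} = (SUP n. emeasure \<nu> {a n<..b})"
  proof (subst SUP_emeasure_incseq)
    have "a (Suc n) \<le> a n" for n using a(2)[of "Suc n"] a(1)[of n] by simp
    then show "incseq (\<lambda>n. {a n<..b})" by (intro incseq_SucI) (fastforce intro: order_le_less_trans)
    have "\<exists>n. a n < x" for x
    proof -
      obtain n where "- x < real n" using reals_Archimedean2 by blast
      then have "a n < x" using a(2)[of n] c by simp
      then show ?thesis ..
    qed
    then show "emeasure \<nu> {..b} = emeasure \<nu> (\<Union>n. {a n<..b})"
      by (intro arg_cong[where f = "emeasure \<nu>"]) auto
  qed auto
  also have "\<dots> \<le> ennreal (L b)"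
  proof (rule SUP_least)
    fix n
    have "emeasure \<nu> {a n<..b} = ennreal (L b - L (a n))"
      using st b a(3) ab[of n] unfolding stieltjes_measure_punctured_def by blast
    moreover have "0 \<le> L (a n)"
      using mono_on_ge_lim_at_bot[OF mono lim, of "a n"] ab[of n] b by simp
    ultimately show "emeasure \<nu> {a n<..b} \<le> ennreal (L b)" by (simp add: ennreal_leI)
  qed
  finally have "emeasure \<nu> {..b} < \<infinity>" by (simp add: order_le_less_trans)
  moreover have "emeasure \<nu> {..<-c} \<le> emeasure \<nu> {..b}" using b by (intro emeasure_mono) auto
  ultimately show ?thesis by (rule order_le_less_trans[rotated])
qed

definition levy_measure :: "real measure \<Rightarrow> bool" where
  "levy_measure \<nu> \<longleftrightarrow> sets \<nu> = sets borel \<and> integrable \<nu> lk_weight"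

lemma levy_representation_obtain_levy_measure:
  assumes "levy_representation G \<gamma> \<sigma>2 L"
  obtains \<nu> where "levy_measure \<nu>" "stieltjes_measure_punctured L \<nu>"
    "\<And>t. char (interval_measure G) t =
       exp (\<i> * complex_of_real (\<gamma> * t) - complex_of_real (\<sigma>2 * t\<^sup>2 / 2) + (\<integral>x. lk_integrand t x \<partial>\<nu>))"
proof -
  from assms obtain \<nu> where st: "stieltjes_measure_punctured L \<nu>"
    and small: "\<And>\<tau>. 0 < \<tau> \<Longrightarrow> (\<integral>\<^sup>+x. ennreal (x\<^sup>2) * indicator {x. 0 < \<bar>x\<bar> \<and> \<bar>x\<bar> < \<tau>} x \<partial>\<nu>) < \<infinity>"
    and ch: "\<And>t. char (interval_measure G) t =
           exp (\<i> * complex_of_real (\<gamma> * t) - complex_of_real (\<sigma>2 * t\<^sup>2 / 2) +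
             (\<integral>x. indicator {x. x \<noteq> 0} x *\<^sub>R
                 (iexp (t * x) - 1 - \<i> * complex_of_real (t * x / (1 + x\<^sup>2))) \<partial>\<nu>))"
    unfolding levy_representation_def by blast
  have mono: "mono_on {..<0} L" "mono_on {0<..} L" "(L \<longlongrightarrow> 0) at_bot" "(L \<longlongrightarrow> 0) at_top"
    using assms unfolding levy_representation_def by auto
  have sets [measurable_cong, simp]: "sets \<nu> = sets borel"
    using st by (simp add: stieltjes_measure_punctured_def)
  \<comment> \<open>The ranges \<open>\<bar>x\<bar> < 2\<close> and \<open>\<bar>x\<bar> > 1\<close>
    overlap, so every nonzero \<open>x\<close> is covered: the weight is at most
    \<open>x\<^sup>2\<close> on the first and at most 1 on the second.\<close>
  have "(\<integral>\<^sup>+x. ennreal (lk_weight x) \<partial>\<nu>) \<le>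
      (\<integral>\<^sup>+x. (ennreal (x\<^sup>2) * indicator {x. 0 < \<bar>x\<bar> \<and> \<bar>x\<bar> < 2} x
          + (indicator {1<..} x + indicator {..<-1} x)) \<partial>\<nu>)"
  proof (rule nn_integral_mono)
    fix x :: real
    consider "x = 0" | "0 < \<bar>x\<bar> \<and> \<bar>x\<bar> < 2" | "1 < x \<or> x < - 1" by linarith
    then show "ennreal (lk_weight x) \<le> ennreal (x\<^sup>2) * indicator {x. 0 < \<bar>x\<bar> \<and> \<bar>x\<bar> < 2} x
          + (indicator {1<..} x + indicator {..<-1} x)"
    proof cases
      case 2
      then have "ennreal (lk_weight x) \<le> ennreal (x\<^sup>2) * indicator {x. 0 < \<bar>x\<bar> \<and> \<bar>x\<bar> < 2} x"
        using lk_weight_le_square[of x] by (simp add: ennreal_leI)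
      then show ?thesis by (rule add_increasing2[OF zero_le])
    next
      case 3
      have "ennreal (lk_weight x) \<le> ennreal 1" by (intro ennreal_leI) simp
      also have "\<dots> = indicator {1<..} x + indicator {..<-1} x" using 3 by auto
      finally show ?thesis by (rule add_increasing[OF zero_le])
    qed simp
  qed
  also have "\<dots> = (\<integral>\<^sup>+x. ennreal (x\<^sup>2) * indicator {x. 0 < \<bar>x\<bar> \<and> \<bar>x\<bar> < 2} x \<partial>\<nu>)
      + (emeasure \<nu> {1<..} + emeasure \<nu> {..<-1})"
    by (simp add: nn_integral_add)
  also have "\<dots> < \<infinity>"
    using small[of 2] stieltjes_punctured_tail_finite_pos[OF st mono(2,4), of 1]
      stieltjes_punctured_tail_finite_neg[OF st mono(1,3), of 1]
    by simp
  finally have "integrable \<nu> lk_weight"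
    by (intro integrableI_bounded) auto
  then have "levy_measure \<nu>" by (simp add: levy_measure_def)
  moreover have "(\<integral>x. indicator {x. x \<noteq> 0} x *\<^sub>R
      (iexp (t * x) - 1 - \<i> * complex_of_real (t * x / (1 + x\<^sup>2))) \<partial>\<nu>) = (\<integral>x. lk_integrand t x \<partial>\<nu>)" for t
    by (intro Bochner_Integration.integral_cong) (auto simp: lk_integrand_def indicator_def)
  ultimately show ?thesis using that[OF _ st] ch by simp
qed

lemma levy_measure_integrable_lk_integrand:
  assumes "levy_measure \<nu>" shows "integrable \<nu> (lk_integrand t)"
proof -
  have [measurable_cong]: "sets \<nu> = sets borel" using assms by (simp add: levy_measure_def)
  show ?thesis
  proof (rule Bochner_Integration.integrable_bound)
    show "integrable \<nu> (\<lambda>x. (4 + \<bar>t\<bar> + t\<^sup>2) * lk_weight x)"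
      using assms by (simp add: levy_measure_def)
    show "AE x in \<nu>. norm (lk_integrand t x) \<le> norm ((4 + \<bar>t\<bar> + t\<^sup>2) * lk_weight x)"
      by (intro AE_I2 order_trans[OF norm_lk_integrand_le]) simp
  qed simp
qed

lemma isCont_levy_exponent:
  assumes "levy_measure \<nu>"
  shows "isCont (\<lambda>t. \<integral>x. lk_integrand t x \<partial>\<nu>) t"
  unfolding continuous_at_sequentially
proof safe
  have [measurable_cong]: "sets \<nu> = sets borel" using assms by (simp add: levy_measure_def)
  fix s assume s: "s \<longlonglongrightarrow> t"
  then have "Bseq s" using convergent_imp_Bseq convergentI by blast
  then obtain K where K: "\<And>n. \<bar>s n\<bar> \<le> K" unfolding Bseq_def by auto
  show "((\<lambda>t. \<integral>x. lk_integrand t x \<partial>\<nu>) \<circ> s) \<longlonglongrightarrow> (\<integral>x. lk_integrand t x \<partial>\<nu>)"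
    unfolding comp_def
  proof (rule integral_dominated_convergence[where w = "\<lambda>x. (4 + K + K\<^sup>2) * lk_weight x"])
    show "AE x in \<nu>. (\<lambda>n. lk_integrand (s n) x) \<longlonglongrightarrow> lk_integrand t x"
      unfolding lk_integrand_def
      by (intro always_eventually allI) (auto intro!: tendsto_intros s)
    fix n
    have "\<bar>s n\<bar>\<^sup>2 \<le> K\<^sup>2" using K[of n] by (intro power_mono) auto
    then have "4 + \<bar>s n\<bar> + (s n)\<^sup>2 \<le> 4 + K + K\<^sup>2" using K[of n] by simp
    then show "AE x in \<nu>. norm (lk_integrand (s n) x) \<le> (4 + K + K\<^sup>2) * lk_weight x"
      by (intro always_eventually allI order_trans[OF norm_lk_integrand_le] mult_right_mono) auto
  qed (use assms in \<open>auto simp: levy_measure_def\<close>)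
qed

text \<open>One quarter of the central fourth difference with step \<open>h\<close>, whose
  coefficients are 1, -4, 6, -4, 1. It kills polynomials of degree at most 3; a second difference
  would leave a constant from the Gaussian term. On \<open>iexp (t * x)\<close> it acts as the
  multiplier \<open>(1 - cos (h * x))\<^sup>2\<close>, so applied to a Levy exponent it yields the
  Fourier transform of a finite measure.\<close>

definition fourth_diff :: "real \<Rightarrow> (real \<Rightarrow> complex) \<Rightarrow> real \<Rightarrow> complex" where
  "fourth_diff h \<psi> t = 3 / 2 * \<psi> t - \<psi> (t + h) - \<psi> (t - h) + \<psi> (t + 2 * h) / 4 + \<psi> (t - 2 * h) / 4"

lemma fourth_diff_iexp:
  "fourth_diff h (\<lambda>t. iexp (t * x)) t = iexp (t * x) * complex_of_real ((1 - cos (h * x))\<^sup>2)"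
proof -
  have e: "iexp ((t + s) * x) = iexp (t * x) * iexp (s * x)" for s
    by (simp add: exp_add[symmetric] algebra_simps)
  have e': "iexp ((t - s) * x) = iexp (t * x) * iexp (- (s * x))" for s
    using e[of "- s"] by simp
  have c: "iexp s + iexp (- s) = 2 * complex_of_real (cos s)" for s
    by (simp add: complex_eq_iff Re_exp Im_exp)
  have "fourth_diff h (\<lambda>t. iexp (t * x)) t = iexp (t * x) *
      (3 / 2 - (iexp (h * x) + iexp (- (h * x))) + (iexp (2 * h * x) + iexp (- (2 * h * x))) / 4)"
    unfolding fourth_diff_def e e' by (simp only: algebra_simps add_divide_distrib times_divide_eq_right)
  also have "\<dots> = iexp (t * x) * complex_of_real (3 / 2 - 2 * cos (h * x) + cos (2 * (h * x)) / 2)"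
    unfolding c by (simp add: mult.assoc)
  also have "3 / 2 - 2 * cos (h * x) + cos (2 * (h * x)) / 2 = (1 - cos (h * x))\<^sup>2"
    unfolding cos_double_cos by (simp add: power2_eq_square field_simps)
  finally show ?thesis .
qed

lemma fourth_diff_lk_integrand:
  "fourth_diff h (\<lambda>t. lk_integrand t x) t = iexp (t * x) * complex_of_real ((1 - cos (h * x))\<^sup>2)"
proof -
  have "fourth_diff h (\<lambda>t. lk_integrand t x) t = fourth_diff h (\<lambda>t. iexp (t * x)) t"
  proof -
    define y where "y = complex_of_real (x / (1 + x\<^sup>2))"
    have "lk_integrand t x = iexp (t * x) - 1 - \<i> * complex_of_real t * y" for t
      by (simp add: lk_integrand_def y_def)
    moreover have "3 / 2 * (a - 1 - \<i> * complex_of_real t * y) - (b - 1 - \<i> * complex_of_real (t + h) * y)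
      - (c - 1 - \<i> * complex_of_real (t - h) * y) + (d - 1 - \<i> * complex_of_real (t + 2 * h) * y) / 4
      + (e - 1 - \<i> * complex_of_real (t - 2 * h) * y) / 4 = 3 / 2 * a - b - c + d / 4 + e / 4" for a b c d e
      by (simp add: field_simps)
    ultimately show ?thesis unfolding fourth_diff_def by simp
  qed
  then show ?thesis by (simp only: fourth_diff_iexp)
qed

lemma fourth_diff_integral_lk_integrand:
  assumes "levy_measure \<nu>"
  shows "fourth_diff h (\<lambda>t. \<integral>x. lk_integrand t x \<partial>\<nu>) t =
    (\<integral>x. iexp (t * x) * complex_of_real ((1 - cos (h * x))\<^sup>2) \<partial>\<nu>)"
    and "integrable \<nu> (\<lambda>x. iexp (t * x) * complex_of_real ((1 - cos (h * x))\<^sup>2))"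
proof -
  note [simp] = levy_measure_integrable_lk_integrand[OF assms]
  show "fourth_diff h (\<lambda>t. \<integral>x. lk_integrand t x \<partial>\<nu>) t =
    (\<integral>x. iexp (t * x) * complex_of_real ((1 - cos (h * x))\<^sup>2) \<partial>\<nu>)"
    unfolding fourth_diff_lk_integrand[symmetric] unfolding fourth_diff_def by simp
  show "integrable \<nu> (\<lambda>x. iexp (t * x) * complex_of_real ((1 - cos (h * x))\<^sup>2))"
    unfolding fourth_diff_lk_integrand[symmetric] unfolding fourth_diff_def by simp
qed

text \<open>A logarithm of the characteristic function is determined up to a constant, and the fourth
  difference removes constants together with the drift and Gaussian terms.\<close>

lemma levy_measures_agree:
  assumes \<nu>: "levy_measure \<nu>" and \<nu>': "levy_measure \<nu>'"
    and eq: "\<And>t. exp (\<i> * complex_of_real (\<gamma> * t) - complex_of_real (\<sigma>2 * t\<^sup>2 / 2) + (\<integral>x. lk_integrand t x \<partial>\<nu>))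
      = exp (\<i> * complex_of_real (\<gamma>' * t) - complex_of_real (\<sigma>2' * t\<^sup>2 / 2) + (\<integral>x. lk_integrand t x \<partial>\<nu>'))"
  shows "density \<nu> (\<lambda>x. ennreal ((1 - cos (h * x))\<^sup>2)) = density \<nu>' (\<lambda>x. ennreal ((1 - cos (h * x))\<^sup>2))"
proof -
  define \<psi> where "\<psi> t = \<i> * complex_of_real (\<gamma> * t) - complex_of_real (\<sigma>2 * t\<^sup>2 / 2) + (\<integral>x. lk_integrand t x \<partial>\<nu>)" for t
  define \<psi>' where "\<psi>' t = \<i> * complex_of_real (\<gamma>' * t) - complex_of_real (\<sigma>2' * t\<^sup>2 / 2) + (\<integral>x. lk_integrand t x \<partial>\<nu>')" for t
  have cont: "isCont (\<lambda>t. \<psi> t - \<psi>' t) t" for t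
    unfolding \<psi>_def \<psi>'_def
    by (intro continuous_intros isCont_levy_exponent \<nu> \<nu>') simp_all
  have exp1: "exp (\<psi> t - \<psi>' t) = 1" for t
    using eq[of t] by (simp add: exp_diff \<psi>_def \<psi>'_def)
  have "(\<lambda>t. \<psi> t - \<psi>' t) constant_on UNIV"
  proof (rule continuous_discrete_range_constant)
    show "continuous_on UNIV (\<lambda>t. \<psi> t - \<psi>' t)"
      using cont by (simp add: continuous_at_imp_continuous_on)
    fix s :: real
    \<comment> \<open>The difference of the two logarithms takes values in the integer multiples of
      \<open>2 * pi * \<i>\<close>. Distinct values are therefore at least \<open>2 * pi\<close>
      apart, and a continuous function on the line with such a range is constant.\<close>
    have "2 * pi \<le> norm (\<psi> u - \<psi>' u - (\<psi> s - \<psi>' s))" if ne: "\<psi> u - \<psi>' u \<noteq> \<psi> s - \<psi>' s" for u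
    proof -
      obtain m where m: "\<psi> u - \<psi>' u = \<i> * complex_of_real (2 * pi * of_int m)"
        using exp1[of u] unfolding exp_eq_1 by (auto simp: complex_eq_iff mult_ac)
      obtain k where k: "\<psi> s - \<psi>' s = \<i> * complex_of_real (2 * pi * of_int k)"
        using exp1[of s] unfolding exp_eq_1 by (auto simp: complex_eq_iff mult_ac)
      have "\<psi> u - \<psi>' u - (\<psi> s - \<psi>' s) = \<i> * complex_of_real (2 * pi * of_int (m - k))"
        unfolding m k by (simp add: algebra_simps)
      then have "norm (\<psi> u - \<psi>' u - (\<psi> s - \<psi>' s)) = 2 * pi * \<bar>of_int (m - k)\<bar>"
        by (simp only: norm_mult norm_ii norm_of_real mult_1) (simp add: abs_mult)
      moreover have "m \<noteq> k" using ne m k by auto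
      then have "1 \<le> \<bar>real_of_int (m - k)\<bar>" by linarith
      ultimately show ?thesis by (simp add: mult_le_cancel_left1)
    qed
    then show "\<exists>e>0. \<forall>y. y \<in> UNIV \<and> \<psi> y - \<psi>' y \<noteq> \<psi> s - \<psi>' s \<longrightarrow> e \<le> norm (\<psi> y - \<psi>' y - (\<psi> s - \<psi>' s))"
      by (intro exI[of _ "2 * pi"]) auto
  qed auto
  then obtain c where c: "\<And>t. \<psi> t = \<psi>' t + c" unfolding constant_on_def by (metis UNIV_I diff_eq_eq add.commute)
  have D: "fourth_diff h (\<lambda>t. \<i> * complex_of_real (g * t) - complex_of_real (s2 * t\<^sup>2 / 2) + f t) = fourth_diff h f"
    for g s2 f by (rule ext) (simp add: fourth_diff_def field_simps power2_eq_square)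
  have "fourth_diff h \<psi> = fourth_diff h \<psi>'"
    by (rule ext) (simp add: fourth_diff_def c field_simps)
  then have *: "fourth_diff h (\<lambda>t. \<integral>x. lk_integrand t x \<partial>\<nu>) = fourth_diff h (\<lambda>t. \<integral>x. lk_integrand t x \<partial>\<nu>')"
    unfolding \<psi>_def \<psi>'_def D .
  have fin: "finite_borel_measure (density \<mu> (\<lambda>x. ennreal ((1 - cos (h * x))\<^sup>2)))"
    and ch: "(CLINT x|density \<mu> (\<lambda>x. ennreal ((1 - cos (h * x))\<^sup>2)). iexp (t * x)) =
      (\<integral>x. iexp (t * x) * complex_of_real ((1 - cos (h * x))\<^sup>2) \<partial>\<mu>)"
    if \<mu>: "levy_measure \<mu>" for \<mu> t
  proof -
    have [measurable_cong, simp]: "sets \<mu> = sets borel" using \<mu> by (simp add: levy_measure_def)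
    then have [simp]: "space \<mu> = UNIV" by (metis sets_eq_imp_space_eq space_borel)
    \<comment> \<open>At frequency 0 the modulus of the integrand is the density itself, so its
      integrability is the finiteness of the weighted measure.\<close>
    have "integrable \<mu> (\<lambda>x. norm (iexp (0 * x) * complex_of_real ((1 - cos (h * x))\<^sup>2)))"
      by (intro integrable_norm fourth_diff_integral_lk_integrand(2)[OF \<mu>])
    then have "integrable \<mu> (\<lambda>x. (1 - cos (h * x))\<^sup>2)"
      by (simp add: norm_mult del: of_real_power)
    then have "(\<integral>\<^sup>+x. ennreal ((1 - cos (h * x))\<^sup>2) \<partial>\<mu>) < \<infinity>"
      by (simp add: integrable_iff_bounded)
    moreover have "emeasure (density \<mu> (\<lambda>x. ennreal ((1 - cos (h * x))\<^sup>2))) (space \<mu>)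
        = (\<integral>\<^sup>+x. ennreal ((1 - cos (h * x))\<^sup>2) \<partial>\<mu>)"
      by (subst emeasure_density) (auto intro!: nn_integral_cong)
    ultimately have "emeasure (density \<mu> (\<lambda>x. ennreal ((1 - cos (h * x))\<^sup>2))) (space \<mu>) \<noteq> \<infinity>"
      by simp
    then show "finite_borel_measure (density \<mu> (\<lambda>x. ennreal ((1 - cos (h * x))\<^sup>2)))"
      by (intro finite_borel_measure.intro finite_measureI)
         (auto simp: finite_borel_measure_axioms_def)
    show "(CLINT x|density \<mu> (\<lambda>x. ennreal ((1 - cos (h * x))\<^sup>2)). iexp (t * x)) =
      (\<integral>x. iexp (t * x) * complex_of_real ((1 - cos (h * x))\<^sup>2) \<partial>\<mu>)"
      by (subst integral_density) (auto simp: scaleR_conv_of_real mult.commute)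
  qed
  show ?thesis
  proof (rule finite_borel_measure_eqI_char)
    show "(CLINT x|density \<nu> (\<lambda>x. ennreal ((1 - cos (h * x))\<^sup>2)). iexp (t * x)) =
       (CLINT x|density \<nu>' (\<lambda>x. ennreal ((1 - cos (h * x))\<^sup>2)). iexp (t * x))" for t
      using fun_cong[OF *, of t] fourth_diff_integral_lk_integrand(1)[OF \<nu>, of h t]
        fourth_diff_integral_lk_integrand(1)[OF \<nu>', of h t]
      by (simp only: ch[OF \<nu>] ch[OF \<nu>'])
  qed (use fin[OF \<nu>] fin[OF \<nu>'] in auto)
qed

text \<open>Both Levy measures agree after weighting with \<open>(1 - cos (h * x))\<^sup>2\<close>.
  The weight vanishes at multiples of \<open>2 * pi / h\<close>, so \<open>h\<close> is adapted to
  each negative interval; this makes \<open>\<nu>'\<close> null there, hence \<open>L'\<close>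
  constant on its negative continuity points.\<close>

lemma levy_spectral_function_vanishes_negative:
  assumes rep: "levy_representation G \<gamma> \<sigma>2 L" and rep': "levy_representation G \<gamma>' \<sigma>2' L'"
    and L0: "\<And>x. x < 0 \<Longrightarrow> L x = 0" and x: "x < 0"
  shows "L' x = 0"
proof -
  obtain \<nu> where \<nu>: "levy_measure \<nu>" "stieltjes_measure_punctured L \<nu>"
    "\<And>t. char (interval_measure G) t =
       exp (\<i> * complex_of_real (\<gamma> * t) - complex_of_real (\<sigma>2 * t\<^sup>2 / 2) + (\<integral>x. lk_integrand t x \<partial>\<nu>))"
    by (rule levy_representation_obtain_levy_measure[OF rep]) (rule that)
  obtain \<nu>' where \<nu>': "levy_measure \<nu>'" "stieltjes_measure_punctured L' \<nu>'"
    "\<And>t. char (interval_measure G) t =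
       exp (\<i> * complex_of_real (\<gamma>' * t) - complex_of_real (\<sigma>2' * t\<^sup>2 / 2) + (\<integral>x. lk_integrand t x \<partial>\<nu>'))"
    by (rule levy_representation_obtain_levy_measure[OF rep']) (rule that)
  have [measurable_cong, simp]: "sets \<nu> = sets borel" "sets \<nu>' = sets borel"
    using \<nu> \<nu>' by (auto simp: levy_measure_def)
  then have [simp]: "space \<nu>' = UNIV" by (metis sets_eq_imp_space_eq space_borel)
  have agree: "density \<nu> (\<lambda>x. ennreal ((1 - cos (h * x))\<^sup>2)) = density \<nu>' (\<lambda>x. ennreal ((1 - cos (h * x))\<^sup>2))" for h
    by (rule levy_measures_agree[OF \<nu>(1) \<nu>'(1), of \<gamma> \<sigma>2 \<gamma>' \<sigma>2' h]) (simp only: \<nu>(3)[symmetric] \<nu>'(3)[symmetric])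
  have mono: "mono_on {..<0} L'" "(L' \<longlongrightarrow> 0) at_bot"
    using rep' unfolding levy_representation_def by auto
  have null: "emeasure \<nu>' {a<..b} = 0" if ab: "a \<le> b" "b < 0" for a b
  proof -
    have contL: "isCont L y" if "y < 0" for y
    proof -
      have "\<forall>\<^sub>F z in nhds y. z \<in> {..<0}"
        using that by (intro eventually_nhds_in_open) auto
      then have "\<forall>\<^sub>F z in nhds y. L z = 0"
        by (rule eventually_mono) (simp add: L0)
      then show ?thesis by (simp add: isCont_cong)
    qed
    have "emeasure \<nu> {a<..b} = ennreal (L b - L a)"
      using \<nu>(2) ab contL unfolding stieltjes_measure_punctured_def by auto
    then have "{a<..b} \<in> null_sets \<nu>" using L0 ab by (auto simp: null_sets_def)
    then have ae: "AE x in \<nu>. x \<notin> {a<..b}" by (rule AE_not_in)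
    \<comment> \<open>With this step \<open>\<bar>h * x\<bar>\<close> lies in the interval from 0
      (excluded) to 1 for all \<open>x\<close> in \<open>{a<..b}\<close>, safely inside the first
      period of the cosine.\<close>
    define h where "h = 1 / \<bar>a\<bar>"
    have "{a<..b} \<in> null_sets (density \<nu> (\<lambda>x. ennreal ((1 - cos (h * x))\<^sup>2)))"
      using ae by (subst null_sets_density_iff) auto
    then have "AE x in \<nu>'. x \<in> {a<..b} \<longrightarrow> ennreal ((1 - cos (h * x))\<^sup>2) = 0"
      unfolding agree by (subst (asm) null_sets_density_iff) auto
    moreover have "cos (h * x) \<noteq> 1" if "x \<in> {a<..b}" for x
    proof -
      have hx: "0 < \<bar>h * x\<bar>" "\<bar>h * x\<bar> \<le> 1" using ab that by (auto simp: h_def divide_simps abs_mult)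
      then have "cos \<bar>h * x\<bar> < cos 0"
        using pi_gt3 by (intro cos_monotone_0_pi) auto
      then show ?thesis by simp
    qed
    ultimately have "AE x in \<nu>'. x \<notin> {a<..b}" by (auto simp del: greaterThanAtMost_iff)
    then show ?thesis by (subst (asm) AE_iff_measurable[of "{a<..b}"]) auto
  qed
  have cont0: "L' b = 0" if b: "b < 0" "isCont L' b" for b
  proof -
    \<comment> \<open>A continuity point \<open>a\<close> far enough to the left has
      \<open>L' a < e\<close>, and absence of mass between \<open>a\<close> and \<open>b\<close>
      bounds \<open>L' b\<close> by \<open>L' a\<close>.\<close>
    have "L' b \<le> 0 + e" if "e > 0" for e
    proof -
      have "\<forall>\<^sub>F a in at_bot. L' a < e" using mono(2) that by (rule order_tendstoD)
      then obtain A where A: "\<And>a. a \<le> A \<Longrightarrow> L' a < e" unfolding eventually_at_bot_linorder by auto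
      obtain a where a: "a < min A b" "isCont L' a"
        by (rule mono_on_obtain_isCont[OF mono(1), of "min A b - 1" "min A b"]) (use b in \<open>auto simp: subset_eq\<close>)
      have "ennreal (L' b - L' a) = 0"
        using null[of a b] \<nu>'(2) a b unfolding stieltjes_measure_punctured_def by auto
      then have "L' b \<le> L' a" by (simp add: ennreal_eq_0_iff)
      then show ?thesis using A[of a] a by simp
    qed
    then have "L' b \<le> 0" by (rule field_le_epsilon)
    then show ?thesis using mono_on_ge_lim_at_bot[OF mono b(1)] by simp
  qed
  obtain b where b: "x < b" "b < 0" "isCont L' b"
    by (rule mono_on_obtain_isCont[OF mono(1), of x 0]) (use x in auto)
  then have "L' x \<le> L' b" using x by (intro mono_onD[OF mono(1)]) auto
  then show ?thesis using cont0[of b] b mono_on_ge_lim_at_bot[OF mono x] by simp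
qed

text \<open>Passage from Khintchine's form to Levy's: off 0 the measure \<open>Q\<close> is divided
  by the weight, and its atom at 0 becomes the Gaussian variance.\<close>

lemma levy_representationI:
  assumes Q: "finite_borel_measure Q" and neg: "emeasure Q {..<0} = 0"
    and ch: "\<And>t. char (interval_measure G) t = exp (\<i> * complex_of_real (\<gamma> * t) + (\<integral>x. lk_kernel t x \<partial>Q))"
  shows "\<exists>L. levy_representation G \<gamma> (measure Q {0}) L \<and> (\<forall>x<0. L x = 0)"
proof -
  interpret finite_borel_measure Q by fact
  have [measurable_cong, simp]: "sets Q = sets borel" by (rule M_is_borel)
  have [simp]: "space Q = UNIV" by (rule borel_UNIV)
  \<comment> \<open>The reciprocal weight, set to 0 at the origin so that \<open>\<nu>\<close>
    receives nothing from the Gaussian atom.\<close>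
  define r where "r x = (if x = 0 then 0 else 1 / lk_weight x)" for x
  have [measurable]: "r \<in> borel_measurable borel" unfolding r_def by measurable
  have r_eq: "r x = 1 + 1 / x\<^sup>2" if "x \<noteq> 0" for x
    using that by (simp add: r_def lk_weight_def field_simps)
  have r_nonneg [simp]: "0 \<le> r x" for x by (simp add: r_def)
  have r_le: "r x \<le> 1 + 1 / c\<^sup>2" if "0 < c" "c \<le> x" for x c
  proof -
    have "c\<^sup>2 \<le> x\<^sup>2" using that by (intro power_mono) auto
    then show ?thesis using that by (simp add: r_eq frac_le)
  qed
  define \<nu> where "\<nu> = density Q (\<lambda>x. ennreal (r x))"
  have [measurable_cong, simp]: "sets \<nu> = sets borel" by (simp add: \<nu>_def)
  have tail: "emeasure \<nu> {x<..} \<le> ennreal ((1 + 1 / c\<^sup>2) * measure Q {x<..})" if "0 < c" "c \<le> x" for c x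
  proof -
    define C where "C = 1 + 1 / c\<^sup>2"
    have C: "0 \<le> C" "\<And>y. x < y \<Longrightarrow> r y \<le> C" using that r_le[of c] by (auto simp: C_def)
    have "emeasure \<nu> {x<..} = (\<integral>\<^sup>+y. ennreal (r y) * indicator {x<..} y \<partial>Q)"
      by (simp add: \<nu>_def emeasure_density)
    also have "\<dots> \<le> (\<integral>\<^sup>+y. ennreal C * indicator {x<..} y \<partial>Q)"
      by (intro nn_integral_mono) (auto intro!: ennreal_leI C split: split_indicator)
    also have "\<dots> = ennreal (C * measure Q {x<..})"
      using C by (simp add: nn_integral_cmult emeasure_eq_measure ennreal_mult)
    finally show ?thesis by (simp add: C_def)
  qed
  \<comment> \<open>Mass is counted from infinity because \<open>\<nu>\<close> may be infinite near
    0; this also produces the required limit 0 at infinity.\<close>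
  define L where "L x = (if x < 0 then 0 else - measure \<nu> {x<..})" for x
  have fin: "emeasure \<nu> {x<..} < \<infinity>" if "0 < x" for x
    using tail[of x x] that by (simp add: order_le_less_trans)
  have fm: "{x<..} \<in> fmeasurable \<nu>" if "0 < x" for x
    using fin[OF that] by (auto simp: fmeasurable_def)
  have tail': "measure \<nu> {x<..} \<le> 2 * measure Q {x<..}" if "1 \<le> x" for x
  proof -
    have "ennreal (measure \<nu> {x<..}) \<le> ennreal ((1 + 1 / 1\<^sup>2) * measure Q {x<..})"
      using tail[of 1 x] fin[of x] that by (simp add: emeasure_eq_ennreal_measure)
    then show ?thesis by (simp add: ennreal_le_iff)
  qed
  have "levy_representation G \<gamma> (measure Q {0}) L"
    unfolding levy_representation_def
  proof (intro conjI exI[of _ \<nu>] allI impI)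
    show "mono_on {..<0} L" by (auto simp: mono_on_def L_def)
    show "mono_on {0<..} L"
      by (auto simp: mono_on_def L_def intro!: measure_mono_fmeasurable fm)
    have "\<forall>\<^sub>F x in at_bot. L x = 0"
      using eventually_le_at_bot[of "-1"] by (rule eventually_mono) (simp add: L_def)
    then show "(L \<longlongrightarrow> 0) at_bot" by (rule tendsto_eventually)
    have "((\<lambda>x. 2 * (measure Q UNIV - cdf Q x)) \<longlongrightarrow> 2 * (measure Q UNIV - measure Q UNIV)) at_top"
      using cdf_lim_at_top by (intro tendsto_intros) simp
    then have lim0: "((\<lambda>x. 2 * (measure Q UNIV - cdf Q x)) \<longlongrightarrow> 0) at_top" by simp
    show "(L \<longlongrightarrow> 0) at_top"
    proof (rule Lim_null_comparison[OF _ lim0])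
      show "\<forall>\<^sub>F x in at_top. norm (L x) \<le> 2 * (measure Q UNIV - cdf Q x)"
        using eventually_ge_at_top[of 1]
      proof (rule eventually_mono)
        fix x :: real assume x: "1 \<le> x"
        have "measure Q {x<..} = measure Q (UNIV - {..x})"
          by (intro arg_cong[where f = "measure Q"]) auto
        also have "\<dots> = measure Q UNIV - cdf Q x"
          unfolding cdf_def by (subst finite_measure_Diff) auto
        finally show "norm (L x) \<le> 2 * (measure Q UNIV - cdf Q x)"
          using tail'[OF x] x by (simp add: L_def)
      qed
    qed
    show "stieltjes_measure_punctured L \<nu>"
      unfolding stieltjes_measure_punctured_def
    proof (intro conjI allI impI)
      show "emeasure \<nu> {0} = 0"
        by (simp add: \<nu>_def emeasure_density nn_integral_0_iff_AE r_def split: split_indicator)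
      fix a b :: real assume "0 < a \<and> a \<le> b \<or> a \<le> b \<and> b < 0"
      then show "emeasure \<nu> {a<..b} = ennreal (L b - L a)"
      proof
        assume ab: "0 < a \<and> a \<le> b"
        have "{a<..b} = {a<..} - {b<..}" using ab by auto
        then have "emeasure \<nu> {a<..b} = emeasure \<nu> {a<..} - emeasure \<nu> {b<..}"
          using ab fin[of b] by (simp add: emeasure_Diff)
        also have "\<dots> = ennreal (measure \<nu> {a<..}) - ennreal (measure \<nu> {b<..})"
          using ab fin[of a] fin[of b] by (simp add: emeasure_eq_ennreal_measure)
        finally show ?thesis using ab by (simp add: L_def ennreal_minus)
      next
        assume ab: "a \<le> b \<and> b < 0"
        have "{..<0} \<in> null_sets Q" using neg by (auto simp: null_sets_def)
        then have "{a<..b} \<in> null_sets Q" by (rule null_sets_subset) (use ab in auto)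
        then have "AE x in Q. x \<notin> {a<..b}" by (rule AE_not_in)
        then have "{a<..b} \<in> null_sets \<nu>"
          unfolding \<nu>_def by (subst null_sets_density_iff) auto
        then show ?thesis using ab by (simp add: L_def null_setsD1)
      qed
    qed simp
    fix \<tau> :: real assume \<tau>: "0 < \<tau>"
    have "(\<integral>\<^sup>+x. ennreal (x\<^sup>2) * indicator {x. 0 < \<bar>x\<bar> \<and> \<bar>x\<bar> < \<tau>} x \<partial>\<nu>) =
        (\<integral>\<^sup>+x. ennreal (r x) * (ennreal (x\<^sup>2) * indicator {x. 0 < \<bar>x\<bar> \<and> \<bar>x\<bar> < \<tau>} x) \<partial>Q)"
      unfolding \<nu>_def by (subst nn_integral_density) auto
    also have "\<dots> \<le> (\<integral>\<^sup>+x. ennreal (1 + \<tau>\<^sup>2) \<partial>Q)"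
    proof (rule nn_integral_mono)
      fix x
      have "r x * x\<^sup>2 \<le> 1 + \<tau>\<^sup>2" if "0 < \<bar>x\<bar>" "\<bar>x\<bar> < \<tau>"
      proof -
        have "\<bar>x\<bar>\<^sup>2 \<le> \<tau>\<^sup>2" using that by (intro power_mono) auto
        then show ?thesis using that by (simp add: r_eq algebra_simps)
      qed
      then show "ennreal (r x) * (ennreal (x\<^sup>2) * indicator {x. 0 < \<bar>x\<bar> \<and> \<bar>x\<bar> < \<tau>} x) \<le> ennreal (1 + \<tau>\<^sup>2)"
        by (auto simp: ennreal_mult[symmetric] simp del: ennreal_plus intro!: ennreal_leI split: split_indicator)
    qed
    also have "\<dots> < \<infinity>" by (simp add: emeasure_eq_measure ennreal_mult[symmetric] del: ennreal_plus)
    finally show "(\<integral>\<^sup>+x. ennreal (x\<^sup>2) * indicator {x. 0 < \<bar>x\<bar> \<and> \<bar>x\<bar> < \<tau>} x \<partial>\<nu>) < \<infinity>" .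
  next
    fix t :: real
    have int: "integrable Q (lk_kernel t)"
      by (rule integrable_const_bound[where B = "4 + \<bar>t\<bar> + t\<^sup>2"]) (auto simp: norm_lk_kernel_le)
    have "(\<integral>x. indicator {x. x \<noteq> 0} x *\<^sub>R
        (iexp (t * x) - 1 - \<i> * complex_of_real (t * x / (1 + x\<^sup>2))) \<partial>\<nu>) = (\<integral>x. lk_integrand t x \<partial>\<nu>)"
      by (intro Bochner_Integration.integral_cong) (auto simp: lk_integrand_def indicator_def)
    also have "\<dots> = (\<integral>x. r x *\<^sub>R lk_integrand t x \<partial>Q)"
      unfolding \<nu>_def by (subst integral_density) auto
    \<comment> \<open>Dividing by the weight undoes the kernel everywhere except at 0. The
      correction there is \<open>measure Q {0}\<close> times \<open>- t\<^sup>2 / 2\<close>, the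
      Gaussian term of the representation.\<close>
    also have "\<dots> = (\<integral>x. lk_kernel t x - indicator {0} x *\<^sub>R lk_kernel t 0 \<partial>Q)"
      by (intro Bochner_Integration.integral_cong)
         (auto simp: r_def lk_kernel_def scaleR_conv_of_real split: split_indicator)
    also have "\<dots> = (\<integral>x. lk_kernel t x \<partial>Q) - measure Q {0} *\<^sub>R lk_kernel t 0"
      using int by (subst Bochner_Integration.integral_diff) (auto simp: emeasure_eq_measure)
    finally have "(\<integral>x. indicator {x. x \<noteq> 0} x *\<^sub>R
        (iexp (t * x) - 1 - \<i> * complex_of_real (t * x / (1 + x\<^sup>2))) \<partial>\<nu>) =
        (\<integral>x. lk_kernel t x \<partial>Q) + complex_of_real (measure Q {0} * t\<^sup>2 / 2)"
      by (simp add: lk_kernel_def scaleR_conv_of_real)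
    then show "char (interval_measure G) t =
           exp (\<i> * complex_of_real (\<gamma> * t) - complex_of_real (measure Q {0} * t\<^sup>2 / 2) +
             (\<integral>x. indicator {x. x \<noteq> 0} x *\<^sub>R
                 (iexp (t * x) - 1 - \<i> * complex_of_real (t * x / (1 + x\<^sup>2))) \<partial>\<nu>))"
      by (simp only: ch) simp
  qed simp
  then show ?thesis by (auto simp: L_def)
qed

section \<open>Limits of compound Poisson exponents\<close>

lemma Bseq_obtain_convergent_subseq:
  fixes g :: "nat \<Rightarrow> real"
  assumes "Bseq g"
  obtains \<rho> l where "strict_mono (\<rho> :: nat \<Rightarrow> nat)" "(\<lambda>n. g (\<rho> n)) \<longlonglongrightarrow> l"
  using bounded_imp_convergent_subsequence[of g] assms
  by (auto simp: Bseq_eq_bounded comp_def)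

lemma (in finite_borel_measure) measure_tail_tendsto_0:
  "(\<lambda>i. measure M {x. real i < \<bar>x\<bar>}) \<longlonglongrightarrow> 0"
proof -
  have "(\<lambda>i. measure M {x. real i < \<bar>x\<bar>}) \<longlonglongrightarrow> measure M (\<Inter>i. {x. real i < \<bar>x\<bar>})"
    by (rule finite_Lim_measure_decseq) (auto simp: decseq_def)
  moreover have "\<exists>i. \<not> real i < \<bar>x\<bar>" for x :: real
    using reals_Archimedean2[of "\<bar>x\<bar>"] by (meson less_asym)
  then have "(\<Inter>i. {x. real i < \<bar>x\<bar>}) = {}" by blast
  ultimately show ?thesis by simp
qed

text \<open>Each of the finitely many exceptional laws is tight on its own, so one radius can be
  taken as the maximum of theirs and the eventual one.\<close>

lemma tightI_eventually:
  assumes \<mu>: "\<And>n. real_distribution (\<mu> n)"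
    and ev: "\<And>\<epsilon>. 0 < \<epsilon> \<Longrightarrow> \<exists>K. \<forall>\<^sub>F n in sequentially. measure (\<mu> n) {x. K < \<bar>x\<bar>} \<le> \<epsilon>"
  shows "tight \<mu>"
  unfolding tight_def
proof (intro conjI allI impI \<mu>)
  interpret \<mu>: real_distribution "\<mu> n" for n by (rule \<mu>)
  fix \<epsilon> :: real assume \<epsilon>: "0 < \<epsilon>"
  obtain K N where K: "\<And>n. N \<le> n \<Longrightarrow> measure (\<mu> n) {x. K < \<bar>x\<bar>} \<le> \<epsilon> / 2"
    using ev[of "\<epsilon> / 2"] \<epsilon> unfolding eventually_sequentially by auto
  have "\<exists>k. measure (\<mu> n) {x. k < \<bar>x\<bar>} \<le> \<epsilon> / 2" for n
  proof -
    have "(\<lambda>i. measure (\<mu> n) {x. real i < \<bar>x\<bar>}) \<longlonglongrightarrow> 0" by (rule \<mu>.measure_tail_tendsto_0)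
    then have "\<forall>\<^sub>F i in sequentially. measure (\<mu> n) {x. real i < \<bar>x\<bar>} < \<epsilon> / 2"
      using \<epsilon> by (intro order_tendstoD) auto
    then show ?thesis by (auto simp: eventually_sequentially intro: less_imp_le)
  qed
  then obtain k where k: "\<And>n. measure (\<mu> n) {x. k n < \<bar>x\<bar>} \<le> \<epsilon> / 2" by metis
  define J where "J = Max (insert 1 (insert K (k ` {..N})))"
  have J: "1 \<le> J" "K \<le> J" "\<And>n. n \<le> N \<Longrightarrow> k n \<le> J" unfolding J_def by (auto intro!: Max_ge simp del: Max_insert)
  have "1 - \<epsilon> < measure (\<mu> n) {- J - 1<..J}" for n
  proof -
    have "measure (\<mu> n) {x. J < \<bar>x\<bar>} \<le> \<epsilon> / 2"
    proof (cases "n \<le> N")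
      case True
      have "measure (\<mu> n) {x. J < \<bar>x\<bar>} \<le> measure (\<mu> n) {x. k n < \<bar>x\<bar>}"
        using J(3)[OF True] by (intro \<mu>.finite_measure_mono) auto
      then show ?thesis using k[of n] by simp
    next
      case False
      have "measure (\<mu> n) {x. J < \<bar>x\<bar>} \<le> measure (\<mu> n) {x. K < \<bar>x\<bar>}"
        using J(2) by (intro \<mu>.finite_measure_mono) auto
      then show ?thesis using K[of n] False by simp
    qed
    moreover have "1 - measure (\<mu> n) {- J - 1<..J} = measure (\<mu> n) (space (\<mu> n) - {- J - 1<..J})"
      by (subst \<mu>.prob_compl) auto
    moreover have "\<dots> \<le> measure (\<mu> n) {x. J < \<bar>x\<bar>}"
      by (intro \<mu>.finite_measure_mono) auto
    ultimately show ?thesis using \<epsilon> by simp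
  qed
  then show "\<exists>a b. a < b \<and> (\<forall>n. 1 - \<epsilon> < measure (\<mu> n) {a<..b})"
    using J(1) by (intro exI[of _ "- J - 1"] exI[of _ J]) auto
qed

text \<open>Large frequencies oscillate: the integral of \<open>iexp (g n * t)\<close> over
  \<open>{0..d}\<close> is at most \<open>2 / \<bar>g n\<bar>\<close>. Continuity of the limit at 0
  keeps that integral above \<open>d / 4\<close> for small \<open>d\<close> and large
  \<open>n\<close>, hence \<open>\<bar>g n\<bar> \<le> 8 / d\<close>.\<close>

lemma Bseq_of_iexp_tendsto:
  assumes conv: "\<And>t. (\<lambda>n. iexp (g n * t)) \<longlonglongrightarrow> u t" and u: "isCont u 0"
  shows "Bseq g"
proof -
  have "u 0 = 1" using conv[of 0] by (simp add: LIMSEQ_const_iff)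
  moreover have "\<exists>d>0. \<forall>t. dist t 0 < d \<longrightarrow> dist (u t) (u 0) < 1 / 2"
    using u unfolding continuous_at_eps_delta by (meson half_gt_zero zero_less_one)
  ultimately obtain d0 where d0: "0 < d0" "\<And>t. \<bar>t\<bar> < d0 \<Longrightarrow> norm (u t - 1) < 1 / 2"
    by (auto simp: dist_norm)
  define d where "d = d0 / 2"
  have d: "0 < d" "\<And>t. t \<in> {0..d} \<Longrightarrow> norm (u t - 1) \<le> 1 / 2"
    using d0 by (auto simp: d_def intro!: less_imp_le)
  have cont: "continuous_on {0..d} (\<lambda>t. iexp (g n * t))" for n
    by (intro continuous_intros)
  have lim: "(\<lambda>n. integral {0..d} (\<lambda>t. iexp (g n * t))) \<longlonglongrightarrow> integral {0..d} u"
    and int_u: "u integrable_on {0..d}"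
  proof -
    note dc = dominated_convergence[where f = "\<lambda>n t. iexp (g n * t)" and g = u and S = "{0..d}" and h = "\<lambda>_. 1"]
    show "(\<lambda>n. integral {0..d} (\<lambda>t. iexp (g n * t))) \<longlonglongrightarrow> integral {0..d} u" "u integrable_on {0..d}"
      by (rule dc; use cont conv in \<open>auto intro!: integrable_continuous_interval simp del: of_real_mult\<close>)+
  qed
  have "norm (integral {0..d} (\<lambda>t. u t - 1)) \<le> integral {0..d} (\<lambda>_. 1 / 2)"
    using int_u d by (intro integral_norm_bound_integral integrable_diff) auto
  also have "integral {0..d} (\<lambda>t. u t - 1) = integral {0..d} u - complex_of_real d"
    using int_u d by (subst Henstock_Kurzweil_Integration.integral_diff) (auto simp: scaleR_conv_of_real)
  finally have "norm (complex_of_real d) - norm (integral {0..d} u) \<le> d / 2"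
    using d norm_triangle_ineq2[of "complex_of_real d" "integral {0..d} u"] by (simp add: norm_minus_commute)
  then have "d / 4 < norm (integral {0..d} u)" using d by simp
  then have "\<forall>\<^sub>F n in sequentially. d / 4 < norm (integral {0..d} (\<lambda>t. iexp (g n * t)))"
    using order_tendstoD(1)[OF tendsto_norm[OF lim]] by blast
  then have "\<forall>\<^sub>F n in sequentially. norm (g n) \<le> 8 / d"
  proof (rule eventually_mono)
    fix n assume n: "d / 4 < norm (integral {0..d} (\<lambda>t. iexp (g n * t)))"
    show "norm (g n) \<le> 8 / d"
    proof (cases "g n = 0")
      case False
      have "((\<lambda>t. iexp (g n * t)) has_integral iexp (g n * d) / (\<i> * g n) - iexp (g n * 0) / (\<i> * g n)) {0..d}"
      proof (rule fundamental_theorem_of_calculus)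
        fix t assume "t \<in> {0..d}"
        have "((\<lambda>t. exp (\<i> * complex_of_real (g n) * complex_of_real t) / (\<i> * g n)) has_vector_derivative
            exp (\<i> * complex_of_real (g n) * complex_of_real t)) (at t within {0..d})"
          by (rule has_vector_derivative_real_field) (use False in \<open>auto intro!: derivative_eq_intros\<close>)
        then show "((\<lambda>t. iexp (g n * t) / (\<i> * g n)) has_vector_derivative iexp (g n * t)) (at t within {0..d})"
          by (simp add: mult.assoc)
      qed (use d in auto)
      then have "norm (integral {0..d} (\<lambda>t. iexp (g n * t))) = norm (iexp (g n * d) - 1) / \<bar>g n\<bar>"
        by (simp add: integral_unique diff_divide_distrib[symmetric] norm_divide norm_mult)
      also have "\<dots> \<le> 2 / \<bar>g n\<bar>" by (intro divide_right_mono norm_iexp_minus_1_le_2) auto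
      finally have "d / 4 < 2 / \<bar>g n\<bar>" using n by simp
      then show ?thesis using False d by (simp add: field_simps)
    qed (use d in simp)
  qed
  then show ?thesis by (rule BfunI)
qed

lemma integrable_bounded_borel:
  fixes f :: "real \<Rightarrow> 'b::{banach, second_countable_topology}"
  assumes "finite_borel_measure M" "f \<in> borel_measurable borel" "\<And>x. norm (f x) \<le> B"
  shows "integrable M f"
proof -
  interpret finite_borel_measure M by fact
  have [measurable_cong]: "sets M = sets borel" by (rule M_is_borel)
  show ?thesis using assms by (intro integrable_const_bound[where B = B]) auto
qed

text \<open>\<open>m n\<close> times \<open>V n\<close> stands for a finite jump measure whose mass
  may grow without bound. Only its weighted mass \<open>c n\<close> is bounded, so the weighted
  measure is normalised to a law and Helly's selection applies to it; multiplying by the limit of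
  \<open>c n\<close> gives \<open>Q\<close>.\<close>

lemma lk_weak_compactness:
  fixes V :: "nat \<Rightarrow> real measure" and m :: "nat \<Rightarrow> real"
  assumes V: "\<And>n. real_distribution (V n)" and m: "\<And>n. 0 \<le> m n"
    and bdd: "Bseq (\<lambda>n. m n * (\<integral>x. lk_weight x \<partial>V n))"
    and tail: "\<And>\<eta>. 0 < \<eta> \<Longrightarrow> \<exists>R. \<forall>\<^sub>F n in sequentially. m n * measure (V n) {x. R < \<bar>x\<bar>} \<le> \<eta>"
    and supp: "\<And>\<tau>. 0 < \<tau> \<Longrightarrow> \<forall>\<^sub>F n in sequentially. measure (V n) {..<-\<tau>} = 0"
  obtains \<rho> Q where "strict_mono (\<rho> :: nat \<Rightarrow> nat)" "finite_borel_measure Q" "emeasure Q {..<0} = 0"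
    "\<And>t. (\<lambda>n. m (\<rho> n) * (\<integral>x. lk_integrand t x \<partial>V (\<rho> n))) \<longlonglongrightarrow> (\<integral>x. lk_kernel t x \<partial>Q)"
proof -
  interpret V: real_distribution "V n" for n by (rule V)
  define c where "c n = m n * (\<integral>x. lk_weight x \<partial>V n)" for n
  have c_nonneg: "0 \<le> c n" for n using m[of n] by (simp add: c_def)
  have int_w: "integrable (V n) lk_weight" for n
    by (rule integrable_bounded_borel[where B = 1]) (auto simp: V.finite_borel_measure_M)
  have int_k: "integrable (V n) (lk_integrand t)" for n t
  proof (rule integrable_bounded_borel)
    show "norm (lk_integrand t x) \<le> 4 + \<bar>t\<bar> + t\<^sup>2" for x
      using norm_lk_integrand_le[of t x] mult_left_mono[of "lk_weight x" 1 "4 + \<bar>t\<bar> + t\<^sup>2"] by simp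
  qed (auto simp: V.finite_borel_measure_M)
  have "Bseq c" using bdd unfolding c_def .
  then obtain s0 c0 where s0: "strict_mono (s0 :: nat \<Rightarrow> nat)" and c0: "(\<lambda>n. c (s0 n)) \<longlonglongrightarrow> c0"
    by (rule Bseq_obtain_convergent_subseq)
  have "0 \<le> c0" using c0 c_nonneg by (intro LIMSEQ_le_const[OF c0]) auto
  show ?thesis
  proof (cases "c0 = 0")
    \<comment> \<open>Vanishing weighted mass cannot be normalised to a law. Here the integrals tend
      to 0 and \<open>Q\<close> is the null measure.\<close>
    case True
    have "(\<lambda>n. m (s0 n) * (\<integral>x. lk_integrand t x \<partial>V (s0 n))) \<longlonglongrightarrow> 0" for t
    proof (rule Lim_null_comparison)
      have "(\<lambda>n. (4 + \<bar>t\<bar> + t\<^sup>2) * c (s0 n)) \<longlonglongrightarrow> (4 + \<bar>t\<bar> + t\<^sup>2) * 0"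
        using c0 True by (intro tendsto_intros) simp
      then show "(\<lambda>n. (4 + \<bar>t\<bar> + t\<^sup>2) * c (s0 n)) \<longlonglongrightarrow> 0" by simp
      show "\<forall>\<^sub>F n in sequentially. norm (m (s0 n) * (\<integral>x. lk_integrand t x \<partial>V (s0 n))) \<le> (4 + \<bar>t\<bar> + t\<^sup>2) * c (s0 n)"
      proof (intro always_eventually allI)
        fix n
        have "norm (\<integral>x. lk_integrand t x \<partial>V (s0 n)) \<le> (\<integral>x. (4 + \<bar>t\<bar> + t\<^sup>2) * lk_weight x \<partial>V (s0 n))"
          by (rule order_trans[OF integral_norm_bound integral_mono])
             (auto intro: integrable_norm int_k int_w norm_lk_integrand_le)
        then have "norm (\<integral>x. lk_integrand t x \<partial>V (s0 n)) \<le> (4 + \<bar>t\<bar> + t\<^sup>2) * (\<integral>x. lk_weight x \<partial>V (s0 n))"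
          by simp
        then show "norm (m (s0 n) * (\<integral>x. lk_integrand t x \<partial>V (s0 n))) \<le> (4 + \<bar>t\<bar> + t\<^sup>2) * c (s0 n)"
          using m[of "s0 n"] by (auto dest!: mult_left_mono[OF _ m[of "s0 n"]] simp: norm_mult c_def mult_ac)
      qed
    qed
    moreover have "finite_borel_measure (null_measure borel)"
      by (intro finite_borel_measure.intro finite_measureI) (auto simp: finite_borel_measure_axioms_def)
    moreover have "(\<integral>x. lk_kernel t x \<partial>null_measure borel) = 0" for t
      by (rule integral_eq_zero_AE) (rule AE_I[of _ _ UNIV], auto)
    ultimately show ?thesis using that[OF s0] by simp
  next
    case False
    then have c0_pos: "0 < c0" using \<open>0 \<le> c0\<close> by simp
    then have "\<forall>\<^sub>F n in sequentially. c0 / 2 < c (s0 n)" using c0 by (intro order_tendstoD) auto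
    then obtain N where N: "\<And>n. N \<le> n \<Longrightarrow> c0 / 2 < c (s0 n)" unfolding eventually_sequentially by auto
    \<comment> \<open>Dropping the first \<open>N\<close> terms keeps \<open>c\<close> above
      \<open>c0 / 2\<close>, so that every member can be normalised, with normalising factors
      bounded by \<open>2 / c0\<close>.\<close>
    define s where "s n = s0 (n + N)" for n
    have s: "strict_mono s" using s0 by (auto simp: s_def strict_mono_def)
    have cs: "c0 / 2 < c (s n)" for n using N by (simp add: s_def)
    then have cs_pos: "0 < c (s n)" for n using c0_pos cs[of n] by linarith
    have c_lim: "(\<lambda>n. c (s n)) \<longlonglongrightarrow> c0" unfolding s_def using c0 by (rule LIMSEQ_ignore_initial_segment)
    define r where "r n x = m (s n) / c (s n) * lk_weight x" for n x
    have r_nonneg: "0 \<le> r n x" for n x using m[of "s n"] cs_pos[of n] by (simp add: r_def)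
    have [measurable]: "r n \<in> borel_measurable borel" for n unfolding r_def by measurable
    define P where "P n = density (V (s n)) (\<lambda>x. ennreal (r n x))" for n
    have P: "real_distribution (P n)" for n
    proof -
      have "emeasure (P n) UNIV = (\<integral>\<^sup>+x. ennreal (r n x) \<partial>V (s n))"
        by (simp add: P_def emeasure_density)
      also have "\<dots> = ennreal (\<integral>x. r n x \<partial>V (s n))"
        using int_w[of "s n"] r_nonneg by (intro nn_integral_eq_integral) (auto simp: r_def)
      also have "(\<integral>x. r n x \<partial>V (s n)) = m (s n) / c (s n) * (\<integral>x. lk_weight x \<partial>V (s n))"
        using int_w[of "s n"] unfolding r_def by simp
      also have "\<dots> = c (s n) / c (s n)" unfolding c_def by simp
      also have "\<dots> = 1" using cs_pos[of n] by simp
      finally show ?thesis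
        by (intro real_distribution.intro prob_spaceI) (auto simp: real_distribution_axioms_def P_def)
    qed
    interpret P: real_distribution "P n" for n by (rule P)
    have P_int: "(\<integral>x. g x \<partial>P n) = (\<integral>x. r n x *\<^sub>R g x \<partial>V (s n))"
      if "g \<in> borel_measurable borel" for g :: "real \<Rightarrow> complex" and n
      unfolding P_def using r_nonneg that by (subst integral_density) auto
    have "tight P"
    proof (rule tightI_eventually[OF P])
      fix \<epsilon> :: real assume \<epsilon>: "0 < \<epsilon>"
      obtain R where R: "\<forall>\<^sub>F n in sequentially. m n * measure (V n) {x. R < \<bar>x\<bar>} \<le> \<epsilon> * (c0 / 2)"
        using tail[of "\<epsilon> * (c0 / 2)"] \<epsilon> c0_pos by auto
      have "\<forall>\<^sub>F n in sequentially. measure (P n) {x. R < \<bar>x\<bar>} \<le> \<epsilon>"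
        using eventually_subseq[OF s R]
      proof (rule eventually_mono)
        fix n assume n: "m (s n) * measure (V (s n)) {x. R < \<bar>x\<bar>} \<le> \<epsilon> * (c0 / 2)"
        have "ennreal (measure (P n) {x. R < \<bar>x\<bar>}) = (\<integral>\<^sup>+x. ennreal (r n x) * indicator {x. R < \<bar>x\<bar>} x \<partial>V (s n))"
          unfolding P.emeasure_eq_measure[symmetric] by (simp add: P_def emeasure_density)
        also have "\<dots> \<le> (\<integral>\<^sup>+x. ennreal (m (s n) / c (s n)) * indicator {x. R < \<bar>x\<bar>} x \<partial>V (s n))"
        proof (intro nn_integral_mono mult_right_mono ennreal_leI)
          show "r n x \<le> m (s n) / c (s n)" for x
            using mult_left_mono[OF lk_weight_le_1[of x], of "m (s n) / c (s n)"] m[of "s n"] cs_pos[of n]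
            by (simp add: r_def)
        qed simp
        also have "\<dots> = ennreal (m (s n) / c (s n) * measure (V (s n)) {x. R < \<bar>x\<bar>})"
          using m[of "s n"] cs_pos[of n]
          by (simp add: nn_integral_cmult V.emeasure_eq_measure ennreal_mult[symmetric])
        finally have "measure (P n) {x. R < \<bar>x\<bar>} \<le> (m (s n) * measure (V (s n)) {x. R < \<bar>x\<bar>}) / c (s n)"
          using m[of "s n"] cs_pos[of n] by (simp add: ennreal_le_iff)
        also have "\<dots> \<le> (\<epsilon> * (c0 / 2)) / (c0 / 2)"
          using n cs[of n] c0_pos m[of "s n"] \<epsilon> by (intro frac_le) auto
        finally show "measure (P n) {x. R < \<bar>x\<bar>} \<le> \<epsilon>" using c0_pos by simp
      qed
      then show "\<exists>K. \<forall>\<^sub>F n in sequentially. measure (P n) {x. K < \<bar>x\<bar>} \<le> \<epsilon>" ..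
    qed
    from tight_imp_convergent_subsubsequence[OF this strict_mono_id]
    obtain \<rho> M where \<rho>: "strict_mono \<rho>" and M: "real_distribution M" and weak: "weak_conv_m (P \<circ> id \<circ> \<rho>) M"
      by blast
    interpret M: real_distribution M by (rule M)
    have conv: "(\<lambda>n. \<integral>x. g x \<partial>P (\<rho> n)) \<longlonglongrightarrow> (\<integral>x. g x \<partial>M)"
      if "\<And>x. isCont g x" "\<And>x. norm (g x) \<le> B" for g :: "real \<Rightarrow> complex" and B
      using weak_conv_imp_integral_bdd_continuous_conv[OF _ M weak that] P by simp
    define Q where "Q = density M (\<lambda>_. ennreal c0)"
    have Q: "finite_borel_measure Q"
      by (intro finite_borel_measure.intro finite_measureI)
         (auto simp: Q_def finite_borel_measure_axioms_def emeasure_density_const M.emeasure_eq_measure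
           ennreal_mult_eq_top_iff)
    have "AE x in M. - \<tau> \<le> x" if \<tau>: "0 < \<tau>" for \<tau> :: real
    proof -
      \<comment> \<open>A bounded continuous function that is zero exactly on the points
        \<open>x \<ge> - \<tau>\<close>. Its integral in the limit law is 0, so the law does not
        charge the rest; \<open>\<tau>\<close> then runs through \<open>1 / Suc i\<close>.\<close>
      define g where "g x = complex_of_real (min 1 (max 0 (- x - \<tau>)))" for x
      have [measurable]: "g \<in> borel_measurable borel" unfolding g_def by measurable
      have "(\<lambda>n. \<integral>x. g x \<partial>P (\<rho> n)) \<longlonglongrightarrow> (\<integral>x. g x \<partial>M)"
      proof (rule conv)
        show "isCont g x" for x unfolding g_def by (intro continuous_intros)
        show "norm (g x) \<le> 1" for x unfolding g_def by (subst norm_of_real) auto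
      qed
      moreover have "\<forall>\<^sub>F n in sequentially. (\<integral>x. g x \<partial>P (\<rho> n)) = 0"
        using eventually_subseq[OF \<rho> eventually_subseq[OF s supp[OF \<tau>]]]
      proof (rule eventually_mono)
        fix n assume "measure (V (s (\<rho> n))) {..<- \<tau>} = 0"
        then have "{..<- \<tau>} \<in> null_sets (V (s (\<rho> n)))"
          by (auto simp: null_sets_def V.emeasure_eq_measure)
        then have "AE x in V (s (\<rho> n)). x \<notin> {..<- \<tau>}" by (rule AE_not_in)
        then have "AE x in V (s (\<rho> n)). r (\<rho> n) x *\<^sub>R g x = 0"
          by (rule eventually_mono) (auto simp: g_def)
        then show "(\<integral>x. g x \<partial>P (\<rho> n)) = 0"
          by (subst P_int) (auto intro: integral_eq_zero_AE)
      qed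
      ultimately have "(\<integral>x. g x \<partial>M) = 0"
        using tendsto_eventually LIMSEQ_unique by metis
      then have "complex_of_real (\<integral>x. min 1 (max 0 (- x - \<tau>)) \<partial>M) = 0" by (simp add: g_def)
      then have "(\<integral>x. min 1 (max 0 (- x - \<tau>)) \<partial>M) = 0" by (simp only: of_real_eq_0_iff)
      then have "AE x in M. min 1 (max 0 (- x - \<tau>)) = 0"
        by (subst (asm) integral_nonneg_eq_0_iff_AE)
           (auto intro!: integrable_bounded_borel[where B = 1] M.finite_borel_measure_M)
      then show ?thesis by (rule eventually_mono) (auto simp: min_def max_def split: if_splits)
    qed
    then have "AE x in M. \<forall>i. - (1 / real (Suc i)) \<le> x"
      by (subst AE_all_countable) auto
    then have "AE x in M. 0 \<le> x"
    proof (rule eventually_mono)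
      fix x :: real assume x: "\<forall>i. - (1 / real (Suc i)) \<le> x"
      show "0 \<le> x"
      proof (rule ccontr)
        assume "\<not> 0 \<le> x"
        then obtain i where "1 / real (Suc i) < - x"
          using reals_Archimedean[of "- x"] by (auto simp: inverse_eq_divide)
        then show False using x[rule_format, of i] by simp
      qed
    qed
    then have "AE x in M. x \<notin> {..<0}" by (rule eventually_mono) simp
    then have "emeasure M {..<0} = 0" by (subst (asm) AE_iff_measurable[of "{..<0}"]) auto
    then have Q0: "emeasure Q {..<0} = 0" by (simp add: Q_def emeasure_density_const)
    have "(\<lambda>n. m (s (\<rho> n)) * (\<integral>x. lk_integrand t x \<partial>V (s (\<rho> n)))) \<longlonglongrightarrow> (\<integral>x. lk_kernel t x \<partial>Q)" for t
    proof -
      have "(\<lambda>n. complex_of_real (c (s (\<rho> n))) * (\<integral>x. lk_kernel t x \<partial>P (\<rho> n))) \<longlonglongrightarrow>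
          complex_of_real c0 * (\<integral>x. lk_kernel t x \<partial>M)"
        using c_lim LIMSEQ_subseq_LIMSEQ[OF c_lim \<rho>]
        by (intro tendsto_intros conv[OF isCont_lk_kernel norm_lk_kernel_le]) (auto simp: comp_def)
      \<comment> \<open>The weight in the density of \<open>P n\<close> cancels the division in the
        kernel, which recovers the original integral.\<close>
      moreover have "complex_of_real (c (s n)) * (\<integral>x. lk_kernel t x \<partial>P n) =
          m (s n) * (\<integral>x. lk_integrand t x \<partial>V (s n))" for n
      proof -
        have "r n x *\<^sub>R lk_kernel t x = complex_of_real (m (s n) / c (s n)) * lk_integrand t x" for x
          by (simp only: r_def scaleR_conv_of_real lk_kernel_times_weight[symmetric] of_real_mult mult_ac)
        then have "(\<integral>x. lk_kernel t x \<partial>P n) = (\<integral>x. complex_of_real (m (s n) / c (s n)) * lk_integrand t x \<partial>V (s n))"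
          by (subst P_int) (simp_all only: lk_kernel_measurable)
        then show ?thesis using cs_pos[of n] by simp
      qed
      moreover have "(\<integral>x. lk_kernel t x \<partial>Q) = complex_of_real c0 * (\<integral>x. lk_kernel t x \<partial>M)"
        unfolding Q_def using c0_pos by (subst integral_density) (auto simp: scaleR_conv_of_real)
      ultimately show ?thesis by simp
    qed
    moreover have "strict_mono (\<lambda>n. s (\<rho> n))" using s \<rho> by (simp add: strict_mono_def)
    ultimately show ?thesis using that Q Q0 by blast
  qed
qed

text \<open>The drifts \<open>\<gamma> n\<close> need not converge. Compensating the jumps by
  \<open>x / (1 + x\<^sup>2)\<close> moves part of the exponent into new drifts
  \<open>\<Gamma> n\<close>; once the jump integrals converge along a subsequence,
  \<open>iexp (\<Gamma> n * t)\<close> converges to a quotient continuous at 0, which bounds the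
  drifts. A further subsequence fixes their limit.\<close>

lemma lk_limit:
  fixes V :: "nat \<Rightarrow> real measure" and m \<gamma> :: "nat \<Rightarrow> real" and f :: "real \<Rightarrow> complex"
  assumes V: "\<And>n. real_distribution (V n)" and m: "\<And>n. 0 \<le> m n"
    and bdd: "Bseq (\<lambda>n. m n * (\<integral>x. lk_weight x \<partial>V n))"
    and tail: "\<And>\<eta>. 0 < \<eta> \<Longrightarrow> \<exists>R. \<forall>\<^sub>F n in sequentially. m n * measure (V n) {x. R < \<bar>x\<bar>} \<le> \<eta>"
    and supp: "\<And>\<tau>. 0 < \<tau> \<Longrightarrow> \<forall>\<^sub>F n in sequentially. measure (V n) {..<-\<tau>} = 0"
    and f: "isCont f 0"
    and conv: "\<And>t. (\<lambda>n. exp (\<i> * complex_of_real (\<gamma> n * t) +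
        m n * (\<integral>x. iexp (t * x) - 1 \<partial>V n))) \<longlonglongrightarrow> f t"
  shows "\<exists>\<gamma>\<^sub>0 Q. finite_borel_measure Q \<and> emeasure Q {..<0} = 0 \<and>
    (\<forall>t. f t = exp (\<i> * complex_of_real (\<gamma>\<^sub>0 * t) + (\<integral>x. lk_kernel t x \<partial>Q)))"
proof -
  interpret V: real_distribution "V n" for n by (rule V)
  obtain \<rho> Q where \<rho>: "strict_mono (\<rho> :: nat \<Rightarrow> nat)" and Q: "finite_borel_measure Q" "emeasure Q {..<0} = 0"
    and lim: "\<And>t. (\<lambda>n. m (\<rho> n) * (\<integral>x. lk_integrand t x \<partial>V (\<rho> n))) \<longlonglongrightarrow> (\<integral>x. lk_kernel t x \<partial>Q)"
    using lk_weak_compactness[OF V m bdd tail supp] by metis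
  define \<Gamma> where "\<Gamma> n = \<gamma> n + m n * (\<integral>x. x / (1 + x\<^sup>2) \<partial>V n)" for n
  have split: "\<i> * complex_of_real (\<gamma> n * t) + m n * (\<integral>x. iexp (t * x) - 1 \<partial>V n)
      = \<i> * complex_of_real (\<Gamma> n * t) + m n * (\<integral>x. lk_integrand t x \<partial>V n)" for n t
  proof -
    have "\<bar>x / (1 + x\<^sup>2)\<bar> \<le> 1" for x :: real
    proof -
      have "\<bar>x\<bar> \<le> 1 + x\<^sup>2"
        using zero_le_power2[of "\<bar>x\<bar> - 1"] by (simp add: power2_eq_square algebra_simps)
      then show ?thesis using one_plus_square_pos[of x] by (simp add: divide_le_eq_1)
    qed
    then have int1: "integrable (V n) (\<lambda>x. x / (1 + x\<^sup>2))"
      by (intro integrable_bounded_borel[where B = 1]) (auto simp: V.finite_borel_measure_M)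
    have int2: "integrable (V n) (\<lambda>x. iexp (t * x) - 1)"
      by (intro integrable_bounded_borel[where B = 2]) (auto simp: V.finite_borel_measure_M norm_iexp_minus_1_le_2 simp del: of_real_mult)
    have "(\<integral>x. lk_integrand t x \<partial>V n) = (\<integral>x. (iexp (t * x) - 1) - \<i> * t * complex_of_real (x / (1 + x\<^sup>2)) \<partial>V n)"
      by (intro Bochner_Integration.integral_cong) (auto simp: lk_integrand_def)
    also have "\<dots> = (\<integral>x. iexp (t * x) - 1 \<partial>V n) - \<i> * t * (\<integral>x. x / (1 + x\<^sup>2) \<partial>V n)"
      using int1 int2 by (subst Bochner_Integration.integral_diff) (auto simp del: of_real_divide)
    finally have eq: "(\<integral>x. lk_integrand t x \<partial>V n) =
      (\<integral>x. iexp (t * x) - 1 \<partial>V n) - \<i> * t * (\<integral>x. x / (1 + x\<^sup>2) \<partial>V n)" .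
    show ?thesis unfolding eq by (simp add: \<Gamma>_def algebra_simps)
  qed
  define E where "E t = exp (\<integral>x. lk_kernel t x \<partial>Q)" for t
  have E_cont: "isCont E t" for t
    unfolding E_def by (intro continuous_intros isCont_integral_lk_kernel Q)
  have u: "(\<lambda>n. iexp (\<Gamma> (\<rho> n) * t)) \<longlonglongrightarrow> f t / E t" for t
  proof -
    have "(\<lambda>n. exp (\<i> * complex_of_real (\<Gamma> (\<rho> n) * t) + m (\<rho> n) * (\<integral>x. lk_integrand t x \<partial>V (\<rho> n)))) \<longlonglongrightarrow> f t"
      using LIMSEQ_subseq_LIMSEQ[OF conv[of t] \<rho>] unfolding comp_def split .
    moreover have "(\<lambda>n. exp (m (\<rho> n) * (\<integral>x. lk_integrand t x \<partial>V (\<rho> n)))) \<longlonglongrightarrow> E t"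
      unfolding E_def by (intro tendsto_exp lim)
    ultimately have "(\<lambda>n. exp (\<i> * complex_of_real (\<Gamma> (\<rho> n) * t) + m (\<rho> n) * (\<integral>x. lk_integrand t x \<partial>V (\<rho> n))) /
        exp (m (\<rho> n) * (\<integral>x. lk_integrand t x \<partial>V (\<rho> n)))) \<longlonglongrightarrow> f t / E t"
      by (intro tendsto_divide) (auto simp: E_def)
    then show ?thesis by (simp add: exp_diff[symmetric])
  qed
  have "Bseq (\<lambda>n. \<Gamma> (\<rho> n))"
    using u by (rule Bseq_of_iexp_tendsto) (auto intro!: continuous_divide f E_cont, simp add: E_def)
  then obtain \<kappa> \<gamma>\<^sub>0 where \<kappa>: "strict_mono (\<kappa> :: nat \<Rightarrow> nat)" and \<gamma>\<^sub>0: "(\<lambda>n. \<Gamma> (\<rho> (\<kappa> n))) \<longlonglongrightarrow> \<gamma>\<^sub>0"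
    by (rule Bseq_obtain_convergent_subseq)
  have "f t = exp (\<i> * complex_of_real (\<gamma>\<^sub>0 * t) + (\<integral>x. lk_kernel t x \<partial>Q))" for t
  proof -
    have "(\<lambda>n. iexp (\<Gamma> (\<rho> (\<kappa> n)) * t)) \<longlonglongrightarrow> iexp (\<gamma>\<^sub>0 * t)"
      by (intro tendsto_intros \<gamma>\<^sub>0)
    moreover have "(\<lambda>n. iexp (\<Gamma> (\<rho> (\<kappa> n)) * t)) \<longlonglongrightarrow> f t / E t"
      using LIMSEQ_subseq_LIMSEQ[OF u[of t] \<kappa>] by (simp add: comp_def)
    ultimately have "f t / E t = iexp (\<gamma>\<^sub>0 * t)" by (rule LIMSEQ_unique[rotated])
    then show ?thesis by (simp add: E_def exp_add field_simps)
  qed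
  then show ?thesis using Q by blast
qed

section \<open>Symmetrisation and truncated moments\<close>

definition sym_law :: "real measure \<Rightarrow> real measure" where
  "sym_law F = distr (F \<Otimes>\<^sub>M F) borel (\<lambda>(x, y). x - y)"

text \<open>A substitute for twice the variance: always finite, unaffected by shifts of
  \<open>F\<close>, and accessible through the modulus of the characteristic function.\<close>

definition sym_moment :: "real measure \<Rightarrow> real" where
  "sym_moment F = (\<integral>x. min 1 (x\<^sup>2) \<partial>sym_law F)"

text \<open>Clamping to the unit interval, rather than cutting values above 1 to 0, is 1-Lipschitz.
  This is what lets \<open>sym_moment\<close> control the variance of the truncated
  variable.\<close>

definition trunc_mean :: "real measure \<Rightarrow> real" where
  "trunc_mean F = (\<integral>x. max 0 (min x 1) \<partial>F)"

lemma char_uminus: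
  assumes "real_distribution F" shows "char F (- t) = cnj (char F t)"
proof -
  have "char F (- t) = (CLINT x|F. cnj (iexp (t * x)))"
    unfolding char_def by (simp add: exp_cnj)
  then show ?thesis unfolding char_def by simp
qed

lemma measure_tail_le_truncated_moment:
  assumes D: "real_distribution D" and "0 < \<delta>"
  shows "measure D {x. 1 / \<delta> < \<bar>x\<bar>} \<le> (\<integral>x. min 1 ((\<delta> * x)\<^sup>2) \<partial>D)"
proof -
  interpret D: real_distribution D by fact
  have "measure D {x. 1 / \<delta> < \<bar>x\<bar>} = (\<integral>x. indicator {x. 1 / \<delta> < \<bar>x\<bar>} x \<partial>D)" by simp
  also have "\<dots> \<le> (\<integral>x. min 1 ((\<delta> * x)\<^sup>2) \<partial>D)"
  proof (rule integral_mono)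
    show "integrable D (\<lambda>x. min 1 ((\<delta> * x)\<^sup>2))"
      by (rule integrable_bounded_borel[where B = 1]) (auto simp: D.finite_borel_measure_M)
    show "indicator {x. 1 / \<delta> < \<bar>x\<bar>} x \<le> min 1 ((\<delta> * x)\<^sup>2)" for x
    proof (cases "1 / \<delta> < \<bar>x\<bar>")
      case True
      then have "1 \<le> \<bar>\<delta> * x\<bar>" using assms by (simp add: field_simps abs_mult)
      then have "1 \<le> \<bar>\<delta> * x\<bar>\<^sup>2" by (rule one_le_power)
      then show ?thesis by simp
    qed simp
  qed (auto simp: D.emeasure_eq_measure)
  finally show ?thesis .
qed

section \<open>Estimates for a single law in terms of its symmetrisation\<close>

context real_distribution
begin

lemma pair_prob_space_self: "pair_prob_space M M"
  by unfold_locales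

lemma integral_pair_mult:
  fixes f g :: "real \<Rightarrow> complex"
  assumes [measurable]: "f \<in> borel_measurable borel" "g \<in> borel_measurable borel"
    and f: "\<And>x. norm (f x) \<le> A" and g: "\<And>x. norm (g x) \<le> B"
  shows "(\<integral>z. f (fst z) * g (snd z) \<partial>(M \<Otimes>\<^sub>M M)) = (\<integral>x. f x \<partial>M) * (\<integral>y. g y \<partial>M)"
proof -
  interpret P: pair_prob_space M M by (rule pair_prob_space_self)
  have "0 \<le> A" using order_trans[OF norm_ge_zero f[of 0]] .
  then have "norm (f x * g y) \<le> A * B" for x y
    unfolding norm_mult using f[of x] g[of y] by (intro mult_mono) auto
  then have "integrable (M \<Otimes>\<^sub>M M) (\<lambda>z. f (fst z) * g (snd z))"
    by (intro P.integrable_const_bound[where B = "A * B"]) auto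
  from P.integral_fst'[OF this] show ?thesis by simp
qed

lemma real_distribution_sym_law: "real_distribution (sym_law M)"
proof -
  interpret P: pair_prob_space M M by (rule pair_prob_space_self)
  show ?thesis unfolding sym_law_def by (rule P.real_distribution_distr) simp
qed

lemma integral_sym_law:
  fixes f :: "real \<Rightarrow> 'b::{banach, second_countable_topology}"
  assumes [measurable]: "f \<in> borel_measurable borel"
  shows "(\<integral>x. f x \<partial>sym_law M) = (\<integral>z. f (fst z - snd z) \<partial>(M \<Otimes>\<^sub>M M))"
  unfolding sym_law_def by (subst integral_distr) (auto simp: case_prod_beta)

text \<open>An independent copy with reversed sign contributes the complex conjugate. Shifts only
  change the phase and hence disappear, so information about normalised sums can be used without
  knowing their centring.\<close>

lemma char_sym_law: "char (sym_law M) t = complex_of_real ((norm (char M t))\<^sup>2)"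
proof -
  have "char (sym_law M) t = (\<integral>z. iexp (t * fst z) * iexp (- t * snd z) \<partial>(M \<Otimes>\<^sub>M M))"
    unfolding char_def
    by (subst integral_sym_law) (auto intro!: Bochner_Integration.integral_cong simp: exp_add[symmetric] algebra_simps)
  also have "\<dots> = char M t * char M (- t)"
    unfolding char_def by (rule integral_pair_mult[where A = 1 and B = 1]) (simp_all del: of_real_mult)
  also have "\<dots> = complex_of_real ((norm (char M t))\<^sup>2)"
    by (simp add: char_uminus[OF real_distribution_axioms] complex_norm_square[symmetric])
  finally show ?thesis .
qed

text \<open>Desymmetrisation: the independent copy is at most 1/2 with probability at least 1/2, and
  on that event a value above \<open>R\<close> gives a difference above
  \<open>R - 1 / 2\<close>.\<close>

lemma measure_sym_law_tail_ge:
  assumes "measure M {x. 1 / 2 < x} \<le> 1 / 2"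
  shows "measure M {x. R < x} \<le> 2 * measure (sym_law M) {x. R - 1 / 2 < \<bar>x\<bar>}"
proof -
  interpret P: pair_prob_space M M by (rule pair_prob_space_self)
  have "measure M {x. x \<le> 1 / 2} = 1 - measure M {x. 1 / 2 < x}"
  proof -
    have "{x. x \<le> 1 / 2} = space M - {x::real. 1 / 2 < x}" by auto
    then show ?thesis by (simp only:) (subst prob_compl, auto)
  qed
  then have half: "1 / 2 \<le> measure M {x. x \<le> 1 / 2}" using assms by simp
  have "measure M {x. R < x} * measure M {x. x \<le> 1 / 2} = measure (M \<Otimes>\<^sub>M M) ({x. R < x} \<times> {x. x \<le> 1 / 2})"
    by (simp add: measure_def emeasure_pair_measure_Times enn2real_mult)
  also have "\<dots> \<le> measure (M \<Otimes>\<^sub>M M) ((\<lambda>(x, y). x - y) -` {x. R - 1 / 2 < \<bar>x\<bar>} \<inter> space (M \<Otimes>\<^sub>M M))"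
  proof (rule P.finite_measure_mono)
    show "(\<lambda>(x, y). x - y) -` {x. R - 1 / 2 < \<bar>x\<bar>} \<inter> space (M \<Otimes>\<^sub>M M) \<in> sets (M \<Otimes>\<^sub>M M)"
      by (rule measurable_sets[where A = borel]) auto
  qed (auto simp: space_pair_measure)
  also have "\<dots> = measure (sym_law M) {x. R - 1 / 2 < \<bar>x\<bar>}"
    unfolding sym_law_def by (subst measure_distr) auto
  finally have "measure M {x. R < x} * measure M {x. x \<le> 1 / 2} \<le> measure (sym_law M) {x. R - 1 / 2 < \<bar>x\<bar>}" .
  moreover have "measure M {x. R < x} * (1 / 2) \<le> measure M {x. R < x} * measure M {x. x \<le> 1 / 2}"
    using half by (intro mult_left_mono) auto
  ultimately show ?thesis by simp
qed

lemma integrable_clamp: "integrable M (\<lambda>x. max 0 (min x 1))"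
  by (rule integrable_bounded_borel[where B = 1]) (auto simp: finite_borel_measure_M)

lemma trunc_mean_nonneg: "0 \<le> trunc_mean M"
  unfolding trunc_mean_def by (rule Bochner_Integration.integral_nonneg) simp

lemma trunc_mean_le_1: "trunc_mean M \<le> 1"
proof -
  have "trunc_mean M \<le> (\<integral>x. 1 \<partial>M)"
    unfolding trunc_mean_def by (intro integral_mono integrable_clamp) auto
  then show ?thesis by (simp add: prob_space[simplified])
qed

lemma trunc_mean_le:
  assumes "0 < \<tau>"
  shows "trunc_mean M \<le> \<tau> + measure M {x. \<tau> < x}"
proof -
  have "trunc_mean M \<le> (\<integral>x. \<tau> + indicator {x. \<tau> < x} x \<partial>M)"
    unfolding trunc_mean_def
  proof (intro integral_mono integrable_clamp)
    show "integrable M (\<lambda>x. \<tau> + indicator {x. \<tau> < x} x)" by (simp add: emeasure_eq_measure)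
    show "max 0 (min x 1) \<le> \<tau> + indicator {x. \<tau> < x} x" for x
      using assms by (auto split: split_indicator)
  qed
  also have "\<dots> = \<tau> + measure M {x. \<tau> < x}"
    by (subst Bochner_Integration.integral_add) (auto simp: emeasure_eq_measure prob_space[simplified])
  finally show ?thesis .
qed

lemma sym_moment_eq: "sym_moment M = (\<integral>z. min 1 ((fst z - snd z)\<^sup>2) \<partial>(M \<Otimes>\<^sub>M M))"
  unfolding sym_moment_def by (subst integral_sym_law) auto

lemma sym_moment_nonneg: "0 \<le> sym_moment M"
  unfolding sym_moment_def by (rule Bochner_Integration.integral_nonneg) simp

text \<open>The variance of a variable is half the mean square difference of two independent copies,
  and clamped values differ by at most the minimum of 1 and the original difference.\<close>

lemma clamp_variance_le: "(\<integral>x. (max 0 (min x 1) - trunc_mean M)\<^sup>2 \<partial>M) \<le> sym_moment M"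
proof -
  interpret P: pair_prob_space M M by (rule pair_prob_space_self)
  define Z where "Z x = max 0 (min x (1::real))" for x
  have [measurable]: "Z \<in> borel_measurable borel" unfolding Z_def by measurable
  define \<mu> where "\<mu> = (\<integral>x. Z x \<partial>M)"
  define e where "e = (\<integral>x. (Z x)\<^sup>2 \<partial>M)"
  have Z: "0 \<le> Z x" "Z x \<le> 1" for x by (auto simp: Z_def)
  have [simp]: "integrable M Z" unfolding Z_def by (rule integrable_clamp)
  have [simp]: "integrable M (\<lambda>x. (Z x)\<^sup>2)"
    by (rule integrable_bounded_borel[where B = 1])
       (auto simp: finite_borel_measure_M Z abs_square_le_1)
  have ZZ: "(Z x - Z y)\<^sup>2 \<le> min 1 ((x - y)\<^sup>2)" for x y
  proof -
    have "\<bar>Z x - Z y\<bar> \<le> 1" "\<bar>Z x - Z y\<bar> \<le> \<bar>x - y\<bar>" by (auto simp: Z_def)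
    then show ?thesis by (simp add: abs_square_le_1 abs_le_square_iff)
  qed
  then have ZZ1: "(Z x - Z y)\<^sup>2 \<le> 1" for x y by (meson min.boundedE)
  have int: "integrable (M \<Otimes>\<^sub>M M) (\<lambda>z. (Z (fst z) - Z (snd z))\<^sup>2)"
    by (rule P.integrable_const_bound[where B = 1]) (auto simp: ZZ1)
  have inner: "(\<integral>y. (Z x - Z y)\<^sup>2 \<partial>M) = (Z x)\<^sup>2 - 2 * \<mu> * Z x + e" for x
  proof -
    have "(\<integral>y. (Z x - Z y)\<^sup>2 \<partial>M) = (\<integral>y. (Z x)\<^sup>2 - 2 * Z x * Z y + (Z y)\<^sup>2 \<partial>M)"
      by (simp add: power2_diff algebra_simps)
    also have "\<dots> = (Z x)\<^sup>2 - 2 * Z x * \<mu> + e"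
      by (simp add: \<mu>_def e_def prob_space[simplified])
    finally show ?thesis by simp
  qed
  have "(\<integral>x. (Z x - \<mu>)\<^sup>2 \<partial>M) = (\<integral>x. (Z x)\<^sup>2 - 2 * \<mu> * Z x + \<mu>\<^sup>2 \<partial>M)"
    by (simp add: power2_diff algebra_simps)
  also have "\<dots> = e - 2 * \<mu> * \<mu> + \<mu>\<^sup>2"
    by (simp add: \<mu>_def e_def prob_space[simplified])
  finally have var: "(\<integral>x. (Z x - \<mu>)\<^sup>2 \<partial>M) = e - \<mu>\<^sup>2" by (simp add: power2_eq_square)
  have "(\<integral>z. (Z (fst z) - Z (snd z))\<^sup>2 \<partial>(M \<Otimes>\<^sub>M M)) = (\<integral>x. (Z x)\<^sup>2 - 2 * \<mu> * Z x + e \<partial>M)"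
    using P.integral_fst'[OF int] by (simp add: inner)
  also have "\<dots> = e - 2 * \<mu> * \<mu> + e"
    by (simp add: \<mu>_def e_def prob_space[simplified])
  finally have pair: "(\<integral>z. (Z (fst z) - Z (snd z))\<^sup>2 \<partial>(M \<Otimes>\<^sub>M M)) = 2 * (e - \<mu>\<^sup>2)"
    by (simp add: power2_eq_square)
  have "2 * (e - \<mu>\<^sup>2) \<le> sym_moment M"
    unfolding sym_moment_eq pair[symmetric]
  proof (rule integral_mono[OF int])
    show "integrable (M \<Otimes>\<^sub>M M) (\<lambda>z. min 1 ((fst z - snd z)\<^sup>2))"
      by (rule P.integrable_const_bound[where B = 1]) auto
  qed (rule ZZ)
  moreover have "0 \<le> e - \<mu>\<^sup>2" unfolding var[symmetric] by simp
  then have "e - \<mu>\<^sup>2 \<le> 2 * (e - \<mu>\<^sup>2)" by simp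
  ultimately have "e - \<mu>\<^sup>2 \<le> sym_moment M" by (meson order_trans)
  then show ?thesis unfolding var[symmetric] unfolding Z_def \<mu>_def trunc_mean_def .
qed

text \<open>The constant 8 is 2 from desymmetrisation times 4 from comparing the threshold 1/2 with
  the truncation at 1.\<close>

lemma measure_gt_1_le_sym_moment:
  assumes "measure M {x. 1 / 2 < x} \<le> 1 / 2"
  shows "measure M {x. 1 < x} \<le> 8 * sym_moment M"
proof -
  interpret D: real_distribution "sym_law M" by (rule real_distribution_sym_law)
  have "measure M {x. 1 < x} \<le> 2 * measure (sym_law M) {x. 1 / 2 < \<bar>x\<bar>}"
    using measure_sym_law_tail_ge[OF assms, of 1] by simp
  also have "measure (sym_law M) {x. 1 / 2 < \<bar>x\<bar>} \<le> (\<integral>x. min 1 ((2 * x)\<^sup>2) \<partial>sym_law M)"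
    by (rule measure_tail_le_truncated_moment[OF D.real_distribution_axioms]) simp
  also have "\<dots> \<le> (\<integral>x. 4 * min 1 (x\<^sup>2) \<partial>sym_law M)"
  proof (rule integral_mono)
    show "integrable (sym_law M) (\<lambda>x. min 1 ((2 * x)\<^sup>2))"
      by (rule integrable_bounded_borel[where B = 1]) (auto simp: D.finite_borel_measure_M)
    show "integrable (sym_law M) (\<lambda>x. 4 * min 1 (x\<^sup>2))"
      by (rule integrable_mult_right, rule integrable_bounded_borel[where B = 1]) (auto simp: D.finite_borel_measure_M)
  qed (auto simp: power_mult_distrib min_def)
  also have "\<dots> = 4 * sym_moment M" unfolding sym_moment_def by simp
  finally show ?thesis by simp
qed

text \<open>Below 1 the clamp is the identity and the second-order Taylor bound leaves the clamped
  variance; above 1 the bound \<open>2 + \<bar>t\<bar>\<close> is paid only with the tail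
  probability. Both quantities are multiples of \<open>sym_moment\<close>.\<close>

lemma norm_centered_char_le:
  assumes nonneg: "AE x in M. 0 \<le> x" and half: "measure M {x. 1 / 2 < x} \<le> 1 / 2"
  shows "norm (\<integral>x. iexp (t * (x - trunc_mean M)) - 1 \<partial>M) \<le> (t\<^sup>2 + 8 * (2 + \<bar>t\<bar>)) * sym_moment M"
proof -
  define Z where "Z x = max 0 (min x (1::real))" for x
  define \<mu> where "\<mu> = trunc_mean M"
  have \<mu>: "0 \<le> \<mu>" "\<mu> \<le> 1" unfolding \<mu>_def by (rule trunc_mean_nonneg, rule trunc_mean_le_1)
  have Z: "0 \<le> Z x" "Z x \<le> 1" for x by (auto simp: Z_def)
  have [measurable]: "Z \<in> borel_measurable borel" unfolding Z_def by measurable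
  have Z\<mu>: "\<bar>Z x - \<mu>\<bar> \<le> 1" for x using Z[of x] \<mu> by linarith
  have [simp]: "integrable M Z" unfolding Z_def by (rule integrable_clamp)
  have int1: "integrable M (\<lambda>x. iexp (t * (x - \<mu>)) - 1)"
    by (rule integrable_bounded_borel[where B = 2])
       (auto simp: finite_borel_measure_M norm_iexp_minus_1_le_2 simp del: of_real_mult of_real_diff)
  have int2: "integrable M (\<lambda>x. \<i> * t * complex_of_real (Z x - \<mu>))"
    by (rule integrable_mult_right, rule integrable_bounded_borel[where B = 1])
       (auto simp: finite_borel_measure_M Z\<mu> simp del: of_real_diff)
  have int3: "integrable M (\<lambda>x. t\<^sup>2 / 2 * (Z x - \<mu>)\<^sup>2)"
    by (rule integrable_mult_right, rule integrable_bounded_borel[where B = 1])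
       (auto simp: finite_borel_measure_M Z\<mu> abs_square_le_1)
  have "(\<integral>x. complex_of_real (Z x - \<mu>) \<partial>M) = complex_of_real (\<integral>x. Z x - \<mu> \<partial>M)"
    by (rule integral_complex_of_real)
  also have "(\<integral>x. Z x - \<mu> \<partial>M) = 0"
    unfolding \<mu>_def trunc_mean_def Z_def by (subst Bochner_Integration.integral_diff) (auto simp: integrable_clamp prob_space[simplified])
  finally have zero: "(\<integral>x. \<i> * t * complex_of_real (Z x - \<mu>) \<partial>M) = 0"
    by (simp del: of_real_diff)
  \<comment> \<open>The linear term may be inserted for free because \<open>Z - \<mu>\<close> has
    mean 0; this is the purpose of centring at the truncated mean.\<close>
  have "(\<integral>x. iexp (t * (x - \<mu>)) - 1 \<partial>M) = (\<integral>x. iexp (t * (x - \<mu>)) - 1 - \<i> * t * complex_of_real (Z x - \<mu>) \<partial>M)"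
    by (simp only: Bochner_Integration.integral_diff[OF int1 int2] zero diff_zero)
  also have "norm \<dots> \<le> (\<integral>x. norm (iexp (t * (x - \<mu>)) - 1 - \<i> * t * complex_of_real (Z x - \<mu>)) \<partial>M)"
    by (rule integral_norm_bound)
  also have "\<dots> \<le> (\<integral>x. t\<^sup>2 / 2 * (Z x - \<mu>)\<^sup>2 + (2 + \<bar>t\<bar>) * indicator {x. 1 < x} x \<partial>M)"
  proof (rule integral_mono_AE)
    show "integrable M (\<lambda>x. norm (iexp (t * (x - \<mu>)) - 1 - \<i> * t * complex_of_real (Z x - \<mu>)))"
      by (intro integrable_norm Bochner_Integration.integrable_diff[OF int1 int2])
    show "integrable M (\<lambda>x. t\<^sup>2 / 2 * (Z x - \<mu>)\<^sup>2 + (2 + \<bar>t\<bar>) * indicator {x. 1 < x} x)"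
      by (intro Bochner_Integration.integrable_add int3 integrable_mult_right) (auto simp: emeasure_eq_measure)
    show "AE x in M. norm (iexp (t * (x - \<mu>)) - 1 - \<i> * t * complex_of_real (Z x - \<mu>)) \<le>
        t\<^sup>2 / 2 * (Z x - \<mu>)\<^sup>2 + (2 + \<bar>t\<bar>) * indicator {x. 1 < x} x"
      using nonneg
    proof (rule eventually_mono)
      fix x :: real assume x: "0 \<le> x"
      show "norm (iexp (t * (x - \<mu>)) - 1 - \<i> * t * complex_of_real (Z x - \<mu>)) \<le>
        t\<^sup>2 / 2 * (Z x - \<mu>)\<^sup>2 + (2 + \<bar>t\<bar>) * indicator {x. 1 < x} x"
      proof (cases "x \<le> 1")
        case True
        then have "Z x = x" using x by (simp add: Z_def)
        then show ?thesis using norm_iexp_second_order[of "t * (x - \<mu>)"] True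
          by (simp add: power_mult_distrib mult.assoc)
      next
        case False
        have "norm (iexp (t * (x - \<mu>)) - 1 - \<i> * t * complex_of_real (Z x - \<mu>)) \<le>
            norm (iexp (t * (x - \<mu>)) - 1) + norm (\<i> * t * complex_of_real (Z x - \<mu>))"
          by (rule norm_triangle_ineq4)
        also have "\<dots> \<le> 2 + \<bar>t\<bar> * \<bar>Z x - \<mu>\<bar>"
          using norm_iexp_minus_1_le_2[of "t * (x - \<mu>)"] by (simp only: norm_mult norm_of_real norm_ii mult_1)
        also have "\<dots> \<le> 2 + \<bar>t\<bar> * 1" using Z\<mu>[of x] by (intro add_left_mono mult_left_mono) auto
        finally have "norm (iexp (t * (x - \<mu>)) - 1 - \<i> * t * complex_of_real (Z x - \<mu>)) \<le> 2 + \<bar>t\<bar>" by simp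
        moreover have "(2 + \<bar>t\<bar>) * indicat_real {x. 1 < x} x = 2 + \<bar>t\<bar>" using False by simp
        ultimately show ?thesis by (intro add_increasing) (simp, simp only:)
      qed
    qed
  qed
  also have "\<dots> = t\<^sup>2 / 2 * (\<integral>x. (Z x - \<mu>)\<^sup>2 \<partial>M) + (2 + \<bar>t\<bar>) * measure M {x. 1 < x}"
    using int3 by (subst Bochner_Integration.integral_add) (auto simp: emeasure_eq_measure)
  also have "\<dots> \<le> t\<^sup>2 * sym_moment M + (2 + \<bar>t\<bar>) * (8 * sym_moment M)"
  proof (intro add_mono mult_mono measure_gt_1_le_sym_moment half)
    show "(\<integral>x. (Z x - \<mu>)\<^sup>2 \<partial>M) \<le> sym_moment M" unfolding Z_def \<mu>_def by (rule clamp_variance_le)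
  qed auto
  finally show ?thesis unfolding \<mu>_def by (simp add: algebra_simps)
qed

text \<open>The same division at 1; the constant 9 is 1 for the clamped variance plus 8 for the
  tail.\<close>

lemma integral_lk_weight_centered_le:
  assumes nonneg: "AE x in M. 0 \<le> x" and half: "measure M {x. 1 / 2 < x} \<le> 1 / 2"
  shows "(\<integral>x. lk_weight (x - trunc_mean M) \<partial>M) \<le> 9 * sym_moment M"
proof -
  define Z where "Z x = max 0 (min x (1::real))" for x
  define \<mu> where "\<mu> = trunc_mean M"
  have \<mu>: "0 \<le> \<mu>" "\<mu> \<le> 1" unfolding \<mu>_def by (rule trunc_mean_nonneg, rule trunc_mean_le_1)
  have [measurable]: "Z \<in> borel_measurable borel" unfolding Z_def by measurable
  have Z\<mu>: "\<bar>Z x - \<mu>\<bar> \<le> 1" for x using \<mu> by (simp add: Z_def) 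
  have int: "integrable M (\<lambda>x. (Z x - \<mu>)\<^sup>2)"
    by (rule integrable_bounded_borel[where B = 1])
       (auto simp: finite_borel_measure_M Z\<mu> abs_square_le_1)
  have "(\<integral>x. lk_weight (x - \<mu>) \<partial>M) \<le> (\<integral>x. (Z x - \<mu>)\<^sup>2 + indicator {x. 1 < x} x \<partial>M)"
  proof (rule integral_mono_AE)
    show "integrable M (\<lambda>x. lk_weight (x - \<mu>))"
      by (rule integrable_bounded_borel[where B = 1]) (auto simp: finite_borel_measure_M)
    show "integrable M (\<lambda>x. (Z x - \<mu>)\<^sup>2 + indicator {x. 1 < x} x)"
      using int by (simp add: emeasure_eq_measure)
    show "AE x in M. lk_weight (x - \<mu>) \<le> (Z x - \<mu>)\<^sup>2 + indicator {x. 1 < x} x"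
      using nonneg
    proof (rule eventually_mono)
      fix x :: real assume x: "0 \<le> x"
      show "lk_weight (x - \<mu>) \<le> (Z x - \<mu>)\<^sup>2 + indicator {x. 1 < x} x"
      proof (cases "x \<le> 1")
        case True
        then have "Z x = x" using x by (simp add: Z_def)
        then show ?thesis using True lk_weight_le_square[of "x - \<mu>"] by simp
      next
        case False
        have "lk_weight (x - \<mu>) \<le> (Z x - \<mu>)\<^sup>2 + 1"
          using lk_weight_le_1[of "x - \<mu>"] zero_le_power2[of "Z x - \<mu>"] by linarith
        then show ?thesis using False by simp
      qed
    qed
  qed
  also have "\<dots> = (\<integral>x. (Z x - \<mu>)\<^sup>2 \<partial>M) + measure M {x. 1 < x}"
    using int by (subst Bochner_Integration.integral_add) (auto simp: emeasure_eq_measure)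
  also have "\<dots> \<le> sym_moment M + 8 * sym_moment M"
  proof (intro add_mono measure_gt_1_le_sym_moment half)
    show "(\<integral>x. (Z x - \<mu>)\<^sup>2 \<partial>M) \<le> sym_moment M" unfolding Z_def \<mu>_def by (rule clamp_variance_le)
  qed
  finally show ?thesis unfolding \<mu>_def by simp
qed

text \<open>Two values between 0 and \<open>\<tau>\<close> differ by at most \<open>\<tau>\<close>;
  otherwise one of the two copies is exceptional, which costs at most 1.\<close>

lemma sym_moment_le:
  assumes nonneg: "AE x in M. 0 \<le> x" and \<tau>: "0 < \<tau>"
  shows "sym_moment M \<le> \<tau>\<^sup>2 + 2 * measure M {x. \<tau> < x}"
proof -
  interpret P: pair_prob_space M M by (rule pair_prob_space_self)
  \<comment> \<open>Adding the negative half-line, a null set here, turns the almost sure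
    nonnegativity into a pointwise case distinction.\<close>
  let ?N = "{x. \<tau> < x} \<union> {..<0}"
  have "AE x in M. x \<notin> {..<0}" using nonneg by (rule eventually_mono) auto
  then have "emeasure M {..<0} = 0" by (subst (asm) AE_iff_measurable[of "{..<0}"]) auto
  then have "measure M ?N = measure M {x. \<tau> < x}"
    by (intro measure_Un_null_set) (auto simp: null_sets_def)
  have int1: "integrable (M \<Otimes>\<^sub>M M) (\<lambda>z. indicat_real ?N (fst z))"
    and int2: "integrable (M \<Otimes>\<^sub>M M) (\<lambda>z. indicat_real ?N (snd z))"
    by (auto intro!: P.integrable_const_bound[where B = 1])
  have fst: "(\<integral>z. indicat_real ?N (fst z) \<partial>(M \<Otimes>\<^sub>M M)) = measure M ?N"
    using P.integral_fst'[OF int1] by (simp add: prob_space[simplified])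
  have snd: "(\<integral>z. indicat_real ?N (snd z) \<partial>(M \<Otimes>\<^sub>M M)) = measure M ?N"
    using P.integral_fst'[OF int2] by (simp add: prob_space[simplified])
  have "sym_moment M \<le> (\<integral>z. \<tau>\<^sup>2 + (indicator ?N (fst z) + indicator ?N (snd z)) \<partial>(M \<Otimes>\<^sub>M M))"
    unfolding sym_moment_eq
  proof (rule integral_mono)
    show "integrable (M \<Otimes>\<^sub>M M) (\<lambda>z. min 1 ((fst z - snd z)\<^sup>2))"
      by (rule P.integrable_const_bound[where B = 1]) auto
    show "integrable (M \<Otimes>\<^sub>M M) (\<lambda>z. \<tau>\<^sup>2 + (indicat_real ?N (fst z) + indicator ?N (snd z)))"
      using int1 int2 by simp
    fix z :: "real \<times> real"
    show "min 1 ((fst z - snd z)\<^sup>2) \<le> \<tau>\<^sup>2 + (indicator ?N (fst z) + indicator ?N (snd z))"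
    proof (cases "fst z \<in> ?N \<or> snd z \<in> ?N")
      case True
      then have "1 \<le> indicat_real ?N (fst z) + indicator ?N (snd z)" by (auto simp: indicator_def)
      then show ?thesis using zero_le_power2[of \<tau>] min.cobounded1[of 1 "(fst z - snd z)\<^sup>2"] by linarith
    next
      case False
      then have "\<bar>fst z - snd z\<bar> \<le> \<bar>\<tau>\<bar>" using \<tau> by auto
      then have "(fst z - snd z)\<^sup>2 \<le> \<tau>\<^sup>2" by (simp add: abs_le_square_iff)
      then show ?thesis using False by simp
    qed
  qed
  also have "\<dots> = \<tau>\<^sup>2 + 2 * measure M ?N"
    using int1 int2 by (simp add: fst snd P.prob_space[simplified])
  finally show ?thesis using \<open>measure M ?N = measure M {x. \<tau> < x}\<close> by simp
qed

end

text \<open>For \<open>u \<le> 2\<close> the expansion of the sine up to the fifth power gives the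
  coefficient 1/6 - 4/120 = 2/15, above 1/8; for \<open>u > 2\<close> the quotient is at most 1/2.
  Evenness covers negative \<open>u\<close>.\<close>

lemma one_minus_sinc_ge:
  fixes u :: real
  assumes "u \<noteq> 0"
  shows "min 1 (u\<^sup>2) / 8 \<le> 1 - sin u / u"
proof -
  have *: "min 1 (u\<^sup>2) / 8 \<le> 1 - sin u / u" if u: "0 < u" for u :: real
  proof (cases "u \<le> 2")
    case True
    have "(\<Sum>m<5. sin_coeff m * u ^ m) = u - u ^ 3 / 6"
    proof -
      have "{..<5::nat} = {0, 1, 2, 3, 4}" by auto
      then show ?thesis by (simp add: sin_coeff_def fact_numeral)
    qed
    then have "\<bar>sin u - (u - u ^ 3 / 6)\<bar> \<le> u ^ 5 / 120"
      using Maclaurin_sin_bound[of u 5] u by (simp add: fact_numeral)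
    then have "sin u \<le> u - u ^ 3 / 6 + u ^ 5 / 120" by linarith
    then have "sin u / u \<le> (u - u ^ 3 / 6 + u ^ 5 / 120) / u" using u by (intro divide_right_mono) auto
    also have "\<dots> = 1 - u\<^sup>2 / 6 + u\<^sup>2 * u\<^sup>2 / 120"
      using u by (simp add: field_simps eval_nat_numeral)
    also have "\<dots> \<le> 1 - u\<^sup>2 / 6 + u\<^sup>2 * 4 / 120"
      using True u power_mono[of u 2 2] by (intro add_mono divide_right_mono mult_left_mono) auto
    finally have "sin u / u \<le> 1 - u\<^sup>2 / 6 + u\<^sup>2 * 4 / 120" .
    then have "u\<^sup>2 / 8 \<le> 1 - sin u / u" using zero_le_power2[of u] by linarith
    then show ?thesis by (smt (verit) divide_right_mono)
  next
    case False
    have "sin u / u \<le> 1 / 2" using False sin_le_one[of u] by (intro frac_le) auto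
    then show ?thesis by linarith
  qed
  show ?thesis using *[of u] *[of "- u"] assms by (cases "0 < u") auto
qed

lemma integral_one_minus_cos:
  fixes \<delta> x :: real
  assumes \<delta>: "0 < \<delta>"
  shows "(LBINT t:{0..\<delta>}. 1 - cos (t * x)) = (if x = 0 then 0 else \<delta> * (1 - sin (\<delta> * x) / (\<delta> * x)))"
proof (cases "x = 0")
  case True
  then show ?thesis by (simp add: set_lebesgue_integral_def)
next
  case False
  have "((\<lambda>t. 1 - cos (t * x)) has_integral (\<delta> - sin (\<delta> * x) / x) - (0 - sin (0 * x) / x)) {0..\<delta>}"
    using False \<delta>
    by (intro fundamental_theorem_of_calculus)
       (auto intro!: derivative_eq_intros simp: has_real_derivative_iff_has_vector_derivative[symmetric])
  moreover have "set_integrable lborel {0..\<delta>} (\<lambda>t. 1 - cos (t * x))"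
    by (intro borel_integrable_atLeastAtMost') (intro continuous_intros)
  ultimately show ?thesis
    using False \<delta> by (simp add: set_borel_integral_eq_integral integral_unique field_simps)
qed

text \<open>The truncated second moment is controlled by the characteristic function near the origin,
  because the mean of \<open>1 - cos (t x)\<close> over \<open>0 \<le> t \<le> \<delta>\<close> is \<open>1 - sin (\<delta> x) / (\<delta> x)\<close>.\<close>

lemma sum_truncated_moment_le:
  fixes D :: "'k \<Rightarrow> real measure"
  assumes D: "\<And>k. k \<in> I \<Longrightarrow> real_distribution (D k)" and I: "finite I" and \<delta>: "0 < \<delta>"
    and le: "\<And>t. t \<in> {0..\<delta>} \<Longrightarrow> (\<Sum>k\<in>I. 1 - Re (char (D k) t)) \<le> \<eta>"
  shows "(\<Sum>k\<in>I. \<integral>x. min 1 ((\<delta> * x)\<^sup>2) \<partial>D k) \<le> 8 * \<eta>"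
proof -
  have key: "(\<integral>x. min 1 ((\<delta> * x)\<^sup>2) \<partial>D k) \<le> 8 / \<delta> * (LBINT t:{0..\<delta>}. 1 - Re (char (D k) t))"
    if k: "k \<in> I" for k
  proof -
    interpret D: real_distribution "D k" using D[OF k] .
    interpret P: pair_sigma_finite lborel "D k" ..
    have int: "integrable (lborel \<Otimes>\<^sub>M D k) (\<lambda>(t, x). indicator {0..\<delta>} t * (1 - cos (t * x)))"
    proof (rule integrableI_bounded_set[where A = "{0..\<delta>} \<times> UNIV" and B = 2])
      show "emeasure (lborel \<Otimes>\<^sub>M D k) ({0..\<delta>} \<times> UNIV) < \<infinity>"
        using \<delta> by (subst D.emeasure_pair_measure_Times) (auto simp: D.emeasure_eq_measure ennreal_mult_less_top)
      show "AE z\<in>{0..\<delta>} \<times> UNIV in lborel \<Otimes>\<^sub>M D k.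
          norm (case z of (t, x) \<Rightarrow> indicator {0..\<delta>} t * (1 - cos (t * x))) \<le> 2"
      proof (intro AE_I2 impI)
        fix z :: "real \<times> real"
        have "\<bar>1 - cos (fst z * snd z)\<bar> \<le> 2" using cos_ge_minus_one[of "fst z * snd z"] cos_le_one[of "fst z * snd z"] by linarith
        then show "norm (case z of (t, x) \<Rightarrow> indicator {0..\<delta>} t * (1 - cos (t * x))) \<le> 2"
          by (auto simp: case_prod_beta split: split_indicator)
      qed
    qed (auto intro!: AE_I2 simp: indicator_def split: if_splits)
    have c: "1 - Re (char (D k) t) = (\<integral>x. 1 - cos (t * x) \<partial>D k)" for t
    proof -
      have "integrable (D k) (\<lambda>x. iexp (t * x))"
        by (rule integrable_bounded_borel[where B = 1]) (auto simp: D.finite_borel_measure_M simp del: of_real_mult)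
      then have "Re (char (D k) t) = (\<integral>x. cos (t * x) \<partial>D k)"
        unfolding char_def by (subst integral_Re[symmetric]) (auto simp: Re_exp)
      moreover have "integrable (D k) (\<lambda>x. cos (t * x))"
        by (rule integrable_bounded_borel[where B = 1]) (auto simp: D.finite_borel_measure_M)
      ultimately show ?thesis by (subst Bochner_Integration.integral_diff) (auto simp: D.prob_space[simplified])
    qed
    have "(LBINT t:{0..\<delta>}. 1 - Re (char (D k) t)) = (\<integral>t. (\<integral>x. indicator {0..\<delta>} t * (1 - cos (t * x)) \<partial>D k) \<partial>lborel)"
      unfolding set_lebesgue_integral_def c by simp
    also have "\<dots> = (\<integral>x. (\<integral>t. indicator {0..\<delta>} t * (1 - cos (t * x)) \<partial>lborel) \<partial>D k)"
      by (rule P.Fubini_integral[symmetric, OF int])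
    also have "\<dots> = (\<integral>x. (if x = 0 then 0 else \<delta> * (1 - sin (\<delta> * x) / (\<delta> * x))) \<partial>D k)"
      unfolding integral_one_minus_cos[OF \<delta>, symmetric] set_lebesgue_integral_def by simp
    also have "\<dots> \<ge> (\<integral>x. \<delta> / 8 * min 1 ((\<delta> * x)\<^sup>2) \<partial>D k)"
    proof (rule integral_mono)
      show "integrable (D k) (\<lambda>x. \<delta> / 8 * min 1 ((\<delta> * x)\<^sup>2))"
        by (intro integrable_mult_right integrable_bounded_borel[where B = 1]) (auto simp: D.finite_borel_measure_M)
      have b: "\<bar>sin u / u\<bar> \<le> 1" for u :: real
        using abs_sin_x_le_abs_x[of u] by (cases "u = 0") (auto simp: divide_le_eq_1)
      show "integrable (D k) (\<lambda>x. if x = 0 then 0 else \<delta> * (1 - sin (\<delta> * x) / (\<delta> * x)))"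
      proof (rule integrable_bounded_borel[where B = "2 * \<delta>"])
        fix x
        have "\<bar>1 - sin (\<delta> * x) / (\<delta> * x)\<bar> \<le> 2" using b[of "\<delta> * x"] by linarith
        then show "norm (if x = 0 then 0 else \<delta> * (1 - sin (\<delta> * x) / (\<delta> * x))) \<le> 2 * \<delta>"
          using \<delta> by (auto simp: abs_mult)
      qed (auto simp: D.finite_borel_measure_M)
      show "\<delta> / 8 * min 1 ((\<delta> * x)\<^sup>2) \<le> (if x = 0 then 0 else \<delta> * (1 - sin (\<delta> * x) / (\<delta> * x)))" for x
        using one_minus_sinc_ge[of "\<delta> * x"] \<delta> mult_left_mono[of "min 1 ((\<delta> * x)\<^sup>2) / 8" "1 - sin (\<delta> * x) / (\<delta> * x)" \<delta>]
        by auto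
    qed
    finally have "\<delta> / 8 * (\<integral>x. min 1 ((\<delta> * x)\<^sup>2) \<partial>D k) \<le> (LBINT t:{0..\<delta>}. 1 - Re (char (D k) t))" by simp
    then show ?thesis using \<delta> by (simp add: field_simps)
  qed
  have cont: "continuous_on {0..\<delta>} (\<lambda>t. 1 - Re (char (D k) t))" if "k \<in> I" for k
  proof -
    interpret D: real_distribution "D k" using D[OF that] .
    show ?thesis
      by (intro continuous_intros continuous_at_imp_continuous_on ballI D.isCont_char)
  qed
  then have sint: "set_integrable lborel {0..\<delta>} (\<lambda>t. 1 - Re (char (D k) t))" if "k \<in> I" for k
    using that by (intro borel_integrable_atLeastAtMost')
  have "(\<Sum>k\<in>I. \<integral>x. min 1 ((\<delta> * x)\<^sup>2) \<partial>D k) \<le> (\<Sum>k\<in>I. 8 / \<delta> * (LBINT t:{0..\<delta>}. 1 - Re (char (D k) t)))"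
    by (intro sum_mono key)
  also have "\<dots> = 8 / \<delta> * (\<Sum>k\<in>I. LBINT t:{0..\<delta>}. 1 - Re (char (D k) t))"
    by (rule sum_distrib_left[symmetric])
  also have "(\<Sum>k\<in>I. LBINT t:{0..\<delta>}. 1 - Re (char (D k) t)) = (LBINT t:{0..\<delta>}. \<Sum>k\<in>I. 1 - Re (char (D k) t))"
    unfolding set_lebesgue_integral_def scaleR_sum_right
    using sint by (intro Bochner_Integration.integral_sum[symmetric]) (auto simp: set_integrable_def)
  also have "\<dots> \<le> (LBINT t:{0..\<delta>}. \<eta>)"
  proof (rule set_integral_mono)
    show "set_integrable lborel {0..\<delta>} (\<lambda>t. \<Sum>k\<in>I. 1 - Re (char (D k) t))"
      using cont by (intro borel_integrable_atLeastAtMost' continuous_on_sum)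
  qed (use le in \<open>auto intro!: borel_integrable_atLeastAtMost'\<close>)
  also have "(LBINT t:{0..\<delta>}. \<eta>) = \<delta> * \<eta>"
    using \<delta> by (simp add: set_lebesgue_integral_def)
  finally show ?thesis using \<delta> by (simp add: mult_left_mono field_simps)
qed

section \<open>Infinitesimal arrays of nonnegative summands\<close>

text \<open>An index is drawn uniformly and then a value from its law. This writes a finite sum of
  laws as a mass times one probability law, the form in which \<open>lk_limit\<close> takes jump
  measures.\<close>

lemma mixture_of_distributions:
  fixes N :: "nat \<Rightarrow> real measure"
  assumes I: "finite I" "I \<noteq> {}" and N: "\<And>k. real_distribution (N k)"
  obtains V where "real_distribution V"
    "\<And>f :: real \<Rightarrow> real. \<And>B. f \<in> borel_measurable borel \<Longrightarrow> (\<And>x. \<bar>f x\<bar> \<le> B) \<Longrightarrow>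
      real (card I) * (\<integral>x. f x \<partial>V) = (\<Sum>k\<in>I. \<integral>x. f x \<partial>N k)"
proof -
  interpret N: real_distribution "N k" for k by (rule N)
  define p where "p = measure_pmf (pmf_of_set I)"
  interpret p: prob_space p unfolding p_def by (rule measure_pmf.prob_space_axioms)
  define V where "V = p \<bind> N"
  have Nm [measurable]: "N \<in> measurable p (subprob_algebra borel)"
    unfolding p_def by (auto simp: space_subprob_algebra N.subprob_space_axioms)
  have ne: "space p \<noteq> {}" by (simp add: p_def)
  have "prob_space V"
    unfolding V_def by (rule p.prob_space_bind[OF _ Nm]) (auto simp: N.prob_space_axioms)
  moreover have "sets V = sets borel" unfolding V_def using ne by (intro sets_bind) auto
  ultimately have "real_distribution V"
    by (auto simp: real_distribution_def real_distribution_axioms_def)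
  moreover have "real (card I) * (\<integral>x. f x \<partial>V) = (\<Sum>k\<in>I. \<integral>x. f x \<partial>N k)"
    if f: "f \<in> borel_measurable borel" "\<And>x. \<bar>f x\<bar> \<le> B" for f :: "real \<Rightarrow> real" and B
  proof -
    have "(\<integral>x. f x \<partial>V) = (\<integral>k. (\<integral>x. f x \<partial>N k) \<partial>p)"
      unfolding V_def using f
      by (intro integral_bind[where K = borel and B = B and B' = 1])
         (auto intro!: Nm p.finite_measure_axioms simp: N.emeasure_space_1[simplified])
    also have "\<dots> = (\<Sum>k\<in>I. \<integral>x. f x \<partial>N k) / real (card I)"
      unfolding p_def using I by (rule integral_pmf_of_set[rotated])
    finally show ?thesis using I by simp
  qed
  ultimately show ?thesis using that by blast
qed

lemma integral_complex_decompose: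
  fixes f :: "real \<Rightarrow> complex"
  assumes "finite_borel_measure M" "f \<in> borel_measurable borel" "\<And>x. norm (f x) \<le> B"
  shows "(\<integral>x. f x \<partial>M) = Complex (\<integral>x. Re (f x) \<partial>M) (\<integral>x. Im (f x) \<partial>M)"
  using integrable_bounded_borel[OF assms] by (simp add: complex_eq_iff)

text \<open>A continuous ramp lies between the indicators of \<open>\<bar>x\<bar> > i + 1\<close>
  and \<open>\<bar>x\<bar> > i\<close>, so the tail of the limit controls those of the
  sequence.\<close>

lemma weak_conv_tail_eventually:
  assumes \<mu>: "\<And>n. real_distribution (\<mu> n)" and M: "real_distribution M" and weak: "weak_conv_m \<mu> M"
    and \<epsilon>: "0 < \<epsilon>"
  shows "\<exists>K>0. \<forall>\<^sub>F n in sequentially. measure (\<mu> n) {x. K < \<bar>x\<bar>} \<le> \<epsilon>"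
proof -
  interpret \<mu>: real_distribution "\<mu> n" for n by (rule \<mu>)
  interpret M: real_distribution M by (rule M)
  have "(\<lambda>i. measure M {x. real i < \<bar>x\<bar>}) \<longlonglongrightarrow> 0" by (rule M.measure_tail_tendsto_0)
  then have "\<forall>\<^sub>F i in sequentially. measure M {x. real i < \<bar>x\<bar>} < \<epsilon>"
    using \<epsilon> by (intro order_tendstoD) auto
  then obtain i where i: "measure M {x. real i < \<bar>x\<bar>} < \<epsilon>" by (auto simp: eventually_sequentially)
  define g where "g x = min 1 (max 0 (\<bar>x\<bar> - real i))" for x :: real
  have g: "0 \<le> g x" "g x \<le> 1" for x by (auto simp: g_def)
  have [measurable]: "g \<in> borel_measurable borel" unfolding g_def by measurable
  have gi: "integrable N g" if "real_distribution N" for N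
    using g real_distribution.finite_borel_measure_M[OF that]
    by (intro integrable_bounded_borel[where B = 1]) auto
  have "(\<lambda>n. \<integral>x. g x \<partial>\<mu> n) \<longlonglongrightarrow> (\<integral>x. g x \<partial>M)"
  proof (rule weak_conv_imp_integral_bdd_continuous_conv[OF \<mu> M weak])
    show "isCont g x" for x unfolding g_def by (intro continuous_intros)
    show "norm (g x) \<le> 1" for x using g[of x] by simp
  qed
  moreover have "(\<integral>x. g x \<partial>M) \<le> (\<integral>x. indicator {x. real i < \<bar>x\<bar>} x \<partial>M)"
    by (intro integral_mono gi M) (auto simp: M.emeasure_eq_measure g_def split: split_indicator)
  then have "(\<integral>x. g x \<partial>M) < \<epsilon>" using i by simp
  ultimately have "\<forall>\<^sub>F n in sequentially. (\<integral>x. g x \<partial>\<mu> n) < \<epsilon>" by (rule order_tendstoD)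
  then have "\<forall>\<^sub>F n in sequentially. measure (\<mu> n) {x. real (Suc i) < \<bar>x\<bar>} \<le> \<epsilon>"
  proof (rule eventually_mono)
    fix n assume n: "(\<integral>x. g x \<partial>\<mu> n) < \<epsilon>"
    have "measure (\<mu> n) {x. real (Suc i) < \<bar>x\<bar>} = (\<integral>x. indicator {x. real (Suc i) < \<bar>x\<bar>} x \<partial>\<mu> n)" by simp
    also have "\<dots> \<le> (\<integral>x. g x \<partial>\<mu> n)"
      by (intro integral_mono gi \<mu>) (auto simp: \<mu>.emeasure_eq_measure g_def split: split_indicator)
    finally show "measure (\<mu> n) {x. real (Suc i) < \<bar>x\<bar>} \<le> \<epsilon>" using n by simp
  qed
  then show ?thesis by (intro exI[of _ "real (Suc i)"]) simp
qed

text \<open>On \<open>\<bar>x\<bar> \<le> K\<close> the exponential is Lipschitz in the frequency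
  with constant \<open>K\<close>; beyond, the trivial bound 2 is used. With uniform tails this is
  equicontinuity.\<close>

lemma (in real_distribution) norm_char_diff_le:
  assumes "0 \<le> K"
  shows "norm (char M s - char M t) \<le> \<bar>s - t\<bar> * K + 2 * measure M {x. K < \<bar>x\<bar>}"
proof -
  have int: "integrable M (\<lambda>x. iexp (u * x))" for u
    by (rule integrable_bounded_borel[where B = 1]) (auto simp: finite_borel_measure_M simp del: of_real_mult)
  have "norm (char M s - char M t) = norm (\<integral>x. iexp (s * x) - iexp (t * x) \<partial>M)"
    unfolding char_def using int by (subst Bochner_Integration.integral_diff) auto
  also have "\<dots> \<le> (\<integral>x. norm (iexp (s * x) - iexp (t * x)) \<partial>M)" by (rule integral_norm_bound)
  also have "\<dots> \<le> (\<integral>x. \<bar>s - t\<bar> * K + 2 * indicator {x. K < \<bar>x\<bar>} x \<partial>M)"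
  proof (rule integral_mono)
    show "integrable M (\<lambda>x. norm (iexp (s * x) - iexp (t * x)))"
      by (intro integrable_norm Bochner_Integration.integrable_diff int)
    show "integrable M (\<lambda>x. \<bar>s - t\<bar> * K + 2 * indicator {x. K < \<bar>x\<bar>} x)"
      by (intro Bochner_Integration.integrable_add integrable_mult_right) (auto simp: emeasure_eq_measure)
    fix x
    have "iexp (s * x) - iexp (t * x) = iexp (t * x) * (iexp ((s - t) * x) - 1)"
      by (simp add: algebra_simps exp_add[symmetric])
    then have eq: "norm (iexp (s * x) - iexp (t * x)) = norm (iexp ((s - t) * x) - 1)"
      by (simp only: norm_mult norm_iexp mult_1)
    show "norm (iexp (s * x) - iexp (t * x)) \<le> \<bar>s - t\<bar> * K + 2 * indicator {x. K < \<bar>x\<bar>} x"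
    proof (cases "K < \<bar>x\<bar>")
      case True
      then show ?thesis unfolding eq using norm_iexp_minus_1_le_2[of "(s - t) * x"] assms
        by (simp add: add_increasing)
    next
      case False
      then have "\<bar>(s - t) * x\<bar> \<le> \<bar>s - t\<bar> * K" by (simp add: abs_mult mult_left_mono)
      then show ?thesis unfolding eq using norm_iexp_minus_1_le[of "(s - t) * x"] False by simp
    qed
  qed
  also have "\<dots> = \<bar>s - t\<bar> * K + 2 * measure M {x. K < \<bar>x\<bar>}"
    by (subst Bochner_Integration.integral_add) (auto simp: emeasure_eq_measure prob_space[simplified])
  finally show ?thesis .
qed

text \<open>Convergence of the transforms at each \<open>t\<close> is not uniform by itself; the
  uniform tail bound makes one neighbourhood of 0 serve all large \<open>n\<close>.\<close>

lemma weak_conv_char_near_0: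
  assumes \<mu>: "\<And>n. real_distribution (\<mu> n)" and M: "real_distribution M" and weak: "weak_conv_m \<mu> M"
    and \<epsilon>: "0 < \<epsilon>"
  shows "\<exists>\<delta>>0. \<delta> \<le> 1 \<and> (\<forall>\<^sub>F n in sequentially. \<forall>t. \<bar>t\<bar> \<le> \<delta> \<longrightarrow> norm (char (\<mu> n) t - 1) \<le> \<epsilon>)"
proof -
  obtain K where K: "0 < K" "\<forall>\<^sub>F n in sequentially. measure (\<mu> n) {x. K < \<bar>x\<bar>} \<le> \<epsilon> / 4"
    using weak_conv_tail_eventually[OF \<mu> M weak, of "\<epsilon> / 4"] \<epsilon> by auto
  define \<delta> where "\<delta> = min 1 (\<epsilon> / (2 * K))"
  have \<delta>: "0 < \<delta>" "\<delta> \<le> 1" "\<delta> * K \<le> \<epsilon> / 2"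
    using K \<epsilon> mult_right_mono[of \<delta> "\<epsilon> / (2 * K)" K] by (auto simp: \<delta>_def)
  have "\<forall>\<^sub>F n in sequentially. \<forall>t. \<bar>t\<bar> \<le> \<delta> \<longrightarrow> norm (char (\<mu> n) t - 1) \<le> \<epsilon>"
    using K(2)
  proof (rule eventually_mono, safe)
    fix n t assume n: "measure (\<mu> n) {x. K < \<bar>x\<bar>} \<le> \<epsilon> / 4" and t: "\<bar>t\<bar> \<le> \<delta>"
    interpret N: real_distribution "\<mu> n" by (rule \<mu>)
    have "norm (char (\<mu> n) t - char (\<mu> n) 0) \<le> \<bar>t - 0\<bar> * K + 2 * measure (\<mu> n) {x. K < \<bar>x\<bar>}"
      using K by (intro N.norm_char_diff_le) simp
    also have "\<dots> \<le> \<delta> * K + 2 * (\<epsilon> / 4)" using t n K by (intro add_mono mult_mono) auto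
    also have "\<dots> \<le> \<epsilon>" using \<delta> by simp
    finally show "norm (char (\<mu> n) t - 1) \<le> \<epsilon>" by (simp add: N.char_zero)
  qed
  then show ?thesis using \<delta> by blast
qed

text \<open>Equicontinuity from the common tails allows the frequency to vary with \<open>n\<close>,
  as it does when the normalising scale changes.\<close>

lemma weak_conv_char_moving:
  assumes \<mu>: "\<And>n. real_distribution (\<mu> n)" and M: "real_distribution M" and weak: "weak_conv_m \<mu> M"
    and s: "s \<longlonglongrightarrow> t"
  shows "(\<lambda>n. char (\<mu> n) (s n)) \<longlonglongrightarrow> char M t"
proof -
  have "(\<lambda>n. char (\<mu> n) (s n) - char (\<mu> n) t) \<longlonglongrightarrow> 0"
  proof (rule LIMSEQ_I)
    fix e :: real assume e: "0 < e"
    obtain K where K: "0 < K" "\<forall>\<^sub>F n in sequentially. measure (\<mu> n) {x. K < \<bar>x\<bar>} \<le> e / 8"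
      using weak_conv_tail_eventually[OF \<mu> M weak, of "e / 8"] e by auto
    have "(\<lambda>n. \<bar>s n - t\<bar> * K) \<longlonglongrightarrow> \<bar>t - t\<bar> * K"
      using s by (intro tendsto_intros)
    then have "\<forall>\<^sub>F n in sequentially. \<bar>s n - t\<bar> * K < e / 4"
      using e by (intro order_tendstoD) auto
    then have "\<forall>\<^sub>F n in sequentially. norm (char (\<mu> n) (s n) - char (\<mu> n) t - 0) < e"
      using K(2)
    proof eventually_elim
      case (elim n)
      interpret N: real_distribution "\<mu> n" by (rule \<mu>)
      show ?case using N.norm_char_diff_le[of K "s n" t] K(1) elim e by simp
    qed
    then show "\<exists>no. \<forall>n\<ge>no. norm (char (\<mu> n) (s n) - char (\<mu> n) t - 0) < e"
      unfolding eventually_sequentially .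
  qed
  from tendsto_add[OF this levy_continuity1[OF \<mu> M weak, of t]] show ?thesis by simp
qed

lemma weak_conv_m_compose:
  assumes "weak_conv_m \<mu> M" "filterlim k sequentially sequentially"
  shows "weak_conv_m (\<lambda>n. \<mu> (k n)) M"
  using assms unfolding weak_conv_m_def weak_conv_def by (auto intro: filterlim_compose)

lemma norm_exp_minus_1_minus_le:
  fixes z :: complex
  assumes "norm z \<le> 1"
  shows "norm (1 + z - exp z) \<le> 3 * (norm z)\<^sup>2"
proof -
  have "norm (exp z - (\<Sum>k\<le>1. z ^ k / fact k)) \<le> exp \<bar>Re z\<bar> * norm z ^ Suc 1 / fact 1"
    by (rule Taylor_exp)
  then have "norm (exp z - (1 + z)) \<le> exp \<bar>Re z\<bar> * (norm z)\<^sup>2"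
    by (simp add: power2_eq_square)
  also have "\<dots> \<le> 3 * (norm z)\<^sup>2"
  proof (rule mult_right_mono)
    have "\<bar>Re z\<bar> \<le> 1" using abs_Re_le_cmod[of z] assms by linarith
    then have "exp \<bar>Re z\<bar> \<le> exp 1" by simp
    then show "exp \<bar>Re z\<bar> \<le> 3" using exp_le by linarith
  qed simp
  finally show ?thesis by (simp add: norm_minus_commute)
qed

text \<open>\<open>W n\<close> is the law of the sum over row \<open>n\<close> minus
  \<open>A n\<close>. It is tied to the summands only through its transform, so no common
  probability space is needed.\<close>

locale infinitesimal_array =
  fixes F :: "nat \<Rightarrow> nat \<Rightarrow> real measure" and I :: "nat \<Rightarrow> nat set"
    and W :: "nat \<Rightarrow> real measure" and A :: "nat \<Rightarrow> real" and M :: "real measure"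
  assumes F: "\<And>n k. real_distribution (F n k)"
    and I: "\<And>n. finite (I n)" "\<And>n. I n \<noteq> {}"
    and nonneg: "\<And>n k. k \<in> I n \<Longrightarrow> AE x in F n k. 0 \<le> x"
    and negligible: "\<And>\<tau> \<epsilon>. 0 < \<tau> \<Longrightarrow> 0 < \<epsilon> \<Longrightarrow>
      \<forall>\<^sub>F n in sequentially. \<forall>k\<in>I n. measure (F n k) {x. \<tau> < x} \<le> \<epsilon>"
    and W: "\<And>n. real_distribution (W n)"
    and char_W: "\<And>n t. char (W n) t = iexp (- (A n * t)) * (\<Prod>k\<in>I n. char (F n k) t)"
    and M: "real_distribution M" and weak: "weak_conv_m W M"
begin

sublocale F: real_distribution "F n k" for n k by (rule F)

text \<open>Near 0 the modulus of the transform of \<open>W n\<close> is close to 1, and its square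
  is the product of the transforms of the symmetrised summands. The inequality
  \<open>y \<le> exp (- (1 - y))\<close> turns this product into a bound on the sum of their
  defects.\<close>

lemma sum_sym_truncated_le:
  assumes \<eta>: "0 < \<eta>"
  shows "\<exists>\<delta>>0. \<delta> \<le> 1 \<and> (\<forall>\<^sub>F n in sequentially.
    (\<Sum>k\<in>I n. \<integral>x. min 1 ((\<delta> * x)\<^sup>2) \<partial>sym_law (F n k)) \<le> 8 * \<eta>)"
proof -
  \<comment> \<open>Chosen so that the squared modulus is at least \<open>exp (- \<eta>)\<close>;
    comparing exponents then bounds the sum of defects by \<open>\<eta>\<close>.\<close>
  have "0 < 1 - exp (- \<eta> / 2)" using \<eta> by simp
  from weak_conv_char_near_0[OF W M weak this]
  obtain \<delta> where \<delta>: "0 < \<delta>" "\<delta> \<le> 1"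
    and near: "\<forall>\<^sub>F n in sequentially. \<forall>t. \<bar>t\<bar> \<le> \<delta> \<longrightarrow> norm (char (W n) t - 1) \<le> 1 - exp (- \<eta> / 2)"
    by blast
  have "\<forall>\<^sub>F n in sequentially. (\<Sum>k\<in>I n. \<integral>x. min 1 ((\<delta> * x)\<^sup>2) \<partial>sym_law (F n k)) \<le> 8 * \<eta>"
    using near
  proof (rule eventually_mono)
    fix n assume n: "\<forall>t. \<bar>t\<bar> \<le> \<delta> \<longrightarrow> norm (char (W n) t - 1) \<le> 1 - exp (- \<eta> / 2)"
    show "(\<Sum>k\<in>I n. \<integral>x. min 1 ((\<delta> * x)\<^sup>2) \<partial>sym_law (F n k)) \<le> 8 * \<eta>"
    proof (rule sum_truncated_moment_le[OF F.real_distribution_sym_law I(1) \<delta>(1)])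
      fix t assume t: "t \<in> {0..\<delta>}"
      have "norm (char (W n) t - 1) \<le> 1 - exp (- \<eta> / 2)" using n t by auto
      then have low: "exp (- \<eta> / 2) \<le> norm (char (W n) t)"
        using norm_triangle_ineq2[of 1 "char (W n) t"] by (simp add: norm_minus_commute)
      have "exp (- \<eta>) = (exp (- \<eta> / 2))\<^sup>2" by (simp add: power2_eq_square exp_add[symmetric])
      also have "\<dots> \<le> (norm (char (W n) t))\<^sup>2" using low by (intro power_mono) auto
      also have "norm (char (W n) t) = (\<Prod>k\<in>I n. norm (char (F n k) t))"
        unfolding char_W norm_mult norm_iexp prod_norm by simp
      also have "\<dots>\<^sup>2 = (\<Prod>k\<in>I n. (norm (char (F n k) t))\<^sup>2)" by (rule prod_power_distrib)
      also have "\<dots> \<le> (\<Prod>k\<in>I n. exp (- (1 - (norm (char (F n k) t))\<^sup>2)))"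
      proof (rule prod_mono, safe)
        fix k
        show "(norm (char (F n k) t))\<^sup>2 \<le> exp (- (1 - (norm (char (F n k) t))\<^sup>2))"
          using exp_ge_add_one_self[of "- (1 - (norm (char (F n k) t))\<^sup>2)"] by simp
      qed simp
      also have "\<dots> = exp (- (\<Sum>k\<in>I n. 1 - (norm (char (F n k) t))\<^sup>2))"
        by (simp add: exp_sum[OF I(1)] sum_negf[symmetric])
      finally have "(\<Sum>k\<in>I n. 1 - (norm (char (F n k) t))\<^sup>2) \<le> \<eta>" by simp
      then show "(\<Sum>k\<in>I n. 1 - Re (char (sym_law (F n k)) t)) \<le> \<eta>"
        by (simp add: F.char_sym_law del: of_real_power)
    qed
  qed
  then show ?thesis using \<delta> by blast
qed

text \<open>Returning from the truncation scale \<open>1 / \<delta>\<close> to 1 costs the factor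
  \<open>1 / \<delta>\<^sup>2\<close>.\<close>

lemma sum_sym_moment_bounded: "\<exists>C>0. \<forall>\<^sub>F n in sequentially. (\<Sum>k\<in>I n. sym_moment (F n k)) \<le> C"
proof -
  obtain \<delta> where \<delta>: "0 < \<delta>" "\<delta> \<le> 1"
    and ev: "\<forall>\<^sub>F n in sequentially. (\<Sum>k\<in>I n. \<integral>x. min 1 ((\<delta> * x)\<^sup>2) \<partial>sym_law (F n k)) \<le> 8 * 1"
    using sum_sym_truncated_le[of 1] by auto
  have le: "\<delta>\<^sup>2 * sym_moment (F n k) \<le> (\<integral>x. min 1 ((\<delta> * x)\<^sup>2) \<partial>sym_law (F n k))" for n k
  proof -
    interpret S: real_distribution "sym_law (F n k)" by (rule F.real_distribution_sym_law)
    have "\<delta>\<^sup>2 * sym_moment (F n k) = (\<integral>x. \<delta>\<^sup>2 * min 1 (x\<^sup>2) \<partial>sym_law (F n k))"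
      unfolding sym_moment_def by simp
    also have "\<dots> \<le> (\<integral>x. min 1 ((\<delta> * x)\<^sup>2) \<partial>sym_law (F n k))"
    proof (rule integral_mono)
      show "integrable (sym_law (F n k)) (\<lambda>x. \<delta>\<^sup>2 * min 1 (x\<^sup>2))"
        by (rule integrable_mult_right, rule integrable_bounded_borel[where B = 1]) (auto simp: S.finite_borel_measure_M)
      show "integrable (sym_law (F n k)) (\<lambda>x. min 1 ((\<delta> * x)\<^sup>2))"
        by (rule integrable_bounded_borel[where B = 1]) (auto simp: S.finite_borel_measure_M)
      have d2: "0 \<le> \<delta>\<^sup>2" "\<delta>\<^sup>2 \<le> 1" using \<delta> by (auto simp: power_le_one)
      show "\<delta>\<^sup>2 * min 1 (x\<^sup>2) \<le> min 1 ((\<delta> * x)\<^sup>2)" for x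
        using d2 mult_le_one[of "\<delta>\<^sup>2" "min 1 (x\<^sup>2)"]
        by (auto simp: power_mult_distrib intro!: mult_left_mono)
    qed
    finally show ?thesis .
  qed
  have "\<forall>\<^sub>F n in sequentially. (\<Sum>k\<in>I n. sym_moment (F n k)) \<le> 8 / \<delta>\<^sup>2"
    using ev
  proof (rule eventually_mono)
    fix n assume n: "(\<Sum>k\<in>I n. \<integral>x. min 1 ((\<delta> * x)\<^sup>2) \<partial>sym_law (F n k)) \<le> 8 * 1"
    have "\<delta>\<^sup>2 * (\<Sum>k\<in>I n. sym_moment (F n k)) \<le> (\<Sum>k\<in>I n. \<integral>x. min 1 ((\<delta> * x)\<^sup>2) \<partial>sym_law (F n k))"
      unfolding sum_distrib_left by (intro sum_mono le)
    also have "\<dots> \<le> 8" using n by simp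
    finally show "(\<Sum>k\<in>I n. sym_moment (F n k)) \<le> 8 / \<delta>\<^sup>2" using \<delta> by (simp add: field_simps)
  qed
  then show ?thesis using \<delta> by (intro exI[of _ "8 / \<delta>\<^sup>2"]) auto
qed

lemma half_eventually: "\<forall>\<^sub>F n in sequentially. \<forall>k\<in>I n. measure (F n k) {x. 1 / 2 < x} \<le> 1 / 2"
  by (rule negligible) auto

lemma sym_moment_eventually_small:
  assumes "0 < \<epsilon>"
  shows "\<forall>\<^sub>F n in sequentially. \<forall>k\<in>I n. sym_moment (F n k) \<le> \<epsilon>"
proof -
  define \<tau> where "\<tau> = sqrt (\<epsilon> / 2)"
  have \<tau>: "0 < \<tau>" "\<tau>\<^sup>2 = \<epsilon> / 2" using assms by (auto simp: \<tau>_def)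
  have "\<forall>\<^sub>F n in sequentially. \<forall>k\<in>I n. measure (F n k) {x. \<tau> < x} \<le> \<epsilon> / 4"
    using assms \<tau> by (intro negligible) auto
  then show ?thesis
  proof (rule eventually_mono, intro ballI)
    fix n k assume n: "\<forall>k\<in>I n. measure (F n k) {x. \<tau> < x} \<le> \<epsilon> / 4" and k: "k \<in> I n"
    have "sym_moment (F n k) \<le> \<tau>\<^sup>2 + 2 * measure (F n k) {x. \<tau> < x}"
      by (rule F.sym_moment_le[OF nonneg[OF k] \<tau>(1)])
    then show "sym_moment (F n k) \<le> \<epsilon>" using n k \<tau> by fastforce
  qed
qed

lemma trunc_mean_eventually_small:
  assumes "0 < \<epsilon>"
  shows "\<forall>\<^sub>F n in sequentially. \<forall>k\<in>I n. trunc_mean (F n k) \<le> \<epsilon>"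
proof -
  have "\<forall>\<^sub>F n in sequentially. \<forall>k\<in>I n. measure (F n k) {x. \<epsilon> / 2 < x} \<le> \<epsilon> / 2"
    using assms by (intro negligible) auto
  then show ?thesis
  proof (rule eventually_mono, intro ballI)
    fix n k assume n: "\<forall>k\<in>I n. measure (F n k) {x. \<epsilon> / 2 < x} \<le> \<epsilon> / 2" and k: "k \<in> I n"
    show "trunc_mean (F n k) \<le> \<epsilon>"
    proof -
      have "measure (F n k) {x. \<epsilon> / 2 < x} \<le> \<epsilon> / 2" using n k by blast
      moreover have "trunc_mean (F n k) \<le> \<epsilon> / 2 + measure (F n k) {x. \<epsilon> / 2 < x}"
        using assms by (intro F.trunc_mean_le) simp
      ultimately show ?thesis by linarith
    qed
  qed
qed

text \<open>It plays two roles: 1 plus it is the transform of the centred summand, and it is also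
  the exponent of the compound Poisson law with intensity 1 and that summand as jump.\<close>

definition centered_char :: "nat \<Rightarrow> nat \<Rightarrow> real \<Rightarrow> complex" where
  "centered_char n k t = (\<integral>x. iexp (t * (x - trunc_mean (F n k))) - 1 \<partial>F n k)"

lemma centered_char_eq: "1 + centered_char n k t = iexp (- (t * trunc_mean (F n k))) * char (F n k) t"
proof -
  have "integrable (F n k) (\<lambda>x. iexp (t * (x - trunc_mean (F n k))))"
    by (rule integrable_bounded_borel[where B = 1])
       (auto simp: F.finite_borel_measure_M simp del: of_real_mult of_real_diff)
  then have "centered_char n k t = (\<integral>x. iexp (t * (x - trunc_mean (F n k))) \<partial>F n k) - 1"
    unfolding centered_char_def
    by (subst Bochner_Integration.integral_diff) (auto simp: F.prob_space[simplified])
  also have "(\<integral>x. iexp (t * (x - trunc_mean (F n k))) \<partial>F n k) =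
      (\<integral>x. iexp (- (t * trunc_mean (F n k))) * iexp (t * x) \<partial>F n k)"
    by (intro Bochner_Integration.integral_cong) (auto simp: exp_add[symmetric] algebra_simps)
  finally show ?thesis by (simp add: char_def)
qed

text \<open>A product of factors \<open>1 + z\<close> is compared with the product of
  \<open>exp z\<close>. All factors have modulus at most 1, so the errors merely add up, each at
  most three times the square of its \<open>z\<close>; their sum is at most the largest
  \<open>sym_moment\<close> times a bounded sum.\<close>

lemma accompanying_char_tendsto:
  "(\<lambda>n. exp (\<i> * complex_of_real (((\<Sum>k\<in>I n. trunc_mean (F n k)) - A n) * t)
      + (\<Sum>k\<in>I n. centered_char n k t))) \<longlonglongrightarrow> char M t"
proof -
  define g where "g n = (\<Sum>k\<in>I n. trunc_mean (F n k)) - A n" for n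
  define B where "B = t\<^sup>2 + 8 * (2 + \<bar>t\<bar>)"
  have B: "0 < B" using zero_le_power2[of t] by (simp add: B_def add_nonneg_pos)
  have W_eq: "char (W n) t = iexp (g n * t) * (\<Prod>k\<in>I n. 1 + centered_char n k t)" for n
  proof -
    have "(\<Prod>k\<in>I n. 1 + centered_char n k t) =
        (\<Prod>k\<in>I n. iexp (- (t * trunc_mean (F n k)))) * (\<Prod>k\<in>I n. char (F n k) t)"
      unfolding centered_char_eq by (rule prod.distrib)
    also have "(\<Prod>k\<in>I n. iexp (- (t * trunc_mean (F n k)))) = iexp (- (t * (\<Sum>k\<in>I n. trunc_mean (F n k))))"
      by (simp add: exp_sum[OF I(1), symmetric] sum_distrib_left sum_negf)
    finally have "iexp (g n * t) * (\<Prod>k\<in>I n. 1 + centered_char n k t) =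
       (iexp (g n * t) * iexp (- (t * (\<Sum>k\<in>I n. trunc_mean (F n k))))) * (\<Prod>k\<in>I n. char (F n k) t)"
      by (simp add: mult.assoc)
    also have "iexp (g n * t) * iexp (- (t * (\<Sum>k\<in>I n. trunc_mean (F n k)))) = iexp (- (A n * t))"
      by (simp add: exp_add[symmetric] g_def algebra_simps)
    finally show ?thesis by (simp add: char_W)
  qed
  obtain C where C: "0 < C" "\<forall>\<^sub>F n in sequentially. (\<Sum>k\<in>I n. sym_moment (F n k)) \<le> C"
    using sum_sym_moment_bounded by blast
  have "(\<lambda>n. char (W n) t - exp (\<i> * complex_of_real (g n * t) + (\<Sum>k\<in>I n. centered_char n k t))) \<longlonglongrightarrow> 0"
  proof (rule LIMSEQ_I)
    fix r :: real assume r: "0 < r"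
    \<comment> \<open>The first entry gives every \<open>centered_char\<close> modulus at most 1, as
      the exponential estimate requires; the second brings the total error down to
      \<open>r / 2\<close>.\<close>
    define \<epsilon> where "\<epsilon> = min (1 / B) (r / (6 * B\<^sup>2 * C))"
    have \<epsilon>: "0 < \<epsilon>" using B C r by (simp add: \<epsilon>_def)
    have "\<forall>\<^sub>F n in sequentially. norm (char (W n) t - exp (\<i> * complex_of_real (g n * t) + (\<Sum>k\<in>I n. centered_char n k t)) - 0) < r"
      using C(2) sym_moment_eventually_small[OF \<epsilon>] half_eventually
    proof eventually_elim
      case (elim n)
      have \<beta>: "norm (centered_char n k t) \<le> B * sym_moment (F n k)" if "k \<in> I n" for k
        unfolding centered_char_def B_def
        using elim(3) that by (intro F.norm_centered_char_le nonneg) auto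
      have \<beta>1: "norm (centered_char n k t) \<le> 1" if "k \<in> I n" for k
      proof -
        have "B * sym_moment (F n k) \<le> B * (1 / B)"
          using elim(2) that B by (intro mult_left_mono) (auto simp: \<epsilon>_def)
        then show ?thesis using \<beta>[OF that] B by simp
      qed
      have \<beta>2: "(norm (centered_char n k t))\<^sup>2 \<le> B\<^sup>2 * \<epsilon> * sym_moment (F n k)" if "k \<in> I n" for k
      proof -
        have "(norm (centered_char n k t))\<^sup>2 \<le> (B * sym_moment (F n k))\<^sup>2"
          using \<beta>[OF that] by (intro power_mono) auto
        also have "\<dots> = B\<^sup>2 * sym_moment (F n k) * sym_moment (F n k)"
          by (simp add: power2_eq_square)
        also have "\<dots> \<le> B\<^sup>2 * \<epsilon> * sym_moment (F n k)"
          using elim(2) that F.sym_moment_nonneg[of n k] by (intro mult_right_mono mult_left_mono) auto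
        finally show ?thesis .
      qed
      have le1: "norm (1 + centered_char n k t) \<le> 1" for k
        unfolding centered_char_eq norm_mult norm_iexp using F.cmod_char_le_1[of n k t] by simp
      \<comment> \<open>The modulus of the exponential depends on the real part alone, and
        \<open>1 + centered_char\<close> has real part at most 1.\<close>
      have le2: "norm (exp (centered_char n k t)) \<le> 1" for k
      proof -
        have "Re (1 + centered_char n k t) \<le> 1" using complex_Re_le_cmod le1 order_trans by blast
        then show ?thesis by simp
      qed
      have "char (W n) t - exp (\<i> * complex_of_real (g n * t) + (\<Sum>k\<in>I n. centered_char n k t)) =
        iexp (g n * t) * ((\<Prod>k\<in>I n. 1 + centered_char n k t) - (\<Prod>k\<in>I n. exp (centered_char n k t)))"
        unfolding W_eq exp_add exp_sum[OF I(1)] by (simp only: right_diff_distrib)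
      also have "norm \<dots> = norm ((\<Prod>k\<in>I n. 1 + centered_char n k t) - (\<Prod>k\<in>I n. exp (centered_char n k t)))"
        by (simp only: norm_mult norm_iexp mult_1)
      also have "\<dots> \<le> (\<Sum>k\<in>I n. norm (1 + centered_char n k t - exp (centered_char n k t)))"
        using le1 le2 by (intro norm_prod_diff)
      also have "\<dots> \<le> (\<Sum>k\<in>I n. 3 * (B\<^sup>2 * \<epsilon> * sym_moment (F n k)))"
        using \<beta>1 \<beta>2 by (intro sum_mono order_trans[OF norm_exp_minus_1_minus_le]) auto
      also have "\<dots> = 3 * B\<^sup>2 * \<epsilon> * (\<Sum>k\<in>I n. sym_moment (F n k))"
        by (simp add: sum_distrib_left mult.assoc)
      also have "\<dots> \<le> 3 * B\<^sup>2 * (r / (6 * B\<^sup>2 * C)) * C"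
        using elim(1) B \<epsilon> r C by (intro mult_mono) (auto simp: \<epsilon>_def sum_nonneg F.sym_moment_nonneg)
      also have "\<dots> = r / 2" using B C by (simp add: field_simps)
      also have "\<dots> < r" using r by simp
      finally show ?case by simp
    qed
    then show "\<exists>no. \<forall>n\<ge>no. norm (char (W n) t - exp (\<i> * complex_of_real (g n * t) + (\<Sum>k\<in>I n. centered_char n k t)) - 0) < r"
      unfolding eventually_sequentially .
  qed
  moreover have "(\<lambda>n. char (W n) t) \<longlonglongrightarrow> char M t" using W M weak by (rule levy_continuity1)
  ultimately have "(\<lambda>n. char (W n) t - (char (W n) t - exp (\<i> * complex_of_real (g n * t) + (\<Sum>k\<in>I n. centered_char n k t)))) \<longlonglongrightarrow> char M t - 0"
    by (intro tendsto_diff)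
  then show ?thesis by (simp add: g_def)
qed

text \<open>The mixture of the centred summands in row \<open>n\<close>, with mass
  \<open>card (I n)\<close>, is the jump measure of the accompanying law, so \<open>lk_limit\<close>
  applies to the accompanying transforms in place of those of \<open>W\<close>.\<close>

theorem levy_khintchine:
  "\<exists>\<gamma> Q. finite_borel_measure Q \<and> emeasure Q {..<0} = 0 \<and>
    (\<forall>t. char M t = exp (\<i> * complex_of_real (\<gamma> * t) + (\<integral>x. lk_kernel t x \<partial>Q)))"
proof -
  define N where "N n k = distr (F n k) borel (\<lambda>x. x - trunc_mean (F n k))" for n k
  have N: "real_distribution (N n k)" for n k unfolding N_def by (rule F.real_distribution_distr) simp
  interpret N: real_distribution "N n k" for n k by (rule N)
  have N_int: "(\<integral>x. f x \<partial>N n k) = (\<integral>x. f (x - trunc_mean (F n k)) \<partial>F n k)"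
    if "f \<in> borel_measurable borel" for f :: "real \<Rightarrow> real" and n k
    unfolding N_def using that by (subst integral_distr) auto
  have N_cint: "(\<integral>x. f x \<partial>N n k) = (\<integral>x. f (x - trunc_mean (F n k)) \<partial>F n k)"
    if "f \<in> borel_measurable borel" for f :: "real \<Rightarrow> complex" and n k
    unfolding N_def using that by (subst integral_distr) auto
  have "\<exists>V. real_distribution V \<and> (\<forall>f B. f \<in> borel_measurable borel \<longrightarrow> (\<forall>x. \<bar>f x :: real\<bar> \<le> B) \<longrightarrow>
      real (card (I n)) * (\<integral>x. f x \<partial>V) = (\<Sum>k\<in>I n. \<integral>x. f x \<partial>N n k))" for n
    by (rule mixture_of_distributions[where N = "N n", OF I(1)[of n] I(2)[of n] N]) blast
  then obtain V where V: "\<And>n. real_distribution (V n)"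
    and V_int: "\<And>n f B. f \<in> borel_measurable borel \<Longrightarrow> (\<And>x. \<bar>f x :: real\<bar> \<le> B) \<Longrightarrow>
      real (card (I n)) * (\<integral>x. f x \<partial>V n) = (\<Sum>k\<in>I n. \<integral>x. f x \<partial>N n k)"
    by metis
  interpret V: real_distribution "V n" for n by (rule V)
  have V_meas: "real (card (I n)) * measure (V n) S = (\<Sum>k\<in>I n. measure (F n k) {x. x - trunc_mean (F n k) \<in> S})"
    if [measurable]: "S \<in> sets borel" for n S
  proof -
    have "real (card (I n)) * (\<integral>x. indicator S x \<partial>V n) = (\<Sum>k\<in>I n. \<integral>x. indicator S x \<partial>N n k)"
    proof (rule V_int)
      show "\<bar>indicator S x\<bar> \<le> (1 :: real)" for x by simp
    qed simp
    moreover have "measure (N n k) S = measure (F n k) {x. x - trunc_mean (F n k) \<in> S}" for k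
      unfolding N_def by (subst measure_distr) (auto simp: vimage_def)
    ultimately show ?thesis by simp
  qed
  show ?thesis
  proof (rule lk_limit[where V = V and m = "\<lambda>n. real (card (I n))" and \<gamma> = "\<lambda>n. (\<Sum>k\<in>I n. trunc_mean (F n k)) - A n"])
    show "real_distribution (V n)" for n by (rule V)
    obtain C where C: "0 < C" "\<forall>\<^sub>F n in sequentially. (\<Sum>k\<in>I n. sym_moment (F n k)) \<le> C"
      using sum_sym_moment_bounded by blast
    have "\<forall>\<^sub>F n in sequentially. norm (real (card (I n)) * (\<integral>x. lk_weight x \<partial>V n)) \<le> 9 * C"
      using C(2) half_eventually
    proof eventually_elim
      case (elim n)
      have "real (card (I n)) * (\<integral>x. lk_weight x \<partial>V n) = (\<Sum>k\<in>I n. \<integral>x. lk_weight x \<partial>N n k)"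
      proof (rule V_int)
        show "\<bar>lk_weight x\<bar> \<le> 1" for x by simp
      qed simp
      also have "\<dots> = (\<Sum>k\<in>I n. \<integral>x. lk_weight (x - trunc_mean (F n k)) \<partial>F n k)"
        by (simp add: N_int)
      also have "\<dots> \<le> (\<Sum>k\<in>I n. 9 * sym_moment (F n k))"
        using elim(2) nonneg by (intro sum_mono F.integral_lk_weight_centered_le) auto
      also have "\<dots> = 9 * (\<Sum>k\<in>I n. sym_moment (F n k))" by (simp add: sum_distrib_left)
      finally have "real (card (I n)) * (\<integral>x. lk_weight x \<partial>V n) \<le> 9 * C" using elim(1) by linarith
      moreover have "0 \<le> real (card (I n)) * (\<integral>x. lk_weight x \<partial>V n)" by simp
      ultimately show ?case by simp
    qed
    then show "Bseq (\<lambda>n. real (card (I n)) * (\<integral>x. lk_weight x \<partial>V n))" by (rule BfunI)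
    show "\<exists>R. \<forall>\<^sub>F n in sequentially. real (card (I n)) * measure (V n) {x. R < \<bar>x\<bar>} \<le> \<eta>" if \<eta>: "0 < \<eta>" for \<eta>
    proof -
      obtain \<delta> where \<delta>: "0 < \<delta>" "\<delta> \<le> 1"
        and ev: "\<forall>\<^sub>F n in sequentially. (\<Sum>k\<in>I n. \<integral>x. min 1 ((\<delta> * x)\<^sup>2) \<partial>sym_law (F n k)) \<le> 8 * (\<eta> / 16)"
        using sum_sym_truncated_le[of "\<eta> / 16"] \<eta> by auto
      have d1: "1 \<le> 1 / \<delta>" using \<delta> by simp
      \<comment> \<open>The added 1/2 is what desymmetrisation takes away, leaving the threshold
        \<open>1 / \<delta>\<close> for the symmetrised law.\<close>
      have "\<forall>\<^sub>F n in sequentially. real (card (I n)) * measure (V n) {x. 1 / \<delta> + 1 / 2 < \<bar>x\<bar>} \<le> \<eta>"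
        using ev half_eventually
      proof eventually_elim
        case (elim n)
        have "measure (F n k) {x. x - trunc_mean (F n k) \<in> {x. 1 / \<delta> + 1 / 2 < \<bar>x\<bar>}} \<le>
            2 * (\<integral>x. min 1 ((\<delta> * x)\<^sup>2) \<partial>sym_law (F n k))" if k: "k \<in> I n" for k
        proof -
          \<comment> \<open>Centring by a number between 0 and 1 cannot bring a nonnegative value
            below -1, and the threshold exceeds 1, so only the upper tail remains. There the
            centring only lowers the value.\<close>
          have "AE x in F n k. x \<in> {x. x - trunc_mean (F n k) \<in> {x. 1 / \<delta> + 1 / 2 < \<bar>x\<bar>}} \<longrightarrow> x \<in> {x. 1 / \<delta> + 1 / 2 < x}"
            using nonneg[OF k]
          proof (rule eventually_mono, safe)
            fix x assume x: "0 \<le> x" "1 / \<delta> + 1 / 2 < \<bar>x - trunc_mean (F n k)\<bar>"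
            then show "1 / \<delta> + 1 / 2 < x"
              using d1 F.trunc_mean_nonneg[of n k] F.trunc_mean_le_1[of n k] by linarith
          qed
          then have "measure (F n k) {x. x - trunc_mean (F n k) \<in> {x. 1 / \<delta> + 1 / 2 < \<bar>x\<bar>}} \<le> measure (F n k) {x. 1 / \<delta> + 1 / 2 < x}"
            by (rule F.finite_measure_mono_AE) simp
          also have "\<dots> \<le> 2 * measure (sym_law (F n k)) {x. 1 / \<delta> < \<bar>x\<bar>}"
            using F.measure_sym_law_tail_ge[of n k "1 / \<delta> + 1 / 2"] elim(2) k by simp
          also have "\<dots> \<le> 2 * (\<integral>x. min 1 ((\<delta> * x)\<^sup>2) \<partial>sym_law (F n k))"
            using measure_tail_le_truncated_moment[OF F.real_distribution_sym_law \<delta>(1), of n k] by simp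
          finally show ?thesis .
        qed
        then have "real (card (I n)) * measure (V n) {x. 1 / \<delta> + 1 / 2 < \<bar>x\<bar>} \<le>
            (\<Sum>k\<in>I n. 2 * (\<integral>x. min 1 ((\<delta> * x)\<^sup>2) \<partial>sym_law (F n k)))"
          by (subst V_meas) (auto intro!: sum_mono)
        also have "\<dots> = 2 * (\<Sum>k\<in>I n. \<integral>x. min 1 ((\<delta> * x)\<^sup>2) \<partial>sym_law (F n k))" by (simp add: sum_distrib_left)
        finally show ?case using elim(1) by simp
      qed
      then show ?thesis ..
    qed
    show "\<forall>\<^sub>F n in sequentially. measure (V n) {..<-\<tau>} = 0" if \<tau>: "0 < \<tau>" for \<tau>
      using trunc_mean_eventually_small[OF \<tau>]
    proof (rule eventually_mono)
      fix n assume n: "\<forall>k\<in>I n. trunc_mean (F n k) \<le> \<tau>"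
      have "measure (F n k) {x. x - trunc_mean (F n k) \<in> {..<-\<tau>}} = 0" if k: "k \<in> I n" for k
      proof -
        have "AE x in F n k. x \<in> {x. x - trunc_mean (F n k) \<in> {..<-\<tau>}} \<longrightarrow> x \<in> {}"
          using nonneg[OF k] by (rule eventually_mono) (use n k in fastforce)
        then have "measure (F n k) {x. x - trunc_mean (F n k) \<in> {..<-\<tau>}} \<le> measure (F n k) {}"
          by (rule F.finite_measure_mono_AE) simp
        then show ?thesis by (simp add: antisym)
      qed
      then have "real (card (I n)) * measure (V n) {..<-\<tau>} = 0" by (subst V_meas) auto
      then show "measure (V n) {..<-\<tau>} = 0" using I[of n] by (simp add: card_eq_0_iff)
    qed
    show "isCont (char M) 0" using real_distribution.isCont_char[OF M] .
    show "(\<lambda>n. exp (\<i> * complex_of_real (((\<Sum>k\<in>I n. trunc_mean (F n k)) - A n) * t) +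
        complex_of_real (real (card (I n))) * (\<integral>x. iexp (t * x) - 1 \<partial>V n))) \<longlonglongrightarrow> char M t" for t
    proof -
      have b: "\<bar>Re (iexp (t * x) - 1)\<bar> \<le> 2" "\<bar>Im (iexp (t * x) - 1)\<bar> \<le> 2" for x
        using abs_Re_le_cmod[of "iexp (t * x) - 1"] abs_Im_le_cmod[of "iexp (t * x) - 1"]
          norm_iexp_minus_1_le_2[of "t * x"] by linarith+
      have d: "(\<integral>x. iexp (t * x) - 1 \<partial>K) = Complex (\<integral>x. Re (iexp (t * x) - 1) \<partial>K) (\<integral>x. Im (iexp (t * x) - 1) \<partial>K)"
        if "real_distribution K" for K
        using real_distribution.finite_borel_measure_M[OF that]
        by (rule integral_complex_decompose[where B = 2]) (auto intro: norm_iexp_minus_1_le_2 simp del: of_real_mult)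
      have re: "real (card (I n)) * (\<integral>x. Re (iexp (t * x) - 1) \<partial>V n) = (\<Sum>k\<in>I n. \<integral>x. Re (iexp (t * x) - 1) \<partial>N n k)" for n
      proof (rule V_int)
        show "\<bar>Re (iexp (t * x) - 1)\<bar> \<le> 2" for x by (rule b)
      qed measurable
      have im: "real (card (I n)) * (\<integral>x. Im (iexp (t * x) - 1) \<partial>V n) = (\<Sum>k\<in>I n. \<integral>x. Im (iexp (t * x) - 1) \<partial>N n k)" for n
      proof (rule V_int)
        show "\<bar>Im (iexp (t * x) - 1)\<bar> \<le> 2" for x by (rule b)
      qed measurable
      have "complex_of_real (real (card (I n))) * (\<integral>x. iexp (t * x) - 1 \<partial>V n) = (\<Sum>k\<in>I n. \<integral>x. iexp (t * x) - 1 \<partial>N n k)" for n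
        unfolding d[OF V] d[OF N] using re[of n] im[of n]
        by (simp only: complex_eq_iff Re_sum Im_sum complex.sel times_complex.sel Re_complex_of_real Im_complex_of_real
          mult_zero_left diff_zero add_0_right simp_thms)
      moreover have "(\<integral>x. iexp (t * x) - 1 \<partial>N n k) = centered_char n k t" for n k
        unfolding centered_char_def by (subst N_cint) auto
      ultimately show ?thesis using accompanying_char_tendsto[of t] by simp
    qed
  qed simp
qed

end

section \<open>Normalised sums of independent summands\<close>

lemma real_distribution_convolution:
  assumes "real_distribution M" "real_distribution N"
  shows "real_distribution (M \<star> N)"
proof -
  interpret M: real_distribution M by fact
  interpret N: real_distribution N by fact
  interpret P: pair_prob_space M N by unfold_locales
  show ?thesis unfolding convolution_def by (rule P.real_distribution_distr) simp
qed

lemma char_convolution: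
  assumes "real_distribution M" "real_distribution N"
  shows "char (M \<star> N) t = char M t * char N t"
proof -
  interpret M: real_distribution M by fact
  interpret N: real_distribution N by fact
  interpret P: pair_prob_space M N by unfold_locales
  have "char (M \<star> N) t = (\<integral>z. iexp (t * fst z) * iexp (t * snd z) \<partial>(M \<Otimes>\<^sub>M N))"
    unfolding char_def convolution_def
    by (subst integral_distr) (auto intro!: Bochner_Integration.integral_cong simp: exp_add[symmetric] algebra_simps)
  also have "\<dots> = (\<integral>x. \<integral>y. iexp (t * x) * iexp (t * y) \<partial>N \<partial>M)"
  proof -
    have "integrable (M \<Otimes>\<^sub>M N) (\<lambda>z. iexp (t * fst z) * iexp (t * snd z))"
      by (rule P.integrable_const_bound[where B = 1]) (auto simp: norm_mult simp del: of_real_mult)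
    from P.integral_fst'[OF this] show ?thesis by simp
  qed
  also have "\<dots> = char M t * char N t" unfolding char_def by simp
  finally show ?thesis .
qed

lemma char_distr_affine:
  assumes "real_distribution M"
  shows "char (distr M borel (\<lambda>x. r * x + s)) t = iexp (s * t) * char M (r * t)"
proof -
  interpret M: real_distribution M by fact
  have "char (distr M borel (\<lambda>x. r * x + s)) t = (\<integral>x. iexp (s * t) * iexp (r * t * x) \<partial>M)"
    unfolding char_def
    by (subst integral_distr) (auto intro!: Bochner_Integration.integral_cong simp: exp_add[symmetric] algebra_simps)
  also have "\<dots> = iexp (s * t) * char M (r * t)" unfolding char_def by simp
  finally show ?thesis .
qed

lemma real_distribution_distr_affine:
  assumes "real_distribution M"
  shows "real_distribution (distr M borel (\<lambda>x. r * x + s))"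
proof -
  interpret M: real_distribution M by fact
  show ?thesis by (rule M.real_distribution_distr) simp
qed

lemma ex_distribution_prod_char:
  assumes "finite J" "\<And>j. real_distribution (N j)"
  shows "\<exists>R. real_distribution R \<and> (\<forall>t. char R t = (\<Prod>j\<in>J. char (N j) t))"
  using assms(1)
proof induction
  case empty
  have "real_distribution (return borel (0::real))"
    by (auto simp: real_distribution_def real_distribution_axioms_def intro: prob_space_return)
  moreover have "char (return borel 0) t = 1" for t
    unfolding char_def by (subst integral_return) auto
  ultimately show ?case by auto
next
  case (insert j J)
  then obtain R where R: "real_distribution R" "\<And>t. char R t = (\<Prod>j\<in>J. char (N j) t)" by blast
  show ?case
    by (rule exI[of _ "N j \<star> R"])
       (use insert R assms(2) in \<open>auto simp: char_convolution intro!: real_distribution_convolution\<close>)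
qed

text \<open>If the first summand is at most \<open>K\<close> in modulus, an event of probability at
  least 1/2, and the second exceeds \<open>2 * K\<close>, the sum exceeds \<open>K\<close>.
  Tightness of a convolution thus passes to one factor.\<close>

lemma convolution_tail_le:
  assumes A: "real_distribution A" and T: "real_distribution T"
    and half: "measure A {x. K < \<bar>x\<bar>} \<le> 1 / 2"
  shows "measure T {x. 2 * K < \<bar>x\<bar>} \<le> 2 * measure (A \<star> T) {x. K < \<bar>x\<bar>}"
proof -
  interpret A: real_distribution A by fact
  interpret T: real_distribution T by fact
  interpret P: pair_prob_space A T by unfold_locales
  have "measure A {x. \<bar>x\<bar> \<le> K} = 1 - measure A {x. K < \<bar>x\<bar>}"
  proof -
    have "{x. \<bar>x\<bar> \<le> K} = space A - {x. K < \<bar>x\<bar>}" by auto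
    then show ?thesis by (simp only:) (subst A.prob_compl, auto)
  qed
  then have "1 / 2 \<le> measure A {x. \<bar>x\<bar> \<le> K}" using half by simp
  then have "1 / 2 * measure T {x. 2 * K < \<bar>x\<bar>} \<le> measure A {x. \<bar>x\<bar> \<le> K} * measure T {x. 2 * K < \<bar>x\<bar>}"
    by (intro mult_right_mono) auto
  also have "\<dots> = measure (A \<Otimes>\<^sub>M T) ({x. \<bar>x\<bar> \<le> K} \<times> {x. 2 * K < \<bar>x\<bar>})"
    by (simp add: measure_def T.emeasure_pair_measure_Times enn2real_mult)
  also have "\<dots> \<le> measure (A \<Otimes>\<^sub>M T) ((\<lambda>(x, y). x + y) -` {x. K < \<bar>x\<bar>} \<inter> space (A \<Otimes>\<^sub>M T))"
  proof (rule P.finite_measure_mono)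
    show "(\<lambda>(x, y). x + y) -` {x. K < \<bar>x\<bar>} \<inter> space (A \<Otimes>\<^sub>M T) \<in> sets (A \<Otimes>\<^sub>M T)"
      by (rule measurable_sets[where A = borel]) auto
  qed (auto simp: space_pair_measure)
  also have "\<dots> = measure (A \<star> T) {x. K < \<bar>x\<bar>}"
    unfolding convolution_def by (subst measure_distr) auto
  finally show ?thesis by simp
qed

lemma cdf_convolution:
  assumes "real_distribution M" "real_distribution N"
  shows "cdf (M \<star> N) x = (\<integral>y. cdf N (x - y) \<partial>M)"
proof -
  interpret M: real_distribution M by fact
  interpret N: real_distribution N by fact
  interpret C: real_distribution "M \<star> N" by (rule real_distribution_convolution) fact+
  have [measurable]: "cdf N \<in> borel_measurable borel"
    by (intro borel_measurable_mono monoI N.cdf_nondecreasing)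
  have "emeasure (M \<star> N) {..x} = (\<integral>\<^sup>+y. emeasure N {a. a + y \<in> {..x}} \<partial>M)"
    by (rule convolution_emeasure) (auto intro: M.finite_measure_axioms N.finite_measure_axioms)
  also have "\<dots> = (\<integral>\<^sup>+y. ennreal (cdf N (x - y)) \<partial>M)"
  proof (intro nn_integral_cong)
    fix y
    have "{a. a + y \<in> {..x}} = {..x - y}" by auto
    then show "emeasure N {a. a + y \<in> {..x}} = ennreal (cdf N (x - y))"
      by (simp add: cdf_def N.emeasure_eq_measure)
  qed
  also have "\<dots> = ennreal (\<integral>y. cdf N (x - y) \<partial>M)"
    by (intro nn_integral_eq_integral integrable_bounded_borel[where B = 1])
       (auto simp: M.finite_borel_measure_M N.cdf_nonneg N.cdf_bounded_prob)
  finally have "ennreal (cdf (M \<star> N) x) = ennreal (\<integral>y. cdf N (x - y) \<partial>M)"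
    by (simp add: cdf_def C.emeasure_eq_measure)
  then show ?thesis
    by (subst (asm) ennreal_inj) (auto simp: C.cdf_nonneg N.cdf_nonneg)
qed

lemma distribution_function_interval_measure:
  assumes "distribution_function G"
  shows "real_distribution (interval_measure G)" "cdf (interval_measure G) = G"
  using assms unfolding distribution_function_def
  by (auto intro!: real_distribution_interval_measure cdf_interval_measure dest: monoD)

lemma distribution_function_cdf:
  assumes "real_distribution M" shows "distribution_function (cdf M)"
proof -
  interpret M: real_distribution M by fact
  show ?thesis unfolding distribution_function_def
    by (auto intro!: monoI M.cdf_nondecreasing M.cdf_is_right_cont M.cdf_lim_at_bot M.cdf_lim_at_top_prob)
qed

text \<open>The integrator \<open>G (\<alpha> * y)\<close> is the distribution function of the law
  divided by \<open>\<alpha>\<close>, whose transform is that of \<open>G\<close> at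
  \<open>t / \<alpha>\<close>. The factorisation of transforms is therefore the convolution identity
  in the definition.\<close>

lemma self_decomposableI_char:
  assumes G: "distribution_function G"
    and char: "\<And>\<alpha>. 1 < \<alpha> \<Longrightarrow> \<exists>H. real_distribution H \<and>
      (\<forall>t. char (interval_measure G) t = char (interval_measure G) (t / \<alpha>) * char H t)"
  shows "self_decomposable G"
  unfolding self_decomposable_def
proof (intro allI impI)
  fix \<alpha> :: real assume \<alpha>: "1 < \<alpha>"
  define M where "M = interval_measure G"
  have M: "real_distribution M" "cdf M = G"
    unfolding M_def using distribution_function_interval_measure[OF G] by auto
  interpret M: real_distribution M by (rule M)
  obtain H where H: "real_distribution H" "\<And>t. char M t = char M (t / \<alpha>) * char H t"
    using char[OF \<alpha>] unfolding M_def by blast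
  define S where "S = distr M borel (\<lambda>x. (1 / \<alpha>) * x + 0)"
  have S: "real_distribution S" unfolding S_def by (rule real_distribution_distr_affine[OF M(1)])
  have cdf_S: "cdf S = (\<lambda>y. G (\<alpha> * y))"
  proof
    fix y
    have "cdf S y = measure M ((\<lambda>x. (1 / \<alpha>) * x + 0) -` {..y} \<inter> space M)"
      unfolding cdf_def S_def by (subst measure_distr) auto
    also have "(\<lambda>x. (1 / \<alpha>) * x + 0) -` {..y} \<inter> space M = {..\<alpha> * y}"
      using \<alpha> by (auto simp: field_simps)
    finally show "cdf S y = G (\<alpha> * y)" using M(2) by (simp add: cdf_def fun_eq_iff)
  qed
  have "interval_measure (\<lambda>y. G (\<alpha> * y)) = S"
  proof (rule cdf_unique)
    have df: "distribution_function (\<lambda>y. G (\<alpha> * y))"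
      using distribution_function_cdf[OF S] cdf_S by simp
    show "real_distribution (interval_measure (\<lambda>y. G (\<alpha> * y)))" "cdf (interval_measure (\<lambda>y. G (\<alpha> * y))) = cdf S"
      using distribution_function_interval_measure[OF df] cdf_S by auto
  qed (rule S)
  moreover have "M = (S \<star> H)"
  proof (rule Levy_uniqueness[OF M(1) real_distribution_convolution[OF S H(1)]])
    show "char M = char (S \<star> H)"
    proof
      fix t
      have "char S t = char M (t / \<alpha>)"
        unfolding S_def by (subst char_distr_affine[OF M(1)]) simp
      then show "char M t = char (S \<star> H) t" by (subst char_convolution[OF S H(1)]) (simp only: H(2)[of t])
    qed
  qed
  then have "G x = (\<integral>y. cdf H (x - y) \<partial>S)" for x
    using cdf_convolution[OF S H(1), of x] M(2) by metis
  ultimately show "\<exists>F. distribution_function F \<and> (\<forall>x. G x = (\<integral>y. F (x - y) \<partial>interval_measure (\<lambda>y. G (\<alpha> * y))))"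
    using distribution_function_cdf[OF H(1)] by auto
qed

text \<open>The symmetrised law has transform 1, and the truncated moment bound with right-hand side
  0 shows that two independent copies coincide almost surely. Fubini then supplies a value that the
  law attains almost surely.\<close>

lemma norm_char_eq_1_imp_degenerate:
  assumes M: "real_distribution M" and one: "\<And>t. norm (char M t) = 1"
  obtains a where "AE x in M. x = a"
proof -
  interpret M: real_distribution M by fact
  interpret P: pair_prob_space M M by (rule M.pair_prob_space_self)
  have "(\<Sum>k\<in>{0::nat}. \<integral>x. min 1 ((1 * x)\<^sup>2) \<partial>sym_law M) \<le> 8 * 0"
    by (rule sum_truncated_moment_le) (auto simp: M.real_distribution_sym_law M.char_sym_law one)
  then have "sym_moment M \<le> 0" by (simp add: sym_moment_def)
  then have "sym_moment M = 0" using M.sym_moment_nonneg by (rule antisym)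
  then have "AE z in M \<Otimes>\<^sub>M M. min 1 ((fst z - snd z)\<^sup>2) = 0"
    unfolding M.sym_moment_eq
    by (subst (asm) integral_nonneg_eq_0_iff_AE) (auto intro!: P.integrable_const_bound[where B = 1])
  then have "AE z in M \<Otimes>\<^sub>M M. snd z = fst z"
    by (rule eventually_mono) (auto simp: min_def split: if_splits)
  then have AE: "AE x in M. AE y in M. y = x" using P.AE_pair[of "\<lambda>z. snd z = fst z"] by simp
  have "\<exists>x. AE y in M. y = x"
  proof (rule ccontr)
    assume "\<not> (\<exists>x. AE y in M. y = x)"
    then have "AE x in M. False" using AE by simp
    then show False by simp
  qed
  then show ?thesis using that by blast
qed

text \<open>Comparing two scalings of the same laws: a limiting ratio \<open>r\<^sub>0 < 1\<close> would give
  \<open>\<bar>f t\<bar> = \<bar>f (r\<^sub>0 t)\<bar> = \<bar>f (r\<^sub>0\<^sup>2 t)\<bar> = \<dots> = 1\<close>.\<close>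

lemma scaling_ratio_eventually_gt:
  assumes \<mu>: "\<And>n. real_distribution (\<mu> n)" and M: "real_distribution M" and weak: "weak_conv_m \<mu> M"
    and r: "\<And>n. 0 \<le> r n"
    and conv: "\<And>t. (\<lambda>n. norm (char (\<mu> n) (r n * t))) \<longlonglongrightarrow> norm (char M t)"
    and nondeg: "\<not> (\<exists>a. AE x in M. x = a)" and c: "c < 1"
  shows "\<forall>\<^sub>F n in sequentially. c < r n"
proof (rule ccontr)
  interpret M: real_distribution M by fact
  assume "\<not> (\<forall>\<^sub>F n in sequentially. c < r n)"
  then have "\<exists>\<^sub>F n in sequentially. r n \<le> c" by (simp add: frequently_def not_le)
  then have "\<forall>N. \<exists>n>N. r n \<le> c"
    unfolding frequently_sequentially by (meson Suc_le_lessD)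
  then obtain s where s: "strict_mono (s :: nat \<Rightarrow> nat)" "\<And>n. r (s n) \<le> c"
    using infinite_enumerate[of "{n. r n \<le> c}"] by (auto simp: infinite_nat_iff_unbounded)
  \<comment> \<open>Only along this subsequence is there an upper bound, namely \<open>c\<close>; it
    also keeps the limiting ratio below 1.\<close>
  have "Bseq (\<lambda>n. r (s n))"
    by (rule BseqI'[where K = "\<bar>c\<bar>"]) (auto simp: r intro!: order_trans[OF s(2) abs_ge_self])
  then obtain \<rho> r0 where \<rho>: "strict_mono (\<rho> :: nat \<Rightarrow> nat)" and r0: "(\<lambda>n. r (s (\<rho> n))) \<longlonglongrightarrow> r0"
    by (rule Bseq_obtain_convergent_subseq)
  define \<kappa> where "\<kappa> n = s (\<rho> n)" for n
  have \<kappa>: "strict_mono \<kappa>" using s(1) \<rho> by (simp add: \<kappa>_def strict_mono_def)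
  have r0': "0 \<le> r0" "r0 < 1"
  proof -
    show "0 \<le> r0" using r by (intro LIMSEQ_le_const[OF r0]) auto
    have "r0 \<le> c" using s(2) by (intro LIMSEQ_le_const2[OF r0]) auto
    then show "r0 < 1" using c by simp
  qed
  have scale: "norm (char M t) = norm (char M (r0 * t))" for t
  proof -
    have "weak_conv_m (\<lambda>n. \<mu> (\<kappa> n)) M"
      using weak filterlim_subseq[OF \<kappa>] by (rule weak_conv_m_compose)
    moreover have "(\<lambda>n. r (\<kappa> n) * t) \<longlonglongrightarrow> r0 * t"
      using r0 unfolding \<kappa>_def by (intro tendsto_intros)
    ultimately have "(\<lambda>n. char (\<mu> (\<kappa> n)) (r (\<kappa> n) * t)) \<longlonglongrightarrow> char M (r0 * t)"
      using \<mu> M by (intro weak_conv_char_moving)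
    then have "(\<lambda>n. norm (char (\<mu> (\<kappa> n)) (r (\<kappa> n) * t))) \<longlonglongrightarrow> norm (char M (r0 * t))" by (rule tendsto_norm)
    moreover have "(\<lambda>n. norm (char (\<mu> (\<kappa> n)) (r (\<kappa> n) * t))) \<longlonglongrightarrow> norm (char M t)"
      using LIMSEQ_subseq_LIMSEQ[OF conv[of t] \<kappa>] by (simp add: comp_def)
    ultimately show ?thesis by (rule LIMSEQ_unique[rotated])
  qed
  have pow: "norm (char M t) = norm (char M (r0 ^ k * t))" for k t
  proof (induction k)
    case (Suc k)
    then show ?case using scale[of "r0 ^ k * t"] by (simp add: mult.assoc)
  qed simp
  have "norm (char M t) = 1" for t
  proof -
    have "(\<lambda>k. r0 ^ k * t) \<longlonglongrightarrow> 0 * t"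
      using r0' by (intro tendsto_intros LIMSEQ_realpow_zero)
    then have "(\<lambda>k. norm (char M (r0 ^ k * t))) \<longlonglongrightarrow> norm (char M 0)"
      by (intro tendsto_norm isCont_tendsto_compose[OF M.isCont_char]) simp
    then show ?thesis using pow[of t] by (simp add: M.char_zero LIMSEQ_const_iff)
  qed
  then obtain a where "AE x in M. x = a" using norm_char_eq_1_imp_degenerate[OF M] by blast
  then show False using nondeg by blast
qed

section \<open>Partial sums of one sequence of nonnegative independent summands\<close>

locale normalized_sums =
  fixes u :: "nat \<Rightarrow> real measure" and a b :: "nat \<Rightarrow> real"
    and W :: "nat \<Rightarrow> real measure" and M :: "real measure"
  assumes u: "\<And>j. real_distribution (u j)"
    and u_nonneg: "\<And>j. 1 \<le> j \<Longrightarrow> AE x in u j. 0 \<le> x"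
    and b_pos: "\<And>d. 0 < b d" and b_inf: "filterlim b at_top sequentially"
    and negligible: "\<And>\<tau> \<epsilon>. 0 < \<tau> \<Longrightarrow> 0 < \<epsilon> \<Longrightarrow>
      \<forall>\<^sub>F d in sequentially. \<forall>j\<in>{1..d}. measure (u j) {x. \<tau> * b d < x} \<le> \<epsilon>"
    and W: "\<And>d. real_distribution (W d)"
    and char_W: "\<And>d t. char (W d) t = iexp (- (a d / b d * t)) * (\<Prod>j\<in>{1..d}. char (u j) (t / b d))"
    and M: "real_distribution M" and weak: "weak_conv_m W M"
begin

definition scaled :: "nat \<Rightarrow> nat \<Rightarrow> real measure" where
  "scaled d j = distr (u j) borel (\<lambda>x. (1 / b d) * x + 0)"

sublocale u: real_distribution "u j" for j by (rule u)
sublocale M: real_distribution M by (rule M)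

lemma real_distribution_scaled: "real_distribution (scaled d j)"
  unfolding scaled_def by (rule real_distribution_distr_affine[OF u])

lemma char_scaled: "char (scaled d j) t = char (u j) (t / b d)"
  unfolding scaled_def by (subst char_distr_affine[OF u]) simp

lemma scaled_nonneg: "AE x in scaled d j. 0 \<le> x" if j: "1 \<le> j"
proof -
  have "AE x in u j. 0 \<le> (1 / b d) * x + 0"
    using u_nonneg[OF j] by (rule eventually_mono) (use b_pos[of d] in simp)
  then show ?thesis unfolding scaled_def by (subst AE_distr_iff) auto
qed

lemma measure_scaled_gt: "measure (scaled d j) {x. \<tau> < x} = measure (u j) {x. \<tau> * b d < x}"
proof -
  have "measure (scaled d j) {x. \<tau> < x} = measure (u j) ((\<lambda>x. (1 / b d) * x + 0) -` {x. \<tau> < x} \<inter> space (u j))"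
    unfolding scaled_def by (subst measure_distr) auto
  also have "(\<lambda>x. (1 / b d) * x + 0) -` {x. \<tau> < x} \<inter> space (u j) = {x. \<tau> * b d < x}"
    using b_pos[of d] by (auto simp: field_simps)
  finally show ?thesis .
qed

lemma levy_khintchine:
  "\<exists>\<gamma> Q. finite_borel_measure Q \<and> emeasure Q {..<0} = 0 \<and>
    (\<forall>t. char M t = exp (\<i> * complex_of_real (\<gamma> * t) + (\<integral>x. lk_kernel t x \<partial>Q)))"
proof -
  \<comment> \<open>Rows start at \<open>Suc n\<close> because \<open>{1..0}\<close> is empty,
    whereas the array requires nonempty rows.\<close>
  interpret infinitesimal_array "\<lambda>n. scaled (Suc n)" "\<lambda>n. {1..Suc n}" "\<lambda>n. W (Suc n)" "\<lambda>n. a (Suc n) / b (Suc n)" M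
  proof (rule infinitesimal_array.intro)
    show "\<forall>\<^sub>F n in sequentially. \<forall>k\<in>{1..Suc n}. measure (scaled (Suc n) k) {x. \<tau> < x} \<le> \<epsilon>"
      if "0 < \<tau>" "0 < \<epsilon>" for \<tau> \<epsilon>
      unfolding measure_scaled_gt
      using negligible[OF that] by (subst eventually_sequentially_Suc)
    show "weak_conv_m (\<lambda>n. W (Suc n)) M"
      using weak filterlim_Suc by (rule weak_conv_m_compose)
    show "AE x in scaled (Suc n) k. 0 \<le> x" if "k \<in> {1..Suc n}" for n k
      using that by (intro scaled_nonneg) simp
    show "real_distribution (scaled (Suc n) k)" for n k by (rule real_distribution_scaled)
    show "real_distribution (W (Suc n))" for n by (rule W)
    show "char (W (Suc n)) t = iexp (- (a (Suc n) / b (Suc n) * t)) * (\<Prod>k\<in>{1..Suc n}. char (scaled (Suc n) k) t)" for n t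
      unfolding char_scaled by (rule char_W)
  qed (rule M | simp)+
  show ?thesis by (rule levy_khintchine)
qed

text \<open>Uniform negligibility of row \<open>Suc d\<close> is applied to its own last member;
  uniformity is essential, since that member changes with \<open>d\<close>.\<close>

lemma char_last_summand_tendsto: "(\<lambda>d. char (u (Suc d)) (t / b (Suc d))) \<longlonglongrightarrow> 1"
proof (rule LIMSEQ_I)
  fix e :: real assume e: "0 < e"
  define \<tau> where "\<tau> = e / (2 * (\<bar>t\<bar> + 1))"
  have \<tau>: "0 < \<tau>" "\<bar>t\<bar> * \<tau> \<le> e / 2" using e by (auto simp: \<tau>_def field_simps)
  have "\<forall>\<^sub>F d in sequentially. \<forall>j\<in>{1..Suc d}. measure (u j) {x. \<tau> * b (Suc d) < x} \<le> e / 8"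
    using negligible[OF \<tau>(1), of "e / 8"] e by (subst eventually_sequentially_Suc) simp
  then have "\<forall>\<^sub>F d in sequentially. norm (char (u (Suc d)) (t / b (Suc d)) - 1) < e"
  proof (rule eventually_mono)
    fix d assume "\<forall>j\<in>{1..Suc d}. measure (u j) {x. \<tau> * b (Suc d) < x} \<le> e / 8"
    then have d: "measure (scaled (Suc d) (Suc d)) {x. \<tau> < x} \<le> e / 8" by (simp add: measure_scaled_gt)
    interpret S: real_distribution "scaled (Suc d) (Suc d)" by (rule real_distribution_scaled)
    have "AE x in scaled (Suc d) (Suc d). x \<in> {x. \<tau> < \<bar>x\<bar>} \<longrightarrow> x \<in> {x. \<tau> < x}"
      by (rule eventually_mono[OF scaled_nonneg]) auto
    then have "measure (scaled (Suc d) (Suc d)) {x. \<tau> < \<bar>x\<bar>} \<le> measure (scaled (Suc d) (Suc d)) {x. \<tau> < x}"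
      by (rule S.finite_measure_mono_AE) simp
    moreover have "norm (char (scaled (Suc d) (Suc d)) t - char (scaled (Suc d) (Suc d)) 0)
        \<le> \<bar>t - 0\<bar> * \<tau> + 2 * measure (scaled (Suc d) (Suc d)) {x. \<tau> < \<bar>x\<bar>}"
      using \<tau> by (intro S.norm_char_diff_le) simp
    ultimately have "norm (char (scaled (Suc d) (Suc d)) t - 1) < e"
      using d \<tau> e by (simp add: S.char_zero)
    then show "norm (char (u (Suc d)) (t / b (Suc d)) - 1) < e" by (simp add: char_scaled)
  qed
  then show "\<exists>no. \<forall>n\<ge>no. norm (char (u (Suc n)) (t / b (Suc n)) - 1) < e"
    unfolding eventually_sequentially .
qed

text \<open>\<open>W' d\<close> is the law of the first \<open>d\<close> summands under the
  normalisation belonging to \<open>Suc d\<close>. It is an affine image of \<open>W d\<close>, and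
  its transform differs from that of \<open>W (Suc d)\<close> by a factor tending to 1. Both
  sequences thus converge to \<open>M\<close>, and the ratio of scales is bounded on both
  sides.\<close>

lemma b_ratio_tendsto_1:
  assumes nondeg: "\<not> (\<exists>a. AE x in M. x = a)"
  shows "(\<lambda>d. b (Suc d) / b d) \<longlonglongrightarrow> 1"
proof -
  define \<rho> where "\<rho> d = b d / b (Suc d)" for d
  have \<rho>: "0 < \<rho> d" for d using b_pos by (simp add: \<rho>_def)
  define W' where "W' d = distr (W d) borel (\<lambda>x. \<rho> d * x + (a d - a (Suc d)) / b (Suc d))" for d
  have W': "real_distribution (W' d)" for d unfolding W'_def by (rule real_distribution_distr_affine[OF W])
  have char_W': "char (W' d) t = iexp ((a d - a (Suc d)) / b (Suc d) * t) * char (W d) (\<rho> d * t)" for d t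
    unfolding W'_def by (rule char_distr_affine[OF W])
  have Suc: "char (W (Suc d)) t = char (W' d) t * char (u (Suc d)) (t / b (Suc d))" for d t
  proof -
    have e: "iexp ((a d - a (Suc d)) / b (Suc d) * t) * iexp (- (a d / b d * (\<rho> d * t))) = iexp (- (a (Suc d) / b (Suc d) * t))"
      using b_pos[of d] by (simp add: exp_add[symmetric] \<rho>_def diff_divide_distrib algebra_simps)
    have p: "char (u j) (\<rho> d * t / b d) = char (u j) (t / b (Suc d))" for j
      using b_pos[of d] by (simp add: \<rho>_def)
    have "char (W' d) t = iexp (- (a (Suc d) / b (Suc d) * t)) * (\<Prod>j\<in>{1..d}. char (u j) (t / b (Suc d)))"
      unfolding char_W' char_W[of d] p e[symmetric] by (simp only: mult.assoc)
    then show ?thesis unfolding char_W[of "Suc d"] by (simp add: prod.nat_ivl_Suc')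
  qed
  have lim: "(\<lambda>d. char (W d) t) \<longlonglongrightarrow> char M t" for t by (rule levy_continuity1[OF W M weak])
  have lim': "(\<lambda>d. char (W' d) t) \<longlonglongrightarrow> char M t" for t
  proof -
    have "(\<lambda>d. char (W (Suc d)) t / char (u (Suc d)) (t / b (Suc d))) \<longlonglongrightarrow> char M t / 1"
      by (intro tendsto_divide LIMSEQ_Suc[OF lim] char_last_summand_tendsto) simp
    moreover have "\<forall>\<^sub>F d in sequentially. char (W (Suc d)) t / char (u (Suc d)) (t / b (Suc d)) = char (W' d) t"
      using tendsto_imp_eventually_ne[OF char_last_summand_tendsto[of t], of 0]
      by (rule eventually_mono) (auto simp: Suc)
    ultimately show ?thesis by (simp add: tendsto_cong)
  qed
  have weak': "weak_conv_m W' M" by (rule levy_continuity[OF W' M lim'])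
  have gt1: "\<forall>\<^sub>F d in sequentially. c < \<rho> d" if "c < 1" for c
  proof (rule scaling_ratio_eventually_gt[OF W M weak _ _ nondeg that])
    show "0 \<le> \<rho> d" for d using \<rho>[of d] by simp
    have "norm (char (W' d) t) = norm (char (W d) (\<rho> d * t))" for d t
      unfolding char_W' norm_mult norm_iexp by simp
    then show "(\<lambda>d. norm (char (W d) (\<rho> d * t))) \<longlonglongrightarrow> norm (char M t)" for t
      using tendsto_norm[OF lim'[of t]] by simp
  qed
  \<comment> \<open>The comparison is repeated with the roles exchanged: rescaling by
    \<open>1 / \<rho> d\<close> leads from \<open>W' d\<close> back to \<open>W d\<close>, up to a
    phase.\<close>
  have gt2: "\<forall>\<^sub>F d in sequentially. c < 1 / \<rho> d" if "c < 1" for c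
  proof (rule scaling_ratio_eventually_gt[OF W' M weak' _ _ nondeg that])
    show "0 \<le> 1 / \<rho> d" for d using \<rho>[of d] by simp
    have "norm (char (W' d) (1 / \<rho> d * t)) = norm (char (W d) t)" for d t
      unfolding char_W' norm_mult norm_iexp using \<rho>[of d] by simp
    then show "(\<lambda>d. norm (char (W' d) (1 / \<rho> d * t))) \<longlonglongrightarrow> norm (char M t)" for t
      using tendsto_norm[OF lim[of t]] by simp
  qed
  have "(\<lambda>d. 1 / \<rho> d) \<longlonglongrightarrow> 1"
  proof (rule order_tendstoI)
    fix c :: real assume c: "1 < c"
    have "\<forall>\<^sub>F d in sequentially. 1 / c < \<rho> d" using c by (intro gt1) simp
    then show "\<forall>\<^sub>F d in sequentially. 1 / \<rho> d < c"
      by (rule eventually_mono) (use c \<rho> in \<open>simp add: field_simps\<close>)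
  qed (rule gt2)
  then show ?thesis by (simp add: \<rho>_def)
qed

text \<open>\<open>A n\<close> is the law of the first \<open>k n\<close> summands measured in the
  scale \<open>b n\<close>, hence close to \<open>M\<close> divided by \<open>\<alpha>\<close>, and
  \<open>T n\<close> the law of the rest. Their convolution is \<open>W n\<close>; tightness of
  \<open>T n\<close> gives a limit along a subsequence, which is the cofactor.\<close>

lemma char_factorization:
  assumes nondeg: "\<not> (\<exists>a. AE x in M. x = a)" and \<alpha>: "1 < \<alpha>"
  shows "\<exists>H. real_distribution H \<and> (\<forall>t. char M t = char M (t / \<alpha>) * char H t)"
proof -
  define c where "c = 1 / \<alpha>"
  have c: "0 < c" "c < 1" using \<alpha> by (auto simp: c_def)
  \<comment> \<open>The last index up to \<open>n\<close> whose scale is at most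
    \<open>c * b n\<close>. The scales need not be monotone, so a maximum over all such indices is
    taken; inserting 0 keeps the set nonempty.\<close>
  define k where "k n = Max (insert 0 {m. m \<le> n \<and> b m \<le> c * b n})" for n
  have k_le: "k n \<le> n" for n unfolding k_def by (subst Max_le_iff) auto
  have k_b: "b (k n) \<le> c * b n" if "b 0 \<le> c * b n" for n
  proof -
    have "k n \<in> insert 0 {m. m \<le> n \<and> b m \<le> c * b n}" unfolding k_def by (rule Max_in) auto
    then show ?thesis using that by auto
  qed
  \<comment> \<open>Since \<open>c < 1\<close>, the index \<open>n\<close> itself is not admissible,
    so \<open>Suc (k n)\<close> is at most \<open>n\<close> and fails the bound by
    maximality.\<close>
  have k_Suc: "c * b n < b (Suc (k n))" if "b 0 \<le> c * b n" for n
  proof -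
    have "k n \<noteq> n" using k_b[OF that] c b_pos[of n] by (auto simp: mult_le_cancel_right1)
    then have "Suc (k n) \<le> n" using k_le[of n] by simp
    moreover have "Suc (k n) \<notin> {m. m \<le> n \<and> b m \<le> c * b n}"
    proof
      assume "Suc (k n) \<in> {m. m \<le> n \<and> b m \<le> c * b n}"
      then have "Suc (k n) \<le> k n" unfolding k_def by (intro Max_ge) auto
      then show False by simp
    qed
    ultimately show ?thesis by auto
  qed
  have cb: "filterlim (\<lambda>n. c * b n) at_top sequentially"
    using b_inf c by (intro filterlim_tendsto_pos_mult_at_top[OF tendsto_const]) auto
  then have b0: "\<forall>\<^sub>F n in sequentially. b 0 \<le> c * b n"
    unfolding filterlim_at_top by blast
  have k_top: "filterlim k at_top sequentially"
    unfolding filterlim_at_top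
  proof
    fix N :: nat
    have "\<forall>\<^sub>F n in sequentially. Max (b ` {..N}) \<le> c * b n"
      using cb unfolding filterlim_at_top by blast
    then show "\<forall>\<^sub>F n in sequentially. N \<le> k n"
      using b0
    proof eventually_elim
      case (elim n)
      show ?case
      proof (rule ccontr)
        assume "\<not> N \<le> k n"
        then have "b (Suc (k n)) \<le> Max (b ` {..N})" by (intro Max_ge) auto
        then show False using k_Suc[OF elim(2)] elim(1) by simp
      qed
    qed
  qed
  define r where "r n = b (k n) / b n" for n
  have r_pos: "0 < r n" for n using b_pos by (simp add: r_def)
  \<comment> \<open>The next scale already exceeds \<open>c * b n\<close>, so \<open>r n\<close>
    lies between \<open>c\<close> divided by a ratio of consecutive scales and \<open>c\<close>
    itself.\<close>
  have r_lim: "r \<longlonglongrightarrow> c"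
  proof (rule tendsto_sandwich)
    have "(\<lambda>d. b (Suc d) / b d) \<longlonglongrightarrow> 1" by (rule b_ratio_tendsto_1[OF nondeg])
    then have "(\<lambda>n. b (Suc (k n)) / b (k n)) \<longlonglongrightarrow> 1" using k_top by (rule filterlim_compose)
    then have "(\<lambda>n. c / (b (Suc (k n)) / b (k n))) \<longlonglongrightarrow> c / 1" by (intro tendsto_divide tendsto_const) auto
    then show "(\<lambda>n. c / (b (Suc (k n)) / b (k n))) \<longlonglongrightarrow> c" by simp
    show "\<forall>\<^sub>F n in sequentially. c / (b (Suc (k n)) / b (k n)) \<le> r n"
      using b0
    proof (rule eventually_mono)
      fix n assume "b 0 \<le> c * b n"
      then have "c * b n \<le> b (Suc (k n))" using k_Suc by (simp add: less_imp_le)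
      then have "b (k n) * (c * b n) \<le> b (k n) * b (Suc (k n))" using b_pos[of "k n"] by (intro mult_left_mono) auto
      then show "c / (b (Suc (k n)) / b (k n)) \<le> r n"
        using b_pos[of n] b_pos[of "k n"] b_pos[of "Suc (k n)"] by (simp add: r_def field_simps)
    qed
    show "\<forall>\<^sub>F n in sequentially. r n \<le> c"
      using b0 by (rule eventually_mono) (use k_b b_pos in \<open>simp add: r_def field_simps\<close>)
  qed simp
  define A where "A n = distr (W (k n)) borel (\<lambda>x. r n * x + 0)" for n
  have A: "real_distribution (A n)" for n unfolding A_def by (rule real_distribution_distr_affine[OF W])
  have char_A: "char (A n) t = char (W (k n)) (r n * t)" for n t
    unfolding A_def by (subst char_distr_affine[OF W]) simp
  have "\<exists>R. real_distribution R \<and> (\<forall>t. char R t = (\<Prod>j\<in>{Suc (k n)..n}. char (scaled n j) t))" for n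
    by (rule ex_distribution_prod_char) (auto simp: real_distribution_scaled)
  then obtain R where R: "\<And>n. real_distribution (R n)" "\<And>n t. char (R n) t = (\<Prod>j\<in>{Suc (k n)..n}. char (scaled n j) t)"
    by metis
  define T where "T n = distr (R n) borel (\<lambda>x. 1 * x + (a (k n) - a n) / b n)" for n
  have T: "real_distribution (T n)" for n unfolding T_def by (rule real_distribution_distr_affine[OF R(1)])
  have char_T: "char (T n) t = iexp ((a (k n) - a n) / b n * t) * (\<Prod>j\<in>{Suc (k n)..n}. char (u j) (t / b n))" for n t
    unfolding T_def char_distr_affine[OF R(1)] R(2) char_scaled by simp
  have char_AT: "char (A n) t * char (T n) t = char (W n) t" for n t
  proof -
    have e: "iexp (- (a (k n) / b (k n) * (r n * t))) * iexp ((a (k n) - a n) / b n * t) = iexp (- (a n / b n * t))"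
      using b_pos[of "k n"] by (simp add: exp_add[symmetric] r_def diff_divide_distrib algebra_simps)
    have p: "char (u j) (r n * t / b (k n)) = char (u j) (t / b n)" for j
      using b_pos[of "k n"] by (simp add: r_def)
    have "{1..n} = {1..k n} \<union> {Suc (k n)..n}" using k_le[of n] by auto
    then have split: "(\<Prod>j\<in>{1..n}. char (u j) (t / b n)) =
        (\<Prod>j\<in>{1..k n}. char (u j) (t / b n)) * (\<Prod>j\<in>{Suc (k n)..n}. char (u j) (t / b n))"
      by (simp only:) (rule prod.union_disjoint, auto)
    show ?thesis
      unfolding char_A char_T char_W p split e[symmetric] by (simp only: mult_ac)
  qed
  have W_AT: "W n = (A n \<star> T n)" for n
  proof (rule Levy_uniqueness[OF W real_distribution_convolution[OF A T]])
    show "char (W n) = char (A n \<star> T n)"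
      by (rule ext) (simp only: char_convolution[OF A T] char_AT)
  qed
  have k_ev: "\<forall>\<^sub>F n in sequentially. P (k n)" if "\<forall>\<^sub>F n in sequentially. P n" for P
    using that k_top by (simp add: filterlim_iff)
  have A_tail: "\<forall>\<^sub>F n in sequentially. measure (A n) {x. K < \<bar>x\<bar>} \<le> \<epsilon>"
    if K: "0 < K" "\<forall>\<^sub>F n in sequentially. measure (W n) {x. K < \<bar>x\<bar>} \<le> \<epsilon>" for K \<epsilon>
  proof -
    \<comment> \<open>Once the scaling contracts, the tail of \<open>A n\<close> is bounded by that
      of \<open>W (k n)\<close>.\<close>
    have "\<forall>\<^sub>F n in sequentially. r n < 1" using r_lim c by (intro order_tendstoD) auto
    then show ?thesis using k_ev[OF K(2)]
    proof eventually_elim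
      case (elim n)
      interpret Wk: real_distribution "W (k n)" by (rule W)
      have "measure (A n) {x. K < \<bar>x\<bar>} = measure (W (k n)) ((\<lambda>x. r n * x + 0) -` {x. K < \<bar>x\<bar>} \<inter> space (W (k n)))"
        unfolding A_def by (subst measure_distr) auto
      also have "\<dots> \<le> measure (W (k n)) {x. K < \<bar>x\<bar>}"
      proof (rule Wk.finite_measure_mono)
        show "(\<lambda>x. r n * x + 0) -` {x. K < \<bar>x\<bar>} \<inter> space (W (k n)) \<subseteq> {x. K < \<bar>x\<bar>}"
        proof safe
          fix x assume "K < \<bar>r n * x + 0\<bar>"
          moreover have "\<bar>r n * x + 0\<bar> \<le> \<bar>x\<bar>"
            using elim(1) r_pos[of n] mult_right_mono[of "r n" 1 "\<bar>x\<bar>"] by (simp add: abs_mult)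
          ultimately show "K < \<bar>x\<bar>" by simp
        qed
      qed simp
      finally show ?case using elim(2) by simp
    qed
  qed
  have "tight T"
  proof (rule tightI_eventually[OF T])
    fix \<epsilon> :: real assume \<epsilon>: "0 < \<epsilon>"
    obtain K where K: "0 < K" "\<forall>\<^sub>F n in sequentially. measure (W n) {x. K < \<bar>x\<bar>} \<le> min (1 / 2) (\<epsilon> / 2)"
      using weak_conv_tail_eventually[OF W M weak, of "min (1 / 2) (\<epsilon> / 2)"] \<epsilon> by auto
    have "\<forall>\<^sub>F n in sequentially. measure (T n) {x. 2 * K < \<bar>x\<bar>} \<le> \<epsilon>"
      using A_tail[OF K] K(2)
    proof eventually_elim
      case (elim n)
      have "measure (T n) {x. 2 * K < \<bar>x\<bar>} \<le> 2 * measure (A n \<star> T n) {x. K < \<bar>x\<bar>}"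
        using elim(1) by (intro convolution_tail_le[OF A T]) simp
      then show ?case using elim(2) W_AT[of n] by simp
    qed
    then show "\<exists>K. \<forall>\<^sub>F n in sequentially. measure (T n) {x. K < \<bar>x\<bar>} \<le> \<epsilon>" ..
  qed
  from tight_imp_convergent_subsubsequence[OF this strict_mono_id]
  obtain \<rho> H where \<rho>: "strict_mono \<rho>" and H: "real_distribution H" and weakT: "weak_conv_m (T \<circ> id \<circ> \<rho>) H"
    by blast
  have T_lim: "(\<lambda>n. char (T (\<rho> n)) t) \<longlonglongrightarrow> char H t" for t
    using levy_continuity1[OF _ H weakT, of t] T by simp
  have A_lim: "(\<lambda>n. char (A n) t) \<longlonglongrightarrow> char M (c * t)" for t
    unfolding char_A using W M weak_conv_m_compose[OF weak k_top] tendsto_mult_right[OF r_lim]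
    by (rule weak_conv_char_moving)
  have "char M t = char M (t / \<alpha>) * char H t" for t
  proof -
    have "(\<lambda>n. char (A (\<rho> n)) t * char (T (\<rho> n)) t) \<longlonglongrightarrow> char M (c * t) * char H t"
      using LIMSEQ_subseq_LIMSEQ[OF A_lim[of t] \<rho>] by (intro tendsto_mult T_lim) (simp add: comp_def)
    moreover have "(\<lambda>n. char (W (\<rho> n)) t) \<longlonglongrightarrow> char M t"
      using LIMSEQ_subseq_LIMSEQ[OF levy_continuity1[OF W M weak, of t] \<rho>] by (simp add: comp_def)
    ultimately show ?thesis unfolding char_AT by (simp add: LIMSEQ_unique c_def)
  qed
  then show ?thesis using H by blast
qed

end

section \<open>Tensor product complexity\<close>

lemma antimono_obtain_isCont:
  fixes q :: "real \<Rightarrow> real"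
  assumes "\<And>x y. 0 < x \<Longrightarrow> x \<le> y \<Longrightarrow> y < 1 \<Longrightarrow> q y \<le> q x" "0 \<le> l" "l < r" "r \<le> 1"
  obtains \<epsilon> where "l < \<epsilon>" "\<epsilon> < r" "isCont q \<epsilon>"
proof -
  have "mono_on {0<..<1} (\<lambda>x. - q x)" using assms(1) by (auto simp: mono_on_def)
  then obtain \<epsilon> where \<epsilon>: "l < \<epsilon>" "\<epsilon> < r" "isCont (\<lambda>x. - q x) \<epsilon>"
    by (rule mono_on_obtain_isCont[of _ _ l r]) (use assms in auto)
  then have "isCont q \<epsilon>" using continuous_minus[of "at \<epsilon>" "\<lambda>x. - q x"] by simp
  then show ?thesis using that \<epsilon> by blast
qed

text \<open>The asymptotics are known only at continuity points of \<open>q\<close>. As these are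
  dense, the levels \<open>1 - \<epsilon>\<^sup>2\<close> they produce still meet every gap between
  two values in the unit interval.\<close>

lemma obtain_isCont_one_minus_square:
  fixes q :: "real \<Rightarrow> real"
  assumes q: "\<And>x y. 0 < x \<Longrightarrow> x \<le> y \<Longrightarrow> y < 1 \<Longrightarrow> q y \<le> q x" and lo: "0 \<le> lo" "lo < hi" "hi \<le> 1"
  obtains \<epsilon> where "0 < \<epsilon>" "\<epsilon> < 1" "isCont q \<epsilon>" "lo < 1 - \<epsilon>\<^sup>2" "1 - \<epsilon>\<^sup>2 < hi"
proof -
  obtain \<epsilon> where \<epsilon>: "sqrt (1 - hi) < \<epsilon>" "\<epsilon> < sqrt (1 - lo)" "isCont q \<epsilon>"
    using q by (rule antimono_obtain_isCont[of q "sqrt (1 - hi)" "sqrt (1 - lo)"]) (use lo in auto)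
  have pos: "0 < \<epsilon>" using \<epsilon>(1) lo real_sqrt_ge_zero[of "1 - hi"] by linarith
  have "(sqrt (1 - hi))\<^sup>2 < \<epsilon>\<^sup>2" using \<epsilon> lo by (intro power_strict_mono) auto
  moreover have "\<epsilon>\<^sup>2 < (sqrt (1 - lo))\<^sup>2" using \<epsilon> pos by (intro power_strict_mono) auto
  ultimately have "1 - hi < \<epsilon>\<^sup>2" "\<epsilon>\<^sup>2 < 1 - lo" using lo by auto
  moreover have "\<epsilon> < 1"
  proof (rule ccontr)
    assume "\<not> \<epsilon> < 1"
    then have "1 \<le> \<epsilon>\<^sup>2" by (intro one_le_power) simp
    then show False using \<open>\<epsilon>\<^sup>2 < 1 - lo\<close> lo by linarith
  qed
  ultimately show ?thesis using that[of \<epsilon>] pos \<epsilon>(3) by simp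
qed

locale tensor_product =
  fixes lam :: "nat \<Rightarrow> nat \<Rightarrow> real"
  assumes eig: "\<And>j. 1 \<le> j \<Longrightarrow> eigen_seq (lam j)"
begin

lemma lam_nonneg: "1 \<le> j \<Longrightarrow> 0 \<le> lam j k"
  and lam_summable: "1 \<le> j \<Longrightarrow> summable (lam j)"
  using eig[of j] by (auto simp: eigen_seq_def)

lemma trace_pos: assumes "1 \<le> j" shows "0 < trace_of (lam j)"
proof -
  have "0 < lam j 0" using eig[OF assms] by (simp add: eigen_seq_def)
  then show ?thesis
    unfolding trace_of_def using lam_nonneg[OF assms] lam_summable[OF assms] by (intro suminf_pos2)
qed

lemma normalized_nonneg: "1 \<le> j \<Longrightarrow> 0 \<le> normalized_eig lam j k"
  using lam_nonneg[of j k] trace_pos[of j] by (simp add: normalized_eig_def)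

lemma normalized_sums: assumes "1 \<le> j" shows "normalized_eig lam j sums 1"
proof -
  have "(\<lambda>k. lam j k / trace_of (lam j)) sums (trace_of (lam j) / trace_of (lam j))"
    unfolding trace_of_def using lam_summable[OF assms] by (intro sums_divide summable_sums)
  then show ?thesis using trace_pos[OF assms] by (simp add: normalized_eig_def[abs_def])
qed

text \<open>The index \<open>0\<close> does not occur; the law chosen there is irrelevant.\<close>

definition index_pmf :: "nat \<Rightarrow> nat pmf" where
  "index_pmf j = (if 1 \<le> j then embed_pmf (normalized_eig lam j) else return_pmf 0)"

lemma pmf_index_pmf: assumes "1 \<le> j" shows "pmf (index_pmf j) k = normalized_eig lam j k"
proof -
  have "(\<integral>\<^sup>+k. ennreal (normalized_eig lam j k) \<partial>count_space UNIV) = (\<Sum>k. ennreal (normalized_eig lam j k))"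
    by (rule nn_integral_count_space_nat)
  also have "\<dots> = ennreal (\<Sum>k. normalized_eig lam j k)"
    using normalized_sums[OF assms] normalized_nonneg[OF assms] by (intro suminf_ennreal2) (auto simp: sums_iff)
  also have "\<dots> = 1" using normalized_sums[OF assms] by (simp add: sums_iff)
  finally show ?thesis
    using assms normalized_nonneg[OF assms] by (simp add: index_pmf_def pmf_embed_pmf)
qed

text \<open>The self-information of an index. A zero eigenvalue gets the value 0, because
  \<open>ln 0 = 0\<close>; such indices have probability 0.\<close>

definition info :: "nat \<Rightarrow> nat \<Rightarrow> real" where
  "info j k = - ln (normalized_eig lam j k)"

lemma info_nonneg: assumes "1 \<le> j" shows "0 \<le> info j k"
proof -
  have "normalized_eig lam j k \<le> 1" using pmf_le_1[of "index_pmf j" k] by (simp add: pmf_index_pmf[OF assms])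
  then show ?thesis using normalized_nonneg[OF assms, of k]
    by (cases "normalized_eig lam j k = 0") (auto simp: info_def)
qed

definition info_law :: "nat \<Rightarrow> real measure" where
  "info_law j = distr (measure_pmf (index_pmf j)) borel (info j)"

lemma real_distribution_info_law: "real_distribution (info_law j)"
  unfolding info_law_def by (rule prob_space.real_distribution_distr[OF measure_pmf.prob_space_axioms]) simp

lemma info_law_nonneg: "1 \<le> j \<Longrightarrow> AE x in info_law j. 0 \<le> x"
  unfolding info_law_def by (subst AE_distr_iff) (simp_all add: info_nonneg)

text \<open>With \<open>z\<close> equal to \<open>\<tau> * b d\<close> the right-hand side is the
  sum in the negligibility condition, which thereby becomes a tail bound for the summands.\<close>

lemma measure_info_law_gt:
  assumes j: "1 \<le> j" and z: "0 \<le> z"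
  shows "measure (info_law j) {x. z < x} =
    (\<Sum>k. normalized_eig lam j k * indicator {x. x < exp (- z)} (normalized_eig lam j k))"
proof -
  have "measure (info_law j) {x. z < x} = measure (measure_pmf (index_pmf j)) {k. z < info j k}"
    unfolding info_law_def by (subst measure_distr) (auto simp: vimage_def)
  also have "\<dots> = (\<integral>k. indicator {k. z < info j k} k \<partial>measure_pmf (index_pmf j))" by simp
  also have "\<dots> = (\<integral>k. pmf (index_pmf j) k * indicator {k. z < info j k} k \<partial>count_space UNIV)"
    unfolding measure_pmf_eq_density by (subst integral_density) auto
  also have "\<dots> = (\<integral>k. normalized_eig lam j k * indicator {x. x < exp (- z)} (normalized_eig lam j k) \<partial>count_space UNIV)"
  proof (rule Bochner_Integration.integral_cong[OF refl])
    fix k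
    show "pmf (index_pmf j) k * indicator {k. z < info j k} k =
        normalized_eig lam j k * indicator {x. x < exp (- z)} (normalized_eig lam j k)"
    proof (cases "normalized_eig lam j k = 0")
      case False
      then have pos: "0 < normalized_eig lam j k" using normalized_nonneg[OF j, of k] by simp
      then have "z < info j k \<longleftrightarrow> normalized_eig lam j k < exp (- z)"
        using ln_less_cancel_iff[OF pos, of "exp (- z)"] by (auto simp: info_def)
      then show ?thesis by (simp add: pmf_index_pmf[OF j] indicator_def)
    qed (simp add: pmf_index_pmf[OF j])
  qed
  also have "\<dots> = (\<Sum>k. normalized_eig lam j k * indicator {x. x < exp (- z)} (normalized_eig lam j k))"
  proof (rule integral_count_space_nat)
    have s: "summable (\<lambda>k. norm (normalized_eig lam j k * indicator {x. x < exp (- z)} (normalized_eig lam j k)))"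
    proof (rule summable_comparison_test'[where N = 0])
      show "summable (normalized_eig lam j)" using normalized_sums[OF j] by (rule sums_summable)
      show "norm (norm (normalized_eig lam j k * indicator {x. x < exp (- z)} (normalized_eig lam j k))) \<le> normalized_eig lam j k" for k
        using normalized_nonneg[OF j, of k] by (simp add: indicator_def)
    qed
    then show "integrable (count_space UNIV) (\<lambda>k. normalized_eig lam j k * indicator {x. x < exp (- z)} (normalized_eig lam j k))"
      by (simp add: integrable_count_space_nat_iff)
  qed
  finally show ?thesis .
qed

text \<open>The default \<open>undefined\<close> makes the support consist of extensional functions,
  as in \<open>multi_idx\<close>.\<close>

definition multi_pmf :: "nat \<Rightarrow> (nat \<Rightarrow> nat) pmf" where
  "multi_pmf d = Pi_pmf {1..d} undefined index_pmf"

definition total_info :: "nat \<Rightarrow> (nat \<Rightarrow> nat) \<Rightarrow> real" where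
  "total_info d kk = (\<Sum>j\<in>{1..d}. info j (kk j))"

lemma tensor_trace_pos: "0 < tensor_trace lam d"
  unfolding tensor_trace_def by (rule prod_pos) (auto intro: trace_pos)

lemma pmf_multi_pmf:
  assumes "kk \<in> multi_idx d"
  shows "pmf (multi_pmf d) kk = tensor_eig lam d kk / tensor_trace lam d"
proof -
  have "pmf (multi_pmf d) kk = (\<Prod>j\<in>{1..d}. pmf (index_pmf j) (kk j))"
    unfolding multi_pmf_def using assms by (intro pmf_Pi') (auto simp: multi_idx_def PiE_def extensional_def)
  also have "\<dots> = (\<Prod>j\<in>{1..d}. lam j (kk j) / trace_of (lam j))"
    by (intro prod.cong) (auto simp: pmf_index_pmf normalized_eig_def)
  also have "\<dots> = tensor_eig lam d kk / tensor_trace lam d"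
    unfolding tensor_eig_def tensor_trace_def by (rule prod_dividef)
  finally show ?thesis .
qed

lemma set_multi_pmf: "set_pmf (multi_pmf d) \<subseteq> multi_idx d"
proof
  fix kk assume "kk \<in> set_pmf (multi_pmf d)"
  then have "kk \<in> {f. \<forall>x. x \<notin> {1..d} \<longrightarrow> f x = undefined}"
    unfolding multi_pmf_def using set_Pi_pmf_subset[of "{1..d}" undefined index_pmf] by blast
  then show "kk \<in> multi_idx d" by (auto simp: multi_idx_def PiE_def extensional_def)
qed

text \<open>Off the support some factor may vanish, and there the convention \<open>ln 0 = 0\<close>
  breaks the identity; on the support all factors are positive.\<close>

lemma pmf_multi_pmf_eq_exp:
  assumes "kk \<in> set_pmf (multi_pmf d)"
  shows "pmf (multi_pmf d) kk = exp (- total_info d kk)"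
proof -
  have kk: "kk \<in> multi_idx d" using assms set_multi_pmf by blast
  then have eq: "pmf (multi_pmf d) kk = (\<Prod>j\<in>{1..d}. normalized_eig lam j (kk j))"
    unfolding multi_pmf_def
    by (subst pmf_Pi') (auto simp: multi_idx_def PiE_def extensional_def pmf_index_pmf intro!: prod.cong)
  have "0 < pmf (multi_pmf d) kk" using assms by (rule pmf_positive)
  then have "(\<Prod>j\<in>{1..d}. normalized_eig lam j (kk j)) \<noteq> 0" using eq by linarith
  then have "normalized_eig lam j (kk j) \<noteq> 0" if "j \<in> {1..d}" for j
    using that by (subst (asm) prod_zero_iff) auto
  then have pos: "0 < normalized_eig lam j (kk j)" if "j \<in> {1..d}" for j
    using that normalized_nonneg[of j "kk j"] by (simp add: less_le)
  have "exp (- total_info d kk) = (\<Prod>j\<in>{1..d}. exp (ln (normalized_eig lam j (kk j))))"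
    unfolding total_info_def info_def by (simp add: exp_sum[symmetric] sum_negf)
  also have "\<dots> = (\<Prod>j\<in>{1..d}. normalized_eig lam j (kk j))"
    by (intro prod.cong) (auto simp: pos)
  finally show ?thesis using eq by simp
qed

lemma sum_tensor_eig:
  assumes "finite A" "A \<subseteq> multi_idx d"
  shows "(\<Sum>kk\<in>A. tensor_eig lam d kk) = tensor_trace lam d * measure (measure_pmf (multi_pmf d)) A"
proof -
  have "measure (measure_pmf (multi_pmf d)) A = (\<Sum>kk\<in>A. pmf (multi_pmf d) kk)"
    using assms(1) by (rule measure_measure_pmf_finite)
  also have "\<dots> = (\<Sum>kk\<in>A. tensor_eig lam d kk / tensor_trace lam d)"
    using assms(2) by (intro sum.cong) (auto simp: pmf_multi_pmf)
  also have "\<dots> = (\<Sum>kk\<in>A. tensor_eig lam d kk) / tensor_trace lam d" by (rule sum_divide_distrib[symmetric])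
  finally show ?thesis using tensor_trace_pos[of d] by simp
qed

section \<open>Sums of the largest eigenvalues and the counting of atoms\<close>

lemma top_sum_ge:
  assumes "finite A" "A \<subseteq> multi_idx d" "card A \<le> n"
  shows "tensor_trace lam d * measure (measure_pmf (multi_pmf d)) A \<le> top_sum lam d n"
  unfolding top_sum_def
proof (rule cSup_upper)
  show "tensor_trace lam d * measure (measure_pmf (multi_pmf d)) A \<in>
      {\<Sum>kk\<in>F. tensor_eig lam d kk | F. F \<subseteq> multi_idx d \<and> finite F \<and> card F \<le> n}"
    using assms sum_tensor_eig[OF assms(1,2)] by (intro CollectI exI[of _ A]) auto
  show "bdd_above {\<Sum>kk\<in>F. tensor_eig lam d kk | F. F \<subseteq> multi_idx d \<and> finite F \<and> card F \<le> n}"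
  proof (rule bdd_aboveI[of _ "tensor_trace lam d"], safe)
    fix F assume "F \<subseteq> multi_idx d" "finite F"
    then have "(\<Sum>kk\<in>F. tensor_eig lam d kk) = tensor_trace lam d * measure (measure_pmf (multi_pmf d)) F"
      by (intro sum_tensor_eig)
    also have "\<dots> \<le> tensor_trace lam d * 1"
      using tensor_trace_pos[of d] by (intro mult_left_mono) auto
    finally show "(\<Sum>kk\<in>F. tensor_eig lam d kk) \<le> tensor_trace lam d" by simp
  qed
qed

lemma top_sum_le:
  assumes "\<And>A. A \<subseteq> multi_idx d \<Longrightarrow> finite A \<Longrightarrow> card A \<le> n \<Longrightarrow> measure (measure_pmf (multi_pmf d)) A \<le> c"
  shows "top_sum lam d n \<le> tensor_trace lam d * c"
  unfolding top_sum_def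
proof (rule cSup_least)
  show "{\<Sum>kk\<in>F. tensor_eig lam d kk | F. F \<subseteq> multi_idx d \<and> finite F \<and> card F \<le> n} \<noteq> {}"
    by (auto intro!: exI[of _ "{}"])
  fix s assume "s \<in> {\<Sum>kk\<in>F. tensor_eig lam d kk | F. F \<subseteq> multi_idx d \<and> finite F \<and> card F \<le> n}"
  then obtain A where A: "s = (\<Sum>kk\<in>A. tensor_eig lam d kk)" "A \<subseteq> multi_idx d" "finite A" "card A \<le> n" by blast
  then show "s \<le> tensor_trace lam d * c"
    using assms[of A] tensor_trace_pos[of d] by (auto simp: sum_tensor_eig intro!: mult_left_mono)
qed

lemma tail_norm_le_iff: "tail_norm lam d n \<le> e \<longleftrightarrow> tensor_trace lam d * (1 - e) \<le> top_sum lam d n"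
  unfolding tail_norm_def pos_divide_le_eq[OF tensor_trace_pos] by (auto simp: algebra_simps)

text \<open>Atoms with information at most \<open>z\<close> have probability at least
  \<open>exp (- z)\<close>, so there are at most \<open>exp z\<close> of them; keeping them all
  leaves a tail of at most \<open>e\<close>.\<close>

lemma card_large_atoms:
  assumes z: "1 - e \<le> measure (measure_pmf (multi_pmf d)) {kk. total_info d kk \<le> z}"
  shows "\<exists>n. tail_norm lam d n \<le> e \<and> real n \<le> exp z"
proof -
  define A where "A = {kk \<in> set_pmf (multi_pmf d). total_info d kk \<le> z}"
  have card: "real (card B) \<le> exp z" if B: "B \<subseteq> A" "finite B" for B
  proof -
    have "real (card B) * exp (- z) = (\<Sum>kk\<in>B. exp (- z))" by simp
    also have "\<dots> \<le> (\<Sum>kk\<in>B. pmf (multi_pmf d) kk)"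
      using B by (intro sum_mono) (auto simp: A_def pmf_multi_pmf_eq_exp)
    also have "\<dots> = measure (measure_pmf (multi_pmf d)) B"
      using B(2) by (rule measure_measure_pmf_finite[symmetric])
    also have "\<dots> \<le> 1" by simp
    finally show ?thesis by (simp add: exp_minus field_simps)
  qed
  have fin: "finite A"
  proof (rule ccontr)
    assume "infinite A"
    then obtain B where "B \<subseteq> A" "finite B" "card B = Suc (nat \<lceil>exp z\<rceil>)"
      using infinite_arbitrarily_large by blast
    then show False using card[of B] by linarith
  qed
  have "measure (measure_pmf (multi_pmf d)) {kk. total_info d kk \<le> z} = measure (measure_pmf (multi_pmf d)) A"
    by (rule measure_prob_cong_0) (auto simp: A_def set_pmf_iff)
  then have "tensor_trace lam d * (1 - e) \<le> tensor_trace lam d * measure (measure_pmf (multi_pmf d)) A"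
    using z tensor_trace_pos[of d] by simp
  also have "\<dots> \<le> top_sum lam d (card A)"
    using fin set_multi_pmf[of d] by (intro top_sum_ge) (auto simp: A_def)
  finally show ?thesis using card[of A] fin by (auto simp: tail_norm_le_iff)
qed

text \<open>Ensures that the \<open>LEAST\<close> in \<open>complexity\<close> is attained: the
  total information is finite, so a large \<open>z\<close> captures almost all mass, and
  \<open>card_large_atoms\<close> makes that a finite number of atoms.\<close>

lemma ex_tail_norm_le:
  assumes "0 < e" shows "\<exists>n. tail_norm lam d n \<le> e"
proof -
  define R where "R = distr (measure_pmf (multi_pmf d)) borel (total_info d)"
  interpret R: real_distribution R unfolding R_def by (rule prob_space.real_distribution_distr[OF measure_pmf.prob_space_axioms]) simp
  have "\<forall>\<^sub>F x in at_top. 1 - e < cdf R x"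
    using R.cdf_lim_at_top_prob assms by (intro order_tendstoD) auto
  then obtain z where "1 - e < cdf R z" unfolding eventually_at_top_linorder by blast
  moreover have "cdf R z = measure (measure_pmf (multi_pmf d)) {kk. total_info d kk \<le> z}"
    unfolding cdf_def R_def by (subst measure_distr) (auto simp: vimage_def)
  ultimately show ?thesis using card_large_atoms[of e d z] by auto
qed

lemma tail_norm_complexity:
  assumes "0 < \<epsilon>" shows "tail_norm lam d (complexity lam d \<epsilon>) \<le> \<epsilon>\<^sup>2"
  unfolding complexity_def by (rule LeastI_ex, rule ex_tail_norm_le) (use assms in simp)

text \<open>Guards the logarithm of the complexity against the argument 0: without any atoms the
  whole mass 1 is left, which exceeds \<open>\<epsilon>\<^sup>2\<close>.\<close>

lemma complexity_pos:
  assumes "0 < \<epsilon>" "\<epsilon> < 1" shows "0 < complexity lam d \<epsilon>"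
proof (rule ccontr)
  assume "\<not> 0 < complexity lam d \<epsilon>"
  then have "tail_norm lam d 0 \<le> \<epsilon>\<^sup>2" using tail_norm_complexity[OF assms(1), of d] by simp
  then have "tensor_trace lam d * (1 - \<epsilon>\<^sup>2) \<le> top_sum lam d 0" by (simp add: tail_norm_le_iff)
  also have "\<dots> \<le> tensor_trace lam d * 0" by (rule top_sum_le) auto
  finally have "1 - \<epsilon>\<^sup>2 \<le> 0" using tensor_trace_pos[of d] by (simp add: mult_le_0_iff)
  moreover have "\<epsilon>\<^sup>2 < 1" using assms by (simp add: power_less_one_iff)
  ultimately show False by simp
qed

lemma ln_complexity_le:
  assumes \<epsilon>: "0 < \<epsilon>" "\<epsilon> < 1"
    and z: "1 - \<epsilon>\<^sup>2 \<le> measure (measure_pmf (multi_pmf d)) {kk. total_info d kk \<le> z}"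
  shows "ln (real (complexity lam d \<epsilon>)) \<le> z"
proof -
  obtain n where n: "tail_norm lam d n \<le> \<epsilon>\<^sup>2" "real n \<le> exp z" using card_large_atoms[OF z] by blast
  then have "complexity lam d \<epsilon> \<le> n" unfolding complexity_def by (intro Least_le)
  then have "real (complexity lam d \<epsilon>) \<le> exp z" using n(2) by linarith
  then have "ln (real (complexity lam d \<epsilon>)) \<le> ln (exp z)"
    using complexity_pos[OF \<epsilon>, of d] by (subst ln_le_cancel_iff) auto
  then show ?thesis by simp
qed

text \<open>The converse of \<open>ln_complexity_le\<close>. An optimal set splits at
  \<open>z\<close>: its atoms beyond \<open>z\<close> have probability at most
  \<open>exp (- z)\<close> each, and there are at most as many as the complexity.\<close>

lemma measure_info_ge:
  assumes \<epsilon>: "0 < \<epsilon>" "\<epsilon> < 1"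
  shows "1 - \<epsilon>\<^sup>2 \<le> measure (measure_pmf (multi_pmf d)) {kk. total_info d kk \<le> z}
    + exp (ln (real (complexity lam d \<epsilon>)) - z)"
proof -
  define n where "n = complexity lam d \<epsilon>"
  have n: "0 < n" unfolding n_def by (rule complexity_pos[OF \<epsilon>])
  let ?P = "measure_pmf (multi_pmf d)"
  have "tensor_trace lam d * (1 - \<epsilon>\<^sup>2) \<le> top_sum lam d n"
    using tail_norm_complexity[OF \<epsilon>(1), of d] by (simp add: tail_norm_le_iff n_def)
  also have "\<dots> \<le> tensor_trace lam d * (measure ?P {kk. total_info d kk \<le> z} + real n * exp (- z))"
  proof (rule top_sum_le)
    fix A assume A: "A \<subseteq> multi_idx d" "finite A" "card A \<le> n"
    let ?B = "A \<inter> {kk. z < total_info d kk}"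
    have "measure ?P A \<le> measure ?P ({kk. total_info d kk \<le> z} \<union> ?B)"
      by (intro measure_pmf.finite_measure_mono) auto
    also have "\<dots> \<le> measure ?P {kk. total_info d kk \<le> z} + measure ?P ?B"
      by (rule measure_Un_le) auto
    also have "measure ?P ?B = (\<Sum>kk\<in>?B. pmf (multi_pmf d) kk)"
      using A(2) by (intro measure_measure_pmf_finite) auto
    also have "\<dots> \<le> (\<Sum>kk\<in>?B. exp (- z))"
    proof (rule sum_mono)
      fix kk assume kk: "kk \<in> ?B"
      show "pmf (multi_pmf d) kk \<le> exp (- z)"
      proof (cases "kk \<in> set_pmf (multi_pmf d)")
        case True
        then show ?thesis using kk by (simp add: pmf_multi_pmf_eq_exp)
      qed (simp add: set_pmf_iff)
    qed
    also have "\<dots> = real (card ?B) * exp (- z)" by simp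
    also have "\<dots> \<le> real n * exp (- z)"
      using A card_mono[of A ?B] by (intro mult_right_mono) auto
    finally show "measure ?P A \<le> measure ?P {kk. total_info d kk \<le> z} + real n * exp (- z)" by simp
  qed
  finally have "1 - \<epsilon>\<^sup>2 \<le> measure ?P {kk. total_info d kk \<le> z} + real n * exp (- z)"
    using tensor_trace_pos[of d] by simp
  also have "real n * exp (- z) = exp (ln (real n) - z)" using n by (simp add: exp_diff exp_minus field_simps)
  finally show ?thesis by (simp add: n_def)
qed

section \<open>The normalised total information and its weak limit\<close>

definition normalized_info_law :: "(nat \<Rightarrow> real) \<Rightarrow> (nat \<Rightarrow> real) \<Rightarrow> nat \<Rightarrow> real measure" where
  "normalized_info_law a b d = distr (measure_pmf (multi_pmf d)) borel (\<lambda>kk. (total_info d kk - a d) / b d)"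

lemma real_distribution_normalized_info_law: "real_distribution (normalized_info_law a b d)"
  unfolding normalized_info_law_def by (rule prob_space.real_distribution_distr[OF measure_pmf.prob_space_axioms]) simp

lemma char_total_info:
  "char (distr (measure_pmf (multi_pmf d)) borel (total_info d)) t = (\<Prod>j\<in>{1..d}. char (info_law j) t)"
proof -
  let ?P = "measure_pmf (multi_pmf d)"
  have "prob_space.indep_vars (measure_pmf (multi_pmf d)) (\<lambda>_. borel) (\<lambda>j kk. info j (kk j)) {1..d}"
  proof -
    have "prob_space.indep_vars (measure_pmf (multi_pmf d)) (\<lambda>_. count_space UNIV) (\<lambda>j kk. kk j) {1..d}"
      unfolding multi_pmf_def by (rule indep_vars_Pi_pmf) simp
    then show ?thesis
      by (rule prob_space.indep_vars_compose2[OF measure_pmf.prob_space_axioms]) simp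
  qed
  from prob_space.char_distr_sum[OF measure_pmf.prob_space_axioms this, of t]
  have "char (distr ?P borel (total_info d)) t = (\<Prod>j\<in>{1..d}. char (distr ?P borel (\<lambda>kk. info j (kk j))) t)"
    by (simp add: total_info_def[abs_def])
  also have "\<dots> = (\<Prod>j\<in>{1..d}. char (info_law j) t)"
  proof (intro prod.cong refl)
    fix j assume j: "j \<in> {1..d}"
    have "char (distr ?P borel (\<lambda>kk. info j (kk j))) t = (\<integral>kk. iexp (t * info j (kk j)) \<partial>?P)"
      unfolding char_def by (subst integral_distr) auto
    also have "\<dots> = (\<integral>k. iexp (t * info j k) \<partial>measure_pmf (map_pmf (\<lambda>kk. kk j) (multi_pmf d)))"
      by (rule integral_map_pmf[symmetric])
    also have "map_pmf (\<lambda>kk. kk j) (multi_pmf d) = index_pmf j"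
      unfolding multi_pmf_def using j by (subst Pi_pmf_component) auto
    also have "(\<integral>k. iexp (t * info j k) \<partial>measure_pmf (index_pmf j)) = char (info_law j) t"
      unfolding char_def info_law_def by (subst integral_distr) auto
    finally show "char (distr ?P borel (\<lambda>kk. info j (kk j))) t = char (info_law j) t" .
  qed
  finally show ?thesis .
qed

lemma char_normalized_info_law:
  "char (normalized_info_law a b d) t = iexp (- (a d / b d * t)) * (\<Prod>j\<in>{1..d}. char (info_law j) (t / b d))"
proof -
  define R where "R = distr (measure_pmf (multi_pmf d)) borel (total_info d)"
  have R: "real_distribution R" unfolding R_def by (rule prob_space.real_distribution_distr[OF measure_pmf.prob_space_axioms]) simp
  have "normalized_info_law a b d = distr R borel (\<lambda>x. (1 / b d) * x + - (a d / b d))"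
    unfolding normalized_info_law_def R_def by (subst distr_distr) (auto simp: comp_def diff_divide_distrib)
  then have "char (normalized_info_law a b d) t = iexp (- (a d / b d) * t) * char R (1 / b d * t)"
    by (simp only: char_distr_affine[OF R])
  then show ?thesis unfolding R_def char_total_info by simp
qed

lemma cdf_normalized_info_law:
  assumes "0 < b d"
  shows "cdf (normalized_info_law a b d) x = measure (measure_pmf (multi_pmf d)) {kk. total_info d kk \<le> a d + b d * x}"
proof -
  have "(\<lambda>kk. (total_info d kk - a d) / b d) -` {..x} = {kk. total_info d kk \<le> a d + b d * x}"
    using assms by (auto simp: field_simps)
  then show ?thesis unfolding cdf_def normalized_info_law_def by (subst measure_distr) auto
qed

text \<open>The two complexity bounds squeeze the distribution functions. Above \<open>G x\<close>,
  a level in between has a quantile beyond \<open>x\<close>, hence a log-complexity too large for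
  \<open>x\<close> to reach that level. Below, room to the left of \<open>x\<close> is traded for
  the vanishing error term.\<close>

theorem weak_conv_normalized_info_law:
  assumes b_pos: "\<And>d. 0 < b d" and b_inf: "filterlim b at_top sequentially"
    and q_mono: "\<And>x y. 0 < x \<Longrightarrow> x \<le> y \<Longrightarrow> y < 1 \<Longrightarrow> q y \<le> q x"
    and G_df: "distribution_function G"
    and q_G: "\<And>\<epsilon>. \<epsilon> \<in> {0<..<1} \<Longrightarrow> isCont q \<epsilon> \<Longrightarrow> q \<epsilon> = gen_inv G (1 - \<epsilon>\<^sup>2)"
    and asym: "\<And>\<epsilon>. \<epsilon> \<in> {0<..<1} \<Longrightarrow> isCont q \<epsilon> \<Longrightarrow>
       (\<lambda>d. (ln (real (complexity lam d \<epsilon>)) - a d - q \<epsilon> * b d) / b d) \<longlonglongrightarrow> 0"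
  shows "weak_conv_m (normalized_info_law a b) (interval_measure G)"
proof -
  have G01: "0 \<le> G x" "G x \<le> 1" for x
  proof -
    interpret M: real_distribution "interval_measure G" by (rule distribution_function_interval_measure[OF G_df])
    show "0 \<le> G x" "G x \<le> 1"
      using M.cdf_nonneg[of x] M.cdf_bounded_prob[of x] distribution_function_interval_measure(2)[OF G_df] by auto
  qed
  interpret rcm: right_continuous_mono G 0 1
    using G_df by unfold_locales (auto simp: distribution_function_def)
  \<comment> \<open>The Galois connection between a right-continuous distribution function and its
    generalised inverse, valid for levels strictly between 0 and 1.\<close>
  have q_le: "q \<epsilon> \<le> x \<longleftrightarrow> 1 - \<epsilon>\<^sup>2 \<le> G x" if "0 < \<epsilon>" "\<epsilon> < 1" "isCont q \<epsilon>" for \<epsilon> x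
  proof -
    have "\<epsilon>\<^sup>2 < 1" "0 < \<epsilon>\<^sup>2" using that by (auto simp: power_less_one_iff)
    then show ?thesis using rcm.pseudoinverse[of "1 - \<epsilon>\<^sup>2" x] q_G[of \<epsilon>] that by (simp add: gen_inv_def)
  qed
  have lim: "(\<lambda>d. (ln (real (complexity lam d \<epsilon>)) - a d) / b d) \<longlonglongrightarrow> q \<epsilon>"
    if "0 < \<epsilon>" "\<epsilon> < 1" "isCont q \<epsilon>" for \<epsilon>
  proof -
    have "(\<lambda>d. (ln (real (complexity lam d \<epsilon>)) - a d - q \<epsilon> * b d) / b d + q \<epsilon>) \<longlonglongrightarrow> 0 + q \<epsilon>"
      using that by (intro tendsto_add asym tendsto_const) auto
    moreover have "(ln (real (complexity lam d \<epsilon>)) - a d - q \<epsilon> * b d) / b d + q \<epsilon> = (ln (real (complexity lam d \<epsilon>)) - a d) / b d" for d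
      using b_pos[of d] by (simp add: field_simps)
    ultimately show ?thesis by simp
  qed
  define F where "F d x = cdf (normalized_info_law a b d) x" for d x
  have F_eq: "F d x = measure (measure_pmf (multi_pmf d)) {kk. total_info d kk \<le> a d + b d * x}" for d x
    unfolding F_def by (rule cdf_normalized_info_law[OF b_pos])
  have F01: "0 \<le> F d x" "F d x \<le> 1" for d x unfolding F_eq by auto
  have "(\<lambda>d. F d x) \<longlonglongrightarrow> G x" if cont: "isCont G x" for x
  proof (rule order_tendstoI)
    fix y assume y: "G x < y"
    show "\<forall>\<^sub>F d in sequentially. F d x < y"
    proof (cases "1 < y")
      case True
      then show ?thesis using F01(2)[of _ x] by (intro always_eventually allI) (auto intro: le_less_trans)
    next
      case False
      obtain \<epsilon> where \<epsilon>: "0 < \<epsilon>" "\<epsilon> < 1" "isCont q \<epsilon>" "G x < 1 - \<epsilon>\<^sup>2" "1 - \<epsilon>\<^sup>2 < y"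
        using q_mono by (rule obtain_isCont_one_minus_square[of q "G x" y]) (use G01 y False in auto)
      have "x < q \<epsilon>" using q_le[OF \<epsilon>(1-3), of x] \<epsilon>(4) by simp
      then have "\<forall>\<^sub>F d in sequentially. x < (ln (real (complexity lam d \<epsilon>)) - a d) / b d"
        using lim[OF \<epsilon>(1-3)] by (intro order_tendstoD)
      then show ?thesis
      proof (rule eventually_mono)
        fix d assume "x < (ln (real (complexity lam d \<epsilon>)) - a d) / b d"
        then have "a d + b d * x < ln (real (complexity lam d \<epsilon>))" using b_pos[of d] by (simp add: field_simps)
        then have "\<not> 1 - \<epsilon>\<^sup>2 \<le> F d x" using ln_complexity_le[OF \<epsilon>(1,2), of d "a d + b d * x"] unfolding F_eq by linarith
        then show "F d x < y" using \<epsilon>(5) by simp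
      qed
    qed
  next
    fix y assume y: "y < G x"
    show "\<forall>\<^sub>F d in sequentially. y < F d x"
    proof (cases "y < 0")
      case True
      then show ?thesis using F01(1)[of _ x] by (intro always_eventually allI) (auto intro: less_le_trans)
    next
      case False
      \<comment> \<open>Continuity at \<open>x\<close> enters here: it provides a point
        \<open>x'\<close> strictly to the left at which \<open>G\<close> still exceeds
        \<open>y\<close>.\<close>
      have "(G \<longlongrightarrow> G x) (at_left x)" using cont by (simp add: continuous_at_imp_continuous_at_within continuous_within[symmetric])
      then have "\<forall>\<^sub>F x' in at_left x. y < G x'" using y by (rule order_tendstoD)
      then obtain w where w: "w < x" "\<And>x'. w < x' \<Longrightarrow> x' < x \<Longrightarrow> y < G x'"
        unfolding eventually_at_left_field by auto
      define x' where "x' = (w + x) / 2"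
      have x': "x' < x" "y < G x'" using w by (auto simp: x'_def)
      obtain \<epsilon> where \<epsilon>: "0 < \<epsilon>" "\<epsilon> < 1" "isCont q \<epsilon>" "y < 1 - \<epsilon>\<^sup>2" "1 - \<epsilon>\<^sup>2 < G x'"
        using q_mono by (rule obtain_isCont_one_minus_square[of q y "G x'"]) (use G01 x' False in auto)
      \<comment> \<open>Half of the gap absorbs the error in the asymptotics of the complexity; the
        other half, times \<open>b d\<close>, makes the exponential error vanish.\<close>
      define \<delta> where "\<delta> = (x - x') / 2"
      have \<delta>: "0 < \<delta>" using x' by (simp add: \<delta>_def)
      have "q \<epsilon> < x' + \<delta>" using q_le[OF \<epsilon>(1-3), of x'] \<epsilon>(5) \<delta> by simp
      then have e1: "\<forall>\<^sub>F d in sequentially. (ln (real (complexity lam d \<epsilon>)) - a d) / b d < x' + \<delta>"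
        using lim[OF \<epsilon>(1-3)] by (intro order_tendstoD)
      have "filterlim (\<lambda>d. \<delta> * b d) at_top sequentially"
        using b_inf \<delta> by (intro filterlim_tendsto_pos_mult_at_top[OF tendsto_const]) auto
      then have "((\<lambda>d. exp (- (\<delta> * b d))) \<longlongrightarrow> 0) sequentially"
        by (intro filterlim_compose[OF exp_at_bot] filterlim_compose[OF filterlim_uminus_at_bot_at_top])
      then have e2: "\<forall>\<^sub>F d in sequentially. exp (- (\<delta> * b d)) < 1 - \<epsilon>\<^sup>2 - y"
        using \<epsilon>(4) by (intro order_tendstoD) auto
      from e1 e2 show ?thesis
      proof eventually_elim
        case (elim d)
        have "ln (real (complexity lam d \<epsilon>)) < a d + b d * (x' + \<delta>)"
          using elim(1) b_pos[of d] by (simp add: field_simps)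
        moreover have "a d + b d * (x' + \<delta>) - (a d + b d * x) = - (\<delta> * b d)"
          by (simp add: \<delta>_def field_simps)
        ultimately have "exp (ln (real (complexity lam d \<epsilon>)) - (a d + b d * x)) \<le> exp (- (\<delta> * b d))" by simp
        then show ?case using measure_info_ge[OF \<epsilon>(1,2), of d "a d + b d * x"] elim(2) unfolding F_eq by linarith
      qed
    qed
  qed
  then show ?thesis
    unfolding weak_conv_m_def weak_conv_def distribution_function_interval_measure(2)[OF G_df] F_def by blast
qed

end

lemma char_point_mass:
  assumes "real_distribution M" "AE x in M. x = c"
  shows "char M t = iexp (t * c)"
proof -
  interpret M: real_distribution M by fact
  have "char M t = (\<integral>x. iexp (t * c) \<partial>M)"
    unfolding char_def by (rule integral_cong_AE) (use assms(2) in \<open>auto elim!: eventually_mono\<close>)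
  then show ?thesis by (simp add: M.prob_space[simplified])
qed

lemma degenerate_df_if_AE_eq:
  assumes G: "distribution_function G" and AE: "AE x in interval_measure G. x = c"
  shows "degenerate_df G"
proof -
  interpret M: real_distribution "interval_measure G" by (rule distribution_function_interval_measure[OF G])
  have "G x = (if x \<ge> c then 1 else 0)" for x
  proof -
    have "G x = measure (interval_measure G) {..x}"
      using distribution_function_interval_measure(2)[OF G] by (metis cdf_def2)
    also have "\<dots> = (if x \<ge> c then 1 else 0)"
    proof (cases "c \<le> x")
      case True
      have "AE y in interval_measure G. y \<in> {..x}" using AE by (rule eventually_mono) (use True in simp)
      then show ?thesis using True by (simp add: M.prob_eq_1)
    next
      case False
      have "AE y in interval_measure G. y \<notin> {..x}" using AE by (rule eventually_mono) (use False in simp)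
      then show ?thesis using False by (simp add: M.prob_eq_0)
    qed
    finally show ?thesis .
  qed
  then show ?thesis unfolding degenerate_df_def by blast
qed

theorem theorem2:
  fixes lam :: "nat \<Rightarrow> nat \<Rightarrow> real"
    and a b :: "nat \<Rightarrow> real"
    and q G :: "real \<Rightarrow> real"
  assumes eig: "\<And>j. j \<ge> 1 \<Longrightarrow> eigen_seq (lam j)"
    and b_pos: "\<And>d. b d > 0"
    and b_inf: "filterlim b at_top sequentially"
    and negl: "\<And>\<tau>. \<tau> > 0 \<Longrightarrow>
       (\<lambda>d. Max ((\<lambda>j. \<Sum>k. normalized_eig lam j k *
              indicator {x. x < exp (- \<tau> * b d)} (normalized_eig lam j k)) ` {1..d}))
       \<longlonglongrightarrow> 0"
    and q_mono: "\<And>x y. 0 < x \<Longrightarrow> x \<le> y \<Longrightarrow> y < 1 \<Longrightarrow> q y \<le> q x"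
    and G_df: "distribution_function G"
    and q_G: "\<And>\<epsilon>. \<epsilon> \<in> {0<..<1} \<Longrightarrow> isCont q \<epsilon> \<Longrightarrow> q \<epsilon> = gen_inv G (1 - \<epsilon>\<^sup>2)"
    and asym: "\<And>\<epsilon>. \<epsilon> \<in> {0<..<1} \<Longrightarrow> isCont q \<epsilon> \<Longrightarrow>
       (\<lambda>d. (ln (real (complexity lam d \<epsilon>)) - a d - q \<epsilon> * b d) / b d) \<longlonglongrightarrow> 0"
  shows "self_decomposable G
    \<and> (\<exists>\<gamma> \<sigma>2 L. levy_representation G \<gamma> \<sigma>2 L)
    \<and> (\<forall>\<gamma> \<sigma>2 L. levy_representation G \<gamma> \<sigma>2 L \<longrightarrow> (\<forall>x<0. L x = 0))
    \<and> (\<not> degenerate_df G \<longrightarrow> (\<lambda>d. b (Suc d) / b d) \<longlonglongrightarrow> 1)"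
proof -
  interpret T: tensor_product lam by unfold_locales (rule eig)
  interpret N: normalized_sums T.info_law a b "T.normalized_info_law a b" "interval_measure G"
  proof (rule normalized_sums.intro)
    show "weak_conv_m (T.normalized_info_law a b) (interval_measure G)"
      by (rule T.weak_conv_normalized_info_law[OF b_pos b_inf q_mono G_df q_G asym])
    show "\<forall>\<^sub>F d in sequentially. \<forall>j\<in>{1..d}. measure (T.info_law j) {x. \<tau> * b d < x} \<le> \<epsilon>"
      if \<tau>: "0 < \<tau>" and \<epsilon>: "0 < \<epsilon>" for \<tau> \<epsilon>
      using order_tendstoD(2)[OF negl[OF \<tau>] \<epsilon>]
    proof (rule eventually_mono, intro ballI)
      fix d j
      let ?S = "(\<lambda>j. \<Sum>k. normalized_eig lam j k * indicator {x. x < exp (- \<tau> * b d)} (normalized_eig lam j k))"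
      assume d: "Max (?S ` {1..d}) < \<epsilon>" and j: "j \<in> {1..d}"
      have "measure (T.info_law j) {x. \<tau> * b d < x} = ?S j"
        using T.measure_info_law_gt[of j "\<tau> * b d"] j \<tau> b_pos[of d] by simp
      also have "\<dots> \<le> Max (?S ` {1..d})" using j by (intro Max_ge) auto
      finally show "measure (T.info_law j) {x. \<tau> * b d < x} \<le> \<epsilon>" using d by simp
    qed
  qed (use b_pos b_inf in \<open>auto simp: T.real_distribution_info_law T.info_law_nonneg T.char_normalized_info_law
      T.real_distribution_normalized_info_law distribution_function_interval_measure[OF G_df]\<close>)
  obtain \<gamma> Q where Q: "finite_borel_measure Q" "emeasure Q {..<0} = 0"
    "\<And>t. char (interval_measure G) t = exp (\<i> * complex_of_real (\<gamma> * t) + (\<integral>x. lk_kernel t x \<partial>Q))"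
    using N.levy_khintchine by blast
  obtain L where L: "levy_representation G \<gamma> (measure Q {0}) L" "\<forall>x<0. L x = 0"
    using levy_representationI[OF Q] by blast
  have "self_decomposable G"
  proof (rule self_decomposableI_char[OF G_df])
    fix \<alpha> :: real assume \<alpha>: "1 < \<alpha>"
    show "\<exists>H. real_distribution H \<and> (\<forall>t. char (interval_measure G) t = char (interval_measure G) (t / \<alpha>) * char H t)"
    proof (cases "\<exists>c. AE x in interval_measure G. x = c")
      case True
      then obtain c where c: "AE x in interval_measure G. x = c" by blast
      define H where "H = return borel (c - c / \<alpha>)"
      have H: "real_distribution H"
        unfolding H_def by (auto simp: real_distribution_def real_distribution_axioms_def intro: prob_space_return)
      have "char H t = iexp (t * (c - c / \<alpha>))" for t
        by (rule char_point_mass[OF H], unfold H_def, subst AE_return) auto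
      then have "char (interval_measure G) t = char (interval_measure G) (t / \<alpha>) * char H t" for t
        by (simp add: char_point_mass[OF N.M c] exp_add[symmetric] algebra_simps)
      then show ?thesis using H by blast
    next
      case False
      then show ?thesis using N.char_factorization \<alpha> by blast
    qed
  qed
  moreover have "\<forall>\<gamma>' \<sigma>2 L'. levy_representation G \<gamma>' \<sigma>2 L' \<longrightarrow> (\<forall>x<0. L' x = 0)"
    using levy_spectral_function_vanishes_negative[OF L(1)] L(2) by blast
  moreover have "(\<lambda>d. b (Suc d) / b d) \<longlonglongrightarrow> 1" if "\<not> degenerate_df G"
    using that degenerate_df_if_AE_eq[OF G_df] by (intro N.b_ratio_tendsto_1) blast
  ultimately show ?thesis using L(1) by blast
qed

end
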